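(* Let $M$ be a compact orientable smooth manifold of finite dimension $d$, let $f:M\to M$ be a $C^1$-diffeomorphism, let $\mu$ be an $f$-invariant Borel probability measure on $M$, and let $\omega$ be a smooth volume form on $M$. Let $g\in\mathcal{M}_\omega$ be a metric satisfying $\alpha_k^g(\mathrm{d}f_x)>\alpha_{k+1}^g(\mathrm{d}f_x)$ for all $x\in M$ and some $k\in\{1,2,\dots,d-1\}$. Then all directional derivatives of $s_{k,f,\mu}$ at $g$ exist. For any $h\in T_g\mathcal{M}_\omega$, the directional derivative of $s_{k,f,\mu}$ at $g$ in direction $h$ is given by $$\partial_hs_{k,f,\mu}(g)=\int_M\bigl\langle Q^{\mathrm{l}}_{k,x}-Q^{\mathrm{r}}_{k,x},\,h_x\bigr\rangle_{g_x}\,\mathrm{d}\mu(x),$$ where $Q^{\mathrm{l}}_{k,x}$ (respectively $Q^{\mathrm{r}}_{k,x}$) denotes the orthogonal projection in $(T_xM,g_x)$ onto the subspace spanned by the first $k$ left singular vectors of $\mathrm{d}f_{f^{-1}x}$ (respectively the first $k$ right singular vectors of $\mathrm{d}f_x$).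
   Context: $\mathcal{M}$ is the set of all $C^\infty$ Riemannian metrics on $M$ (open in the Fréchet space $\mathcal{S}^0_2M$ of smooth symmetric $(0,2)$-tensor fields); $\mathcal{M}_\omega\subset\mathcal{M}$ is the submanifold of metrics inducing the volume form $\omega$, with tangent space $T_g\mathcal{M}_\omega=\{h\in\mathcal{S}^0_2M:\operatorname{tr}(g_x^{-1}h_x)=0\ \forall x\in M\}$. $\alpha_1^g(\mathrm{d}f_x)\ge\dots\ge\alpha_d^g(\mathrm{d}f_x)>0$ are the singular values of $\mathrm{d}f_x:(T_xM,g_x)\to(T_{fx}M,g_{fx})$, and $s_{k,f,\mu}:\mathcal{M}_\omega\to\mathbb{R}$ is $s_{k,f,\mu}(g)=\int_M\log\prod_{i=1}^k\alpha_i^g(\mathrm{d}f_x)\,\mathrm{d}\mu(x)$. The directional derivative $\partial_hs_{k,f,\mu}(g)$ is $\frac{\mathrm{d}}{\mathrm{d}t}\big|_{t=0}s_{k,f,\mu}(\gamma(t))$ for a smooth curve $\gamma$ in $\mathcal{M}_\omega$ with $\gamma(0)=g$, $\dot\gamma(0)=h$. Singular vectors are taken with respect to $g$: right singular vectors of $\mathrm{d}f_x$ are eigenvectors of $(\mathrm{d}f_x)^*\mathrm{d}f_x$ in $T_xM$, left singular vectors of $\mathrm{d}f_{f^{-1}x}$ are eigenvectors of $\mathrm{d}f_{f^{-1}x}(\mathrm{d}f_{f^{-1}x})^*$ in $T_xM$ (adjoints with respect to $g$), and "first $k$" refers to the $k$ largest singular values. A $g_x$-self-adjoint linear map $Q:T_xM\to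 T_xM$ is identified with the symmetric $(0,2)$-tensor $(v,w)\mapsto g_x(Qv,w)$, and for symmetric $(0,2)$-tensors $a,b$ on $T_xM$, $\langle a,b\rangle_{g_x}=\operatorname{tr}(g_x^{-1}a\,g_x^{-1}b)$ in a local matrix representation (independent of the chart).
   Formalization: The derivative is proved to be 1/2 times the stated integral; without the factor 1/2 the formula is false, e.g. for the toral automorphism with rows (3,1),(2,1), flat g, μ the point mass at 0, k=1, h=diag(1,-1). *)

theory Defs
  imports "HOL-Probability.Probability"
begin

section \<open>Differentiability classes on open subsets of Euclidean space\<close>

text \<open>Both notions are only meant for open \<open>S\<close>: the derivatives are taken at interior points.\<close>

fun Ck_on :: "nat \<Rightarrow> 'a::euclidean_space set \<Rightarrow> ('a \<Rightarrow> 'b::real_normed_vector) \<Rightarrow> bool" where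
  "Ck_on 0 S F \<longleftrightarrow> continuous_on S F"
| "Ck_on (Suc n) S F \<longleftrightarrow>
     F differentiable_on S \<and> (\<forall>b\<in>Basis. Ck_on n S (\<lambda>x. frechet_derivative F (at x) b))"

definition smooth_on :: "'a::euclidean_space set \<Rightarrow> ('a \<Rightarrow> 'b::real_normed_vector) \<Rightarrow> bool" where
  "smooth_on S F \<longleftrightarrow> (\<forall>n. Ck_on n S F)"

fun iterated_partial :: "'a list \<Rightarrow> ('a::euclidean_space \<Rightarrow> 'b::real_normed_vector) \<Rightarrow> 'a \<Rightarrow> 'b" where
  "iterated_partial [] F = F"
| "iterated_partial (b # bs) F = (\<lambda>x. frechet_derivative (iterated_partial bs F) (at x) b)"

section \<open>Smooth manifolds\<close>

text \<open>The manifold is the whole type \<open>'m\<close>, its dimension is \<open>CARD('n)\<close>, and its smooth structure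
  is the one generated by a (not necessarily maximal) atlas. A chart is a pair of its domain and
  its coordinate map.\<close>

type_synonym ('m, 'n) chart = "'m set \<times> ('m \<Rightarrow> real ^ 'n)"

abbreviation chart_dom :: "('m, 'n::finite) chart \<Rightarrow> 'm set" where "chart_dom \<equiv> fst"

abbreviation chart_map :: "('m, 'n::finite) chart \<Rightarrow> 'm \<Rightarrow> real ^ 'n" where "chart_map \<equiv> snd"

definition chart_inv :: "('m, 'n::finite) chart \<Rightarrow> real ^ 'n \<Rightarrow> 'm" where
  "chart_inv c = inv_into (chart_dom c) (chart_map c)"

definition chart_range :: "('m, 'n::finite) chart \<Rightarrow> (real ^ 'n) set" where
  "chart_range c = chart_map c ` chart_dom c"

definition is_chart :: "('m::topological_space, 'n::finite) chart \<Rightarrow> bool" where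
  "is_chart c \<longleftrightarrow> open (chart_dom c) \<and> open (chart_range c) \<and>
     homeomorphism (chart_dom c) (chart_range c) (chart_map c) (chart_inv c)"

definition smooth_atlas :: "('m::topological_space, 'n::finite) chart set \<Rightarrow> bool" where
  "smooth_atlas \<A> \<longleftrightarrow> (\<forall>c\<in>\<A>. is_chart c) \<and> (\<Union>c\<in>\<A>. chart_dom c) = UNIV \<and>
     (\<forall>c\<in>\<A>. \<forall>c'\<in>\<A>.
        smooth_on (chart_map c ` (chart_dom c \<inter> chart_dom c')) (chart_map c' \<circ> chart_inv c))"

definition orientable :: "('m::topological_space, 'n::finite) chart set \<Rightarrow> bool" where
  "orientable \<A> \<longleftrightarrow> (\<exists>\<B>. smooth_atlas \<B> \<and> smooth_atlas (\<A> \<union> \<B>) \<and>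
     (\<forall>c\<in>\<B>. \<forall>c'\<in>\<B>. \<forall>y \<in> chart_map c ` (chart_dom c \<inter> chart_dom c').
        det (jacobian (chart_map c' \<circ> chart_inv c) (at y)) > 0))"

definition C1_map :: "('m::topological_space, 'n::finite) chart set \<Rightarrow> ('m \<Rightarrow> 'm) \<Rightarrow> bool" where
  "C1_map \<A> f \<longleftrightarrow> continuous_on UNIV f \<and>
     (\<forall>c\<in>\<A>. \<forall>c'\<in>\<A>.
        Ck_on 1 (chart_map c ` (chart_dom c \<inter> f -` chart_dom c')) (chart_map c' \<circ> f \<circ> chart_inv c))"

definition C1_diffeomorphism ::
    "('m::topological_space, 'n::finite) chart set \<Rightarrow> ('m \<Rightarrow> 'm) \<Rightarrow> bool" where
  "C1_diffeomorphism \<A> f \<longleftrightarrow> bij f \<and> C1_map \<A> f \<and> C1_map \<A> (inv f)"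

section \<open>Tangent spaces, differentials and tensor fields\<close>

text \<open>At every point \<open>x\<close> one chart around \<open>x\<close> is fixed once and for all. The tangent space at \<open>x\<close>
  is identified with \<open>real ^ 'n\<close> by means of this chart; in particular a (0,2)-tensor at \<open>x\<close> is
  given by its matrix in the coordinate basis of the chart. No regularity in \<open>x\<close> of the choice is
  assumed: smoothness of a field is tested after transporting it to the charts of the atlas.\<close>

definition pref_chart :: "('m, 'n::finite) chart set \<Rightarrow> 'm \<Rightarrow> ('m, 'n) chart" where
  "pref_chart \<A> x = (SOME c. c \<in> \<A> \<and> x \<in> chart_dom c)"

definition tangent_map ::
    "('m, 'n::finite) chart set \<Rightarrow> ('m \<Rightarrow> 'm) \<Rightarrow> 'm \<Rightarrow> real ^ 'n \<Rightarrow> real ^ 'n" where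
  "tangent_map \<A> f x =
     frechet_derivative (chart_map (pref_chart \<A> (f x)) \<circ> f \<circ> chart_inv (pref_chart \<A> x))
       (at (chart_map (pref_chart \<A> x) x))"

text \<open>Matrix whose columns are the coordinate vectors of the chart \<open>c\<close> at the point with
  coordinates \<open>y\<close>, as elements of the tangent space at that point.\<close>

definition frame_matrix :: "('m, 'n::finite) chart set \<Rightarrow> ('m, 'n) chart \<Rightarrow> real ^ 'n \<Rightarrow> real ^ 'n ^ 'n" where
  "frame_matrix \<A> c y = jacobian (chart_map (pref_chart \<A> (chart_inv c y)) \<circ> chart_inv c) (at y)"

type_synonym ('m, 'n) tensor_field = "'m \<Rightarrow> real ^ 'n ^ 'n"

definition local_tensor ::
    "('m, 'n::finite) chart set \<Rightarrow> ('m, 'n) chart \<Rightarrow> ('m, 'n) tensor_field \<Rightarrow> real ^ 'n \<Rightarrow> real ^ 'n ^ 'n" where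
  "local_tensor \<A> c a y =
     transpose (frame_matrix \<A> c y) ** a (chart_inv c y) ** frame_matrix \<A> c y"

definition sym_tensors :: "('m, 'n::finite) chart set \<Rightarrow> ('m, 'n) tensor_field set" where
  "sym_tensors \<A> = {a. (\<forall>x. transpose (a x) = a x) \<and>
     (\<forall>c\<in>\<A>. smooth_on (chart_range c) (local_tensor \<A> c a))}"

definition ginner :: "real ^ 'n::finite ^ 'n \<Rightarrow> real ^ 'n \<Rightarrow> real ^ 'n \<Rightarrow> real" where
  "ginner G v w = v \<bullet> (G *v w)"

definition metrics :: "('m, 'n::finite) chart set \<Rightarrow> ('m, 'n) tensor_field set" where
  "metrics \<A> = {g \<in> sym_tensors \<A>. \<forall>x v. v \<noteq> 0 \<longrightarrow> ginner (g x) v v > 0}"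

section \<open>Volume forms\<close>

definition volume_form ::
    "('m, 'n::finite) chart set \<Rightarrow> ('m \<Rightarrow> ('n \<Rightarrow> real ^ 'n) \<Rightarrow> real) \<Rightarrow> bool" where
  "volume_form \<A> \<omega> \<longleftrightarrow>
     (\<forall>x v i. linear (\<lambda>u. \<omega> x (v(i := u)))) \<and>
     (\<forall>x v i j. i \<noteq> j \<and> v i = v j \<longrightarrow> \<omega> x v = 0) \<and>
     (\<forall>x. \<exists>v. \<omega> x v \<noteq> 0) \<and>
     (\<forall>c\<in>\<A>. smooth_on (chart_range c)
        (\<lambda>y. \<omega> (chart_inv c y) (\<lambda>i. column i (frame_matrix \<A> c y))))"

text \<open>The manifold is oriented by \<open>\<omega>\<close>; the volume form induced by \<open>g\<close> is then the one taking the
  value 1 on positively oriented \<open>g\<close>-orthonormal frames.\<close>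

definition metrics_inducing ::
    "('m, 'n::finite) chart set \<Rightarrow> ('m \<Rightarrow> ('n \<Rightarrow> real ^ 'n) \<Rightarrow> real) \<Rightarrow> ('m, 'n) tensor_field set" where
  "metrics_inducing \<A> \<omega> = {g \<in> metrics \<A>.
     \<forall>x v. (\<forall>i j. ginner (g x) (v i) (v j) = (if i = j then 1 else 0)) \<and> \<omega> x v > 0 \<longrightarrow> \<omega> x v = 1}"

definition tangent_metrics_inducing ::
    "('m, 'n::finite) chart set \<Rightarrow> ('m, 'n) tensor_field \<Rightarrow> ('m, 'n) tensor_field set" where
  "tangent_metrics_inducing \<A> g = {h \<in> sym_tensors \<A>. \<forall>x. trace (matrix_inv (g x) ** h x) = 0}"

section \<open>Smooth curves and directional derivatives in the space of tensor fields\<close>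

text \<open>Convergence in the Frechet topology: uniform convergence of all partial derivatives of the
  local representations on compact subsets of the charts.\<close>

definition tensor_tendsto ::
    "('m, 'n::finite) chart set \<Rightarrow> ('b \<Rightarrow> ('m, 'n) tensor_field) \<Rightarrow> ('m, 'n) tensor_field \<Rightarrow> 'b filter \<Rightarrow> bool" where
  "tensor_tendsto \<A> A a F \<longleftrightarrow>
     (\<forall>c\<in>\<A>. \<forall>K bs. compact K \<and> K \<subseteq> chart_range c \<and> set bs \<subseteq> Basis \<longrightarrow>
        uniform_limit K (\<lambda>s. iterated_partial bs (local_tensor \<A> c (A s)))
          (iterated_partial bs (local_tensor \<A> c a)) F)"

definition tensor_curve_derivative ::
    "('m, 'n::finite) chart set \<Rightarrow> (real \<Rightarrow> ('m, 'n) tensor_field) \<Rightarrow> ('m, 'n) tensor_field \<Rightarrow> real \<Rightarrow> bool" where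
  "tensor_curve_derivative \<A> \<gamma> a t \<longleftrightarrow>
     tensor_tendsto \<A> (\<lambda>s x. (\<gamma> (t + s) x - \<gamma> t x) /\<^sub>R s) a (at 0)"

definition smooth_tensor_curve ::
    "('m, 'n::finite) chart set \<Rightarrow> real set \<Rightarrow> (real \<Rightarrow> ('m, 'n) tensor_field) \<Rightarrow> bool" where
  "smooth_tensor_curve \<A> I \<gamma> \<longleftrightarrow>
     (\<exists>\<Gamma> :: nat \<Rightarrow> real \<Rightarrow> ('m, 'n) tensor_field. \<Gamma> 0 = \<gamma> \<and>
        (\<forall>n. \<forall>t\<in>I. \<Gamma> n t \<in> sym_tensors \<A> \<and> tensor_curve_derivative \<A> (\<Gamma> n) (\<Gamma> (Suc n) t) t))"

definition smooth_curve_through ::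
    "('m, 'n::finite) chart set \<Rightarrow> ('m, 'n) tensor_field set \<Rightarrow> ('m, 'n) tensor_field \<Rightarrow> ('m, 'n) tensor_field
      \<Rightarrow> (real \<Rightarrow> ('m, 'n) tensor_field) \<Rightarrow> bool" where
  "smooth_curve_through \<A> N g h \<gamma> \<longleftrightarrow>
     (\<exists>\<epsilon>>0. smooth_tensor_curve \<A> {-\<epsilon><..<\<epsilon>} \<gamma> \<and> (\<forall>t\<in>{-\<epsilon><..<\<epsilon>}. \<gamma> t \<in> N)) \<and>
     \<gamma> 0 = g \<and> tensor_curve_derivative \<A> \<gamma> h 0"

text \<open>The derivative along smooth curves in \<open>N\<close> through \<open>g\<close> with velocity \<open>h\<close> has to exist and to be
  the same number \<open>D\<close> for every such curve; the first conjunct excludes the vacuous case.\<close>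

definition has_directional_derivative ::
    "('m, 'n::finite) chart set \<Rightarrow> ('m, 'n) tensor_field set \<Rightarrow> (('m, 'n) tensor_field \<Rightarrow> real)
      \<Rightarrow> ('m, 'n) tensor_field \<Rightarrow> ('m, 'n) tensor_field \<Rightarrow> real \<Rightarrow> bool" where
  "has_directional_derivative \<A> N F g h D \<longleftrightarrow>
     (\<exists>\<gamma>. smooth_curve_through \<A> N g h \<gamma>) \<and>
     (\<forall>\<gamma>. smooth_curve_through \<A> N g h \<gamma> \<longrightarrow> ((\<lambda>t. F (\<gamma> t)) has_real_derivative D) (at 0))"

section \<open>Singular values and singular vectors\<close>

text \<open>Here \<open>L\<close> is a linear map between two copies of \<open>real ^ 'n\<close> with the inner products given by the
  Gram matrices \<open>G\<close> (domain) and \<open>G'\<close> (codomain).\<close>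

definition metric_adjoint ::
    "real ^ 'n::finite ^ 'n \<Rightarrow> real ^ 'n ^ 'n \<Rightarrow> (real ^ 'n \<Rightarrow> real ^ 'n) \<Rightarrow> real ^ 'n \<Rightarrow> real ^ 'n" where
  "metric_adjoint G G' L = (THE L'. \<forall>v w. ginner G' (L v) w = ginner G v (L' w))"

text \<open>Eigenvalues of a diagonalizable map, repeated according to the dimension of the eigenspace.\<close>

definition eigenvalue_mset :: "('a::euclidean_space \<Rightarrow> 'a) \<Rightarrow> real multiset" where
  "eigenvalue_mset T = (\<Sum>l\<in>{l. \<exists>v. v \<noteq> 0 \<and> T v = l *\<^sub>R v}. replicate_mset (dim {v. T v = l *\<^sub>R v}) l)"

text \<open>\<open>singular_value i\<close> is the \<open>i\<close>-th largest singular value, counted from \<open>i = 1\<close>.\<close>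

definition singular_value ::
    "nat \<Rightarrow> real ^ 'n::finite ^ 'n \<Rightarrow> real ^ 'n ^ 'n \<Rightarrow> (real ^ 'n \<Rightarrow> real ^ 'n) \<Rightarrow> real" where
  "singular_value i G G' L =
     rev (sorted_list_of_multiset (image_mset sqrt (eigenvalue_mset (metric_adjoint G G' L \<circ> L)))) ! (i - 1)"

text \<open>Spans of all singular vectors belonging to the first \<open>k\<close> singular values; they have
  dimension \<open>k\<close> if the \<open>k\<close>-th singular value is larger than the next one.\<close>

definition right_singular_space ::
    "nat \<Rightarrow> real ^ 'n::finite ^ 'n \<Rightarrow> real ^ 'n ^ 'n \<Rightarrow> (real ^ 'n \<Rightarrow> real ^ 'n) \<Rightarrow> (real ^ 'n) set" where
  "right_singular_space k G G' L =
     span {v. \<exists>i\<in>{1..k}. metric_adjoint G G' L (L v) = (singular_value i G G' L)\<^sup>2 *\<^sub>R v}"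

definition left_singular_space ::
    "nat \<Rightarrow> real ^ 'n::finite ^ 'n \<Rightarrow> real ^ 'n ^ 'n \<Rightarrow> (real ^ 'n \<Rightarrow> real ^ 'n) \<Rightarrow> (real ^ 'n) set" where
  "left_singular_space k G G' L =
     span {v. \<exists>i\<in>{1..k}. L (metric_adjoint G G' L v) = (singular_value i G G' L)\<^sup>2 *\<^sub>R v}"

definition orth_projection :: "real ^ 'n::finite ^ 'n \<Rightarrow> (real ^ 'n) set \<Rightarrow> real ^ 'n \<Rightarrow> real ^ 'n" where
  "orth_projection G V v = (THE u. u \<in> V \<and> (\<forall>w\<in>V. ginner G (v - u) w = 0))"

text \<open>Matrix of the tensor \<open>(v, w) \<mapsto> G(Q v, w)\<close>.\<close>

definition tensor_of_map :: "real ^ 'n::finite ^ 'n \<Rightarrow> (real ^ 'n \<Rightarrow> real ^ 'n) \<Rightarrow> real ^ 'n ^ 'n" where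
  "tensor_of_map G Q = (\<chi> i j. ginner G (Q (axis i 1)) (axis j 1))"

definition tensor_inner :: "real ^ 'n::finite ^ 'n \<Rightarrow> real ^ 'n ^ 'n \<Rightarrow> real ^ 'n ^ 'n \<Rightarrow> real" where
  "tensor_inner G a b = trace (matrix_inv G ** a ** matrix_inv G ** b)"

section \<open>The functional and the projections\<close>

text \<open>\<open>\<alpha>\<^sub>i\<^sup>g(df\<^sub>x)\<close>\<close>

definition sv ::
    "('m, 'n::finite) chart set \<Rightarrow> ('m \<Rightarrow> 'm) \<Rightarrow> ('m, 'n) tensor_field \<Rightarrow> nat \<Rightarrow> 'm \<Rightarrow> real" where
  "sv \<A> f g i x = singular_value i (g x) (g (f x)) (tangent_map \<A> f x)"

definition s_functional ::
    "('m, 'n::finite) chart set \<Rightarrow> nat \<Rightarrow> ('m \<Rightarrow> 'm) \<Rightarrow> 'm measure \<Rightarrow> ('m, 'n) tensor_field \<Rightarrow> real" where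
  "s_functional \<A> k f \<mu> g = (\<integral>x. ln (\<Prod>i=1..k. sv \<A> f g i x) \<partial>\<mu>)"

text \<open>Singular values are square roots of eigenvalues, and a variation \<open>h\<close> of \<open>g\<close> changes
  \<open>g(v,v)\<close> by \<open>h(v,v)\<close>; so the derivative of \<open>ln \<alpha>\<close> carries a factor \<open>1/2\<close>. The source prints the
  derivative formula for \<open>s_functional\<close> without this factor, which is false with the conventions fixed here
  and there: take the toral automorphism with matrix rows (3,1), (2,1), the flat metric,
  the point mass at the origin, \<open>k = 1\<close> and \<open>h = diag(1,-1)\<close>.\<close>

definition Q_right ::
    "('m, 'n::finite) chart set \<Rightarrow> ('m \<Rightarrow> 'm) \<Rightarrow> ('m, 'n) tensor_field \<Rightarrow> nat \<Rightarrow> 'm \<Rightarrow> real ^ 'n \<Rightarrow> real ^ 'n" where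
  "Q_right \<A> f g k x =
     orth_projection (g x) (right_singular_space k (g x) (g (f x)) (tangent_map \<A> f x))"

definition Q_left ::
    "('m, 'n::finite) chart set \<Rightarrow> ('m \<Rightarrow> 'm) \<Rightarrow> ('m, 'n) tensor_field \<Rightarrow> nat \<Rightarrow> 'm \<Rightarrow> real ^ 'n \<Rightarrow> real ^ 'n" where
  "Q_left \<A> f g k x =
     orth_projection (g x) (left_singular_space k (g (inv f x)) (g x) (tangent_map \<A> f (inv f x)))"

end

theory Submission
  imports Defs
begin

text \<open>The squared singular values of the differential at \<open>x\<close> are the eigenvalues of the pencil \<open>(G, B)\<close>, where
  \<open>G\<close> is the Gram matrix of \<open>g\<close> at \<open>x\<close> and \<open>B\<close> is the pull-back of the Gram matrix at \<open>f x\<close>. If \<open>(v i, l i)\<close>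
  and \<open>(w j, \<mu> j)\<close> are the orthonormal eigenframes of two nearby pencils \<open>(G, B)\<close> and \<open>(G', B')\<close>, then the
  numbers \<open>weight i j = G (v i, w j) * G' (w j, v i)\<close> have row and column sums 1, and \<open>\<bar>weight i j\<bar> (\<mu> j - l i)\<^sup>2\<close> is quadratically
  small in the perturbation. Writing a difference of traces as a sum over \<open>i, j\<close> with these weights gives the
  first-order expansion of \<open>\<Sum>\<phi> (l i)\<close> with a uniform quadratic error, where \<open>\<phi>\<close> is \<open>ln\<close> above
  the spectral gap and \<open>0\<close> below it; the same identity with an indicator function shows that the number of
  eigenvalues above the gap is locally constant. No regularity of individual eigenvalues or eigenvectors is used.

  By compactness the difference quotients of the integrand converge uniformly, so one may differentiate under the
  integral, and the invariance of \<open>\<mu>\<close> moves the contribution of the left singular vectors from \<open>f x\<close> to \<open>x\<close>.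
  A curve of metrics with the volume form of \<open>g\<close> and velocity \<open>h\<close> is \<open>(det g / det (g + t h))\<^sup>1\<^sup>/\<^sup>d (g + t h)\<close>.\<close>

section \<open>Eigenframes of symmetric pencils\<close>

text \<open>Single eigenvalues cannot be differentiated in general: the gap separates only the
  \<open>k\<close>-th from the \<open>(k + 1)\<close>-st singular value, so eigenvalues on one side
  of it may collide and eigenvectors need not depend continuously on the point. Symmetric functions
  of the whole upper group do not see this, and comparing two arbitrary nearby pencils, rather than
  one with a fixed centre, makes the error constants uniform in the base point. A second difficulty
  is regularity in the point. Tangent spaces are identified through a chart chosen arbitrarily at
  each point, so matrices such as \<open>g x\<close> need not be continuous in \<open>x\<close>, and
  as \<open>f\<close> is only C^1, the pull-back of the metric is merely continuous. Estimates are
  therefore made for Gram matrices read in a fixed pair of charts, and eigenvalues are carried over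
  by congruence invariance. Finally, the metrics at \<open>x\<close> and at \<open>f x\<close> are
  varied by two independent curves. This yields continuity, hence integrability, of the left and
  right terms separately, as required before the invariance of the measure is applied to the left
  term alone.\<close>

lemma norm_matrix_vector_mult_le:
  fixes A :: "real^'n^'m" and x :: "real^'n"
  shows "norm (A *v x) \<le> norm A * norm x"
proof -
  have "norm ((A *v x) $ i) \<le> norm (A $ i) * norm x" for i
    by (simp add: matrix_vector_mul_component Cauchy_Schwarz_ineq2)
  then have "norm (A *v x) \<le> L2_set (\<lambda>i. norm (A $ i) * norm x) UNIV"
    unfolding norm_vec_def[of "A *v x"] by (intro L2_set_mono) auto
  also have "\<dots> = norm A * norm x"
    by (simp add: norm_vec_def[of A] L2_set_left_distrib)
  finally show ?thesis .
qed

lemma abs_inner_matrix_le: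
  fixes A :: "real^'n^'m"
  shows "\<bar>x \<bullet> (A *v y)\<bar> \<le> norm A * norm x * norm y"
proof -
  have "\<bar>x \<bullet> (A *v y)\<bar> \<le> norm x * norm (A *v y)"
    by (rule Cauchy_Schwarz_ineq2)
  also have "\<dots> \<le> norm x * (norm A * norm y)"
    by (intro mult_left_mono norm_matrix_vector_mult_le) auto
  finally show ?thesis by (simp add: ac_simps)
qed

lemma sym_matrix_inner:
  fixes A :: "real^'n^'n"
  assumes "transpose A = A"
  shows "x \<bullet> (A *v y) = y \<bullet> (A *v x)"
  by (metis assms dot_lmul_matrix inner_commute transpose_matrix_vector)

lemma inner_transpose_matrix: "x \<bullet> (transpose A *v y) = (A *v x) \<bullet> (y::real^'n)"
  for A :: "real^'m^'n"
  by (metis dot_lmul_matrix inner_commute transpose_matrix_vector)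

definition spd :: "real^'n^'n \<Rightarrow> bool" where
  "spd G \<longleftrightarrow> transpose G = G \<and> (\<forall>v. v \<noteq> 0 \<longrightarrow> 0 < v \<bullet> (G *v v))"

text \<open>A simultaneous diagonalisation of two forms: \<open>G\<close> becomes the identity and
  \<open>B\<close> the diagonal \<open>l\<close>. The frame is indexed by \<open>'n\<close> without
  any order on \<open>l\<close>, so eigenvalues occur with multiplicity and ties need no
  treatment.\<close>

definition eigen_frame ::
    "real^'n^'n \<Rightarrow> real^'n^'n \<Rightarrow> ('n \<Rightarrow> real^'n) \<Rightarrow> ('n \<Rightarrow> real) \<Rightarrow> bool" where
  "eigen_frame G B v l \<longleftrightarrow>
     (\<forall>i j. v i \<bullet> (G *v v j) = (if i = j then 1 else 0)) \<and> (\<forall>i. B *v v i = l i *\<^sub>R (G *v v i))"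

lemma spd_bounded_below:
  fixes G :: "real^'n^'n"
  assumes "spd G"
  obtains \<kappa> where "\<kappa> > 0" "\<And>v. \<kappa> * (v \<bullet> v) \<le> v \<bullet> (G *v v)"
proof -
  let ?q = "\<lambda>v. v \<bullet> (G *v v)"
  have "\<exists>u\<in>sphere 0 1. \<forall>v\<in>sphere 0 1. ?q u \<le> ?q v"
    by (intro continuous_attains_inf) (auto intro!: continuous_intros)
  then obtain u where u: "norm u = 1" and min: "\<And>v. norm v = 1 \<Longrightarrow> ?q u \<le> ?q v" by auto
  have "?q u > 0"
    using u assms unfolding spd_def by (metis norm_zero zero_neq_one)
  moreover have "?q u * (v \<bullet> v) \<le> ?q v" for v
  proof (cases "v = 0")
    case False
    then have "?q u \<le> ?q (v /\<^sub>R norm v)" by (intro min) simp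
    also have "\<dots> = ?q v / (v \<bullet> v)"
      by (simp add: matrix_vector_mult_scaleR power2_norm_eq_inner[symmetric] power2_eq_square divide_simps)
    finally show ?thesis using False by (simp add: pos_le_divide_eq)
  qed auto
  ultimately show thesis using that by blast
qed

text \<open>If the Rayleigh quotient on \<open>W\<close> has its maximum \<open>l\<close> at
  \<open>u\<close>, the form \<open>B - l *\<^sub>R G\<close> is nonpositive on \<open>W\<close> and
  zero at \<open>u\<close>, so its first variation at \<open>u\<close> vanishes along
  \<open>W\<close>. As \<open>W\<close> may fail to be invariant, the eigenvector equation holds
  only when tested against \<open>W\<close>.\<close>

lemma Rayleigh_maximizer:
  fixes G B :: "real^'n^'n"
  assumes G: "spd G" and B: "transpose B = B" and W: "subspace W" and w0: "w0 \<in> W" "w0 \<noteq> 0"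
  obtains u l where "u \<in> W" "u \<bullet> (G *v u) = 1" "\<And>w. w \<in> W \<Longrightarrow> w \<bullet> (B *v u - l *\<^sub>R (G *v u)) = 0"
proof -
  let ?G = "\<lambda>v. v \<bullet> (G *v v)" and ?B = "\<lambda>v. v \<bullet> (B *v v)"
  have Gpos: "?G v > 0" if "v \<noteq> 0" for v using G that by (auto simp: spd_def)
  have Gs: "transpose G = G" using G by (auto simp: spd_def)
  have cpt: "compact (sphere 0 1 \<inter> W)"
    by (intro compact_Int_closed compact_sphere closed_subspace W)
  have "w0 /\<^sub>R norm w0 \<in> sphere 0 1 \<inter> W"
    using w0 W by (auto intro: subspace_scale)
  then have "sphere 0 1 \<inter> W \<noteq> {}" by blast
  moreover have "\<forall>v\<in>sphere 0 1 \<inter> W. ?G v \<noteq> 0"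
  proof
    fix v assume "v \<in> sphere 0 1 \<inter> W"
    then have "v \<noteq> 0" by auto
    then show "?G v \<noteq> 0" using Gpos[of v] by linarith
  qed
  then have "continuous_on (sphere 0 1 \<inter> W) (\<lambda>v. ?B v / ?G v)"
    by (intro continuous_intros)
  ultimately obtain u where u: "norm u = 1" "u \<in> W"
      and max: "\<And>v. norm v = 1 \<Longrightarrow> v \<in> W \<Longrightarrow> ?B v / ?G v \<le> ?B u / ?G u"
    using continuous_attains_sup[OF cpt, of "\<lambda>v. ?B v / ?G v"]
    unfolding Int_iff mem_sphere_0 Ball_def Bex_def by blast
  have u0: "u \<noteq> 0" using u by auto
  define l where "l = ?B u / ?G u"
  define C where "C = B - l *\<^sub>R G"
  have Cs: "transpose C = C"
    using B Gs by (simp add: C_def transpose_def vec_eq_iff)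
  have Cv: "C *v x = B *v x - l *\<^sub>R (G *v x)" for x
    by (simp add: C_def matrix_vector_mult_diff_rdistrib scaleR_matrix_vector_assoc)
  have neg: "x \<bullet> (C *v x) \<le> 0" if "x \<in> W" for x
  proof (cases "x = 0")
    case False
    have "?B (x /\<^sub>R norm x) / ?G (x /\<^sub>R norm x) \<le> l"
      unfolding l_def using False that W by (intro max) (auto intro: subspace_scale)
    then have "?B x / ?G x \<le> l" using False
      by (simp add: matrix_vector_mult_scaleR)
    then show ?thesis using Gpos[OF False] by (simp add: Cv inner_diff_right divide_le_eq)
  qed auto
  have zero: "u \<bullet> (C *v u) = 0"
    using Gpos[OF u0] by (simp add: Cv l_def inner_diff_right)
  have orth: "w \<bullet> (C *v u) = 0" if w: "w \<in> W" for w
  proof (rule ccontr)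
    define p where "p = w \<bullet> (C *v u)"
    define q where "q = w \<bullet> (C *v w)"
    assume "w \<bullet> (C *v u) \<noteq> 0"
    then have p0: "p \<noteq> 0" by (simp add: p_def)
    have le: "2 * t * p + t\<^sup>2 * q \<le> 0" for t
    proof -
      have "u + t *\<^sub>R w \<in> W" using u w W by (auto intro: subspace_add subspace_scale)
      from neg[OF this] have "u \<bullet> (C *v u) + t * (u \<bullet> (C *v w)) + t * p + t * t * q \<le> 0"
        by (simp add: p_def q_def matrix_vector_right_distrib matrix_vector_mult_scaleR inner_simps algebra_simps)
      moreover have "u \<bullet> (C *v w) = p" unfolding p_def by (rule sym_matrix_inner[OF Cs])
      ultimately show ?thesis using zero by (simp add: power2_eq_square ac_simps)
    qed
    \<comment> \<open>Small enough for the linear term to win: \<open>t * p\<close> is positive and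
      at least \<open>t\<^sup>2 * \<bar>q\<bar>\<close>, so \<open>2 * t * p + t\<^sup>2 * q\<close>
      is positive. The added 1 avoids division by zero.\<close>
    define t where "t = p / (\<bar>q\<bar> + 1)"
    have "t * p > 0" using p0 by (simp add: t_def power2_eq_square[symmetric] zero_less_divide_iff add_nonneg_pos)
    moreover have "t\<^sup>2 * \<bar>q\<bar> \<le> t * p"
    proof -
      have "t\<^sup>2 * \<bar>q\<bar> \<le> t\<^sup>2 * (\<bar>q\<bar> + 1)" by (intro mult_left_mono) auto
      also have "t * (\<bar>q\<bar> + 1) = p" by (simp add: t_def add_nonneg_pos less_imp_neq[symmetric])
      then have "t\<^sup>2 * (\<bar>q\<bar> + 1) = t * p" by (simp only: power2_eq_square mult.assoc)
      finally show ?thesis .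
    qed
    moreover have "- (t\<^sup>2 * \<bar>q\<bar>) \<le> t\<^sup>2 * q"
      by (metis abs_ge_minus_self minus_mult_right mult_left_mono neg_le_iff_le minus_le_iff zero_le_power2)
    ultimately show False using le[of t] by linarith
  qed
  define s where "s = 1 / sqrt (?G u)"
  show thesis
  proof (rule that[of "s *\<^sub>R u" l])
    show "s *\<^sub>R u \<in> W" using u W by (auto intro: subspace_scale)
    show "(s *\<^sub>R u) \<bullet> (G *v (s *\<^sub>R u)) = 1"
      using Gpos[OF u0] by (simp add: s_def matrix_vector_mult_scaleR)
    show "w \<bullet> (B *v (s *\<^sub>R u) - l *\<^sub>R (G *v (s *\<^sub>R u))) = 0" if "w \<in> W" for w
      using orth[OF that] by (simp add: Cv matrix_vector_mult_scaleR inner_simps algebra_simps)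
  qed
qed

text \<open>Spectral theorem for the pencil, by induction on the index set: each step adds a
  Rayleigh maximiser from the \<open>G\<close>-orthogonal complement of the vectors already
  found.\<close>

lemma eigen_frame_exists:
  fixes G B :: "real^'n^'n"
  assumes G: "spd G" and B: "transpose B = B"
  obtains v l where "eigen_frame G B v l"
proof -
  have Gs: "transpose G = G" using G by (auto simp: spd_def)
  have "\<exists>v l. (\<forall>i\<in>S. \<forall>j\<in>S. v i \<bullet> (G *v v j) = (if i = j then 1 else 0)) \<and>
       (\<forall>i\<in>S. B *v v i = l i *\<^sub>R (G *v v i))" if "finite S" for S :: "'n set"
    using that
  proof (induction S)
    case empty
    show ?case by auto
  next
    case (insert a S)
    then obtain v l where on: "\<And>i j. i \<in> S \<Longrightarrow> j \<in> S \<Longrightarrow> v i \<bullet> (G *v v j) = (if i = j then 1 else 0)"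
      and eg: "\<And>i. i \<in> S \<Longrightarrow> B *v v i = l i *\<^sub>R (G *v v i)" by blast
    let ?W = "{w. \<forall>i\<in>S. w \<bullet> (G *v v i) = 0}"
    have "dim ((\<lambda>i. G *v v i) ` S) \<le> card ((\<lambda>i. G *v v i) ` S)"
      using insert by (intro dim_le_card') auto
    also have "\<dots> \<le> card S" using insert by (intro card_image_le)
    also have "\<dots> < card (insert a S)" using insert by simp
    also have "\<dots> \<le> DIM(real^'n)" by (simp add: card_mono)
    finally obtain w0 where "w0 \<noteq> 0" "\<And>y. y \<in> span ((\<lambda>i. G *v v i) ` S) \<Longrightarrow> orthogonal w0 y"
      using orthogonal_to_subspace_exists by blast
    then have "w0 \<noteq> 0" "w0 \<in> ?W" by (auto simp: orthogonal_def span_base)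
    moreover have "subspace ?W" by (auto simp: subspace_def inner_simps)
    ultimately obtain u m where u: "u \<in> ?W" "u \<bullet> (G *v u) = 1"
        and um: "\<And>w. w \<in> ?W \<Longrightarrow> w \<bullet> (B *v u - m *\<^sub>R (G *v u)) = 0"
      using Rayleigh_maximizer[OF G B, of ?W w0] by blast
    let ?z = "B *v u - m *\<^sub>R (G *v u)"
    have vz: "v i \<bullet> ?z = 0" if "i \<in> S" for i
    proof -
      have "v i \<bullet> (B *v u) = u \<bullet> (B *v v i)" by (rule sym_matrix_inner[OF B])
      also have "\<dots> = 0" using u that by (simp add: eg)
      finally have 1: "v i \<bullet> (B *v u) = 0" .
      have "v i \<bullet> (G *v u) = u \<bullet> (G *v v i)" by (rule sym_matrix_inner[OF Gs])
      also have "\<dots> = 0" using u that by auto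
      finally show ?thesis using 1 by (simp add: inner_diff_right)
    qed
    \<comment> \<open>The residual is orthogonal to \<open>?W\<close> by maximality and to the old
      vectors by symmetry. Subtracting from \<open>w\<close> its \<open>G\<close>-orthogonal
      projection on the old vectors leaves an element of \<open>?W\<close>, so the two cases cover
      every \<open>w\<close>.\<close>
    have "w \<bullet> ?z = 0" for w
    proof -
      define w' where "w' = w - (\<Sum>i\<in>S. (w \<bullet> (G *v v i)) *\<^sub>R v i)"
      have "w' \<in> ?W"
      proof safe
        fix j assume j: "j \<in> S"
        have "(\<Sum>i\<in>S. (w \<bullet> (G *v v i)) * (v i \<bullet> (G *v v j))) = (\<Sum>i\<in>S. if i = j then w \<bullet> (G *v v i) else 0)"
          using j by (intro sum.cong) (auto simp: on)
        then show "w' \<bullet> (G *v v j) = 0"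
          using j insert by (simp add: w'_def inner_diff_left inner_sum_left)
      qed
      then have "w' \<bullet> ?z = 0" by (rule um)
      moreover have "(\<Sum>i\<in>S. (w \<bullet> (G *v v i)) *\<^sub>R v i) \<bullet> ?z = 0"
        by (simp add: inner_sum_left vz)
      ultimately show ?thesis by (simp add: w'_def inner_diff_left)
    qed
    then have z: "B *v u = m *\<^sub>R (G *v u)" by (metis inner_eq_zero_iff right_minus_eq)
    have sy: "v i \<bullet> (G *v u) = 0" if "i \<in> S" for i
      using sym_matrix_inner[OF Gs, of "v i" u] u that by auto
    show ?case
    proof (intro exI conjI)
      show "\<forall>i\<in>insert a S. \<forall>j\<in>insert a S. (v(a := u)) i \<bullet> (G *v (v(a := u)) j) = (if i = j then 1 else 0)"
        using insert u on sy by auto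
      show "\<forall>i\<in>insert a S. B *v (v(a := u)) i = (l(a := m)) i *\<^sub>R (G *v (v(a := u)) i)"
        using insert z eg by auto
    qed
  qed
  from this[of UNIV] show thesis using that by (auto simp: eigen_frame_def)
qed

text \<open>A perturbation by less than half the ellipticity constant of \<open>G0\<close> keeps the
  other half. One \<open>\<kappa>\<close> serves as radius and as lower bound; the latter will
  control the length of frame vectors.\<close>

lemma spd_nearby:
  fixes G0 :: "real^'n^'n"
  assumes "spd G0"
  obtains \<kappa> where "\<kappa> > 0"
    "\<And>G v. norm (G - G0) < \<kappa> \<Longrightarrow> \<kappa> * (v \<bullet> v) \<le> v \<bullet> (G *v v)"
    "\<And>G. transpose G = G \<Longrightarrow> norm (G - G0) < \<kappa> \<Longrightarrow> spd G"
proof -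
  obtain \<kappa> where k: "\<kappa> > 0" "\<And>v. \<kappa> * (v \<bullet> v) \<le> v \<bullet> (G0 *v v)"
    using spd_bounded_below[OF assms] by blast
  have 1: "\<kappa> / 2 * (v \<bullet> v) \<le> v \<bullet> (G *v v)" if "norm (G - G0) < \<kappa> / 2" for G v
  proof -
    have "\<bar>v \<bullet> ((G - G0) *v v)\<bar> \<le> norm (G - G0) * norm v * norm v"
      by (rule abs_inner_matrix_le)
    also have "\<dots> \<le> \<kappa> / 2 * norm v * norm v"
      using that by (intro mult_right_mono) auto
    finally have "\<bar>v \<bullet> ((G - G0) *v v)\<bar> \<le> \<kappa> / 2 * (v \<bullet> v)"
      by (simp add: power2_norm_eq_inner[symmetric] power2_eq_square)
    moreover have "v \<bullet> (G *v v) = v \<bullet> (G0 *v v) + v \<bullet> ((G - G0) *v v)"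
      by (simp add: matrix_vector_mult_diff_rdistrib inner_diff_right)
    ultimately show ?thesis using k(2)[of v] by linarith
  qed
  have 2: "spd G" if "transpose G = G" "norm (G - G0) < \<kappa> / 2" for G
    unfolding spd_def
  proof safe
    fix v :: "real^'n" assume "v \<noteq> 0"
    then have "0 < \<kappa> / 2 * (v \<bullet> v)" using k(1) by simp
    then show "0 < v \<bullet> (G *v v)" using 1[OF that(2), of v] by linarith
  qed (rule that)
  show thesis using that[of "\<kappa> / 2"] 1 2 k(1) by auto
qed

text \<open>With the frame vectors as columns of \<open>V\<close>, orthonormality says that
  \<open>transpose V ** G\<close> is a left inverse of \<open>V\<close>. For square matrices it is
  also a right inverse, which is the expansion.\<close>

lemma eigen_frame_expand:
  fixes G B :: "real^'n^'n"
  assumes "eigen_frame G B v l"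
  shows "(\<Sum>i\<in>UNIV. (v i \<bullet> (G *v x)) *\<^sub>R v i) = x"
proof -
  define V :: "real^'n^'n" where "V = (\<chi> a i. v i $ a)"
  have col: "column i V = v i" for i by (simp add: V_def column_def vec_eq_iff)
  have V: "V *v y = (\<Sum>i\<in>UNIV. (y $ i) *\<^sub>R v i)" for y
    by (simp add: matrix_mult_sum col scalar_mult_eq_scaleR)
  have VT: "(transpose V *v y) $ i = v i \<bullet> y" for y i
    by (simp add: V_def transpose_def matrix_vector_mult_def inner_vec_def)
  have "(transpose V ** G) ** V = mat 1"
  proof -
    have "((transpose V ** G) ** V) $ i $ j = v i \<bullet> (G *v v j)" for i j
    proof -
      have "((transpose V ** G) ** V) $ i $ j = (((transpose V ** G) ** V) *v axis j 1) $ i"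
        by (simp add: matrix_vector_mult_basis column_def)
      also have "\<dots> = (transpose V *v (G *v (V *v axis j 1))) $ i"
        by (simp add: matrix_vector_mul_assoc matrix_mul_assoc)
      finally show ?thesis by (simp add: VT matrix_vector_mult_basis col del: transpose_matrix_vector)
    qed
    then show ?thesis using assms by (simp add: eigen_frame_def vec_eq_iff mat_def)
  qed
  then have "V ** (transpose V ** G) = mat 1" by (simp add: matrix_left_right_inverse)
  then have "V *v (transpose V *v (G *v x)) = x"
    by (metis matrix_vector_mul_assoc matrix_vector_mul_lid)
  then show ?thesis by (simp add: V VT del: transpose_matrix_vector)
qed

section \<open>Comparison of two pencils through the overlaps of their eigenframes\<close>

locale two_frames =
  fixes G B G' B' :: "real^'n^'n" and v w :: "'n \<Rightarrow> real^'n" and l \<mu> :: "'n \<Rightarrow> real"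
    and e \<Lambda> :: real
  assumes sym: "transpose G = G" "transpose B = B" "transpose G' = G'" "transpose B' = B'"
    and v: "eigen_frame G B v l" and w: "eigen_frame G' B' w \<mu>"
    and dB: "\<And>i j. \<bar>v i \<bullet> ((B' - B) *v w j)\<bar> \<le> e"
    and dG: "\<And>i j. \<bar>v i \<bullet> ((G' - G) *v w j)\<bar> \<le> e"
    and l: "\<And>i. \<bar>l i\<bar> \<le> \<Lambda>" and \<mu>: "\<And>j. \<bar>\<mu> j\<bar> \<le> \<Lambda>"
begin

text \<open>For \<open>G' = G\<close> this is the squared overlap of two orthonormal frames, a
  doubly stochastic matrix. Otherwise entries may be negative, hence the absolute values in the
  estimates. Using \<open>G\<close> in one factor and \<open>G'\<close> in the other keeps row and
  column sums exactly 1.\<close>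

definition weight :: "'n \<Rightarrow> 'n \<Rightarrow> real" where
  "weight i j = (v i \<bullet> (G *v w j)) * (w j \<bullet> (G' *v v i))"

lemma e_nonneg: "0 \<le> e" using dB abs_ge_zero order_trans by blast
lemma Lambda_nonneg: "0 \<le> \<Lambda>" using l abs_ge_zero order_trans by blast

text \<open>Expand one copy of \<open>w j\<close> in the frame \<open>v\<close> and pair the result
  with \<open>G' *v w j\<close>.\<close>

lemma sum_weight_left: "(\<Sum>i\<in>UNIV. weight i j) = 1"
proof -
  have "w j \<bullet> (G' *v w j) = 1" using w by (simp add: eigen_frame_def)
  also have "w j \<bullet> (G' *v w j) = (G' *v w j) \<bullet> (\<Sum>i\<in>UNIV. (v i \<bullet> (G *v w j)) *\<^sub>R v i)"
    by (simp add: eigen_frame_expand[OF v] inner_commute)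
  also have "\<dots> = (\<Sum>i\<in>UNIV. weight i j)"
    using sym_matrix_inner[OF sym(3), of "w j"] by (simp add: inner_sum_right weight_def inner_commute)
  finally show ?thesis by simp
qed

lemma sum_weight_right: "(\<Sum>j\<in>UNIV. weight i j) = 1"
proof -
  have "v i \<bullet> (G *v v i) = 1" using v by (simp add: eigen_frame_def)
  also have "v i \<bullet> (G *v v i) = (G *v v i) \<bullet> (\<Sum>j\<in>UNIV. (w j \<bullet> (G' *v v i)) *\<^sub>R w j)"
    by (simp add: eigen_frame_expand[OF w] inner_commute)
  also have "\<dots> = (\<Sum>j\<in>UNIV. weight i j)"
    using sym_matrix_inner[OF sym(1), of "v i"] by (simp add: inner_sum_right weight_def inner_commute ac_simps)
  finally show ?thesis by simp
qed

text \<open>Both \<open>v i \<bullet> (B' *v w j)\<close> and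
  \<open>v i \<bullet> (B *v w j)\<close> are evaluated by the eigenvector equations, the second
  after using symmetry; subtracting them produces the gap times the overlap, up to a term with
  \<open>G' - G\<close>.\<close>

lemma gap_left: "(\<mu> j - l i) * (v i \<bullet> (G *v w j)) =
    v i \<bullet> ((B' - B) *v w j) - \<mu> j * (v i \<bullet> ((G' - G) *v w j))"
proof -
  have "v i \<bullet> (B' *v w j) = \<mu> j * (v i \<bullet> (G' *v w j))"
    using w by (simp add: eigen_frame_def)
  moreover have "v i \<bullet> (B *v w j) = w j \<bullet> (B *v v i)" by (rule sym_matrix_inner[OF sym(2)])
  then have "v i \<bullet> (B *v w j) = l i * (v i \<bullet> (G *v w j))"
    using v sym_matrix_inner[OF sym(1), of "v i" "w j"] by (simp add: eigen_frame_def)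
  ultimately show ?thesis
    by (simp add: matrix_vector_mult_diff_rdistrib inner_diff_right algebra_simps)
qed

text \<open>The companion for the other overlap: keeping \<open>G'\<close> instead of
  \<open>G\<close> changes the coefficient of the metric error from \<open>\<mu> j\<close> to
  \<open>l i\<close>.\<close>

lemma gap_right: "(\<mu> j - l i) * (w j \<bullet> (G' *v v i)) =
    v i \<bullet> ((B' - B) *v w j) - l i * (v i \<bullet> ((G' - G) *v w j))"
proof -
  have "v i \<bullet> (B' *v w j) = \<mu> j * (w j \<bullet> (G' *v v i))"
    using w sym_matrix_inner[OF sym(3), of "v i" "w j"] by (simp add: eigen_frame_def)
  moreover have "v i \<bullet> (B *v w j) = w j \<bullet> (B *v v i)" by (rule sym_matrix_inner[OF sym(2)])
  then have "v i \<bullet> (B *v w j) = l i * (v i \<bullet> (G *v w j))"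
    using v sym_matrix_inner[OF sym(1), of "v i" "w j"] by (simp add: eigen_frame_def)
  ultimately show ?thesis
    using sym_matrix_inner[OF sym(3), of "v i" "w j"]
    by (simp add: matrix_vector_mult_diff_rdistrib inner_diff_right algebra_simps)
qed

lemma gap_left_le: "\<bar>(\<mu> j - l i) * (v i \<bullet> (G *v w j))\<bar> \<le> (1 + \<Lambda>) * e"
proof -
  have "\<bar>\<mu> j * (v i \<bullet> ((G' - G) *v w j))\<bar> \<le> \<Lambda> * e"
    unfolding abs_mult by (intro mult_mono \<mu> dG Lambda_nonneg) auto
  then show ?thesis using dB[of i j] unfolding gap_left by (simp add: algebra_simps)
qed

lemma gap_right_le: "\<bar>(\<mu> j - l i) * (w j \<bullet> (G' *v v i))\<bar> \<le> (1 + \<Lambda>) * e"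
proof -
  have "\<bar>l i * (v i \<bullet> ((G' - G) *v w j))\<bar> \<le> \<Lambda> * e"
    unfolding abs_mult by (intro mult_mono l dG Lambda_nonneg) auto
  then show ?thesis using dB[of i j] unfolding gap_right by (simp add: algebra_simps)
qed

text \<open>Each of the two overlaps in \<open>weight\<close> absorbs one factor
  \<open>\<mu> j - l i\<close> at the cost of one factor \<open>e\<close>. This is the source of all
  quadratic errors below.\<close>

lemma weight_gap_le: "\<bar>weight i j\<bar> * (\<mu> j - l i)\<^sup>2 \<le> ((1 + \<Lambda>) * e)\<^sup>2"
proof -
  have "\<bar>weight i j\<bar> * (\<mu> j - l i)\<^sup>2 =
      \<bar>(\<mu> j - l i) * (v i \<bullet> (G *v w j))\<bar> * \<bar>(\<mu> j - l i) * (w j \<bullet> (G' *v v i))\<bar>"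
    unfolding weight_def abs_mult power2_abs[of "\<mu> j - l i", symmetric]
    by (simp only: power2_eq_square ac_simps)
  also have "\<dots> \<le> ((1 + \<Lambda>) * e) * ((1 + \<Lambda>) * e)"
    using gap_left_le gap_right_le Lambda_nonneg e_nonneg by (intro mult_mono) auto
  finally show ?thesis by (simp add: power2_eq_square)
qed

text \<open>The weights in column \<open>j\<close> add up to 1, so one of them has absolute value at
  least \<open>1 / CARD('n)\<close>; for that index \<open>weight_gap_le\<close> bounds the gap
  itself.\<close>

lemma eigenvalue_close:
  obtains i where "(\<mu> j - l i)\<^sup>2 \<le> CARD('n) * ((1 + \<Lambda>) * e)\<^sup>2"
proof -
  have "\<exists>i. 1 \<le> CARD('n) * \<bar>weight i j\<bar>"
  proof (rule ccontr)
    assume "\<not> ?thesis"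
    then have "\<bar>weight i j\<bar> < 1 / CARD('n)" for i by (auto simp: not_le field_simps)
    then have "(\<Sum>i\<in>UNIV. weight i j) < (\<Sum>i\<in>(UNIV::'n set). 1 / CARD('n))"
      by (intro sum_strict_mono) (auto intro: le_less_trans[OF abs_ge_self])
    then show False by (simp add: sum_weight_left)
  qed
  then obtain i where i: "1 \<le> CARD('n) * \<bar>weight i j\<bar>" ..
  have "(\<mu> j - l i)\<^sup>2 \<le> (CARD('n) * \<bar>weight i j\<bar>) * (\<mu> j - l i)\<^sup>2"
    using mult_right_mono[OF i, of "(\<mu> j - l i)\<^sup>2"] by simp
  also have "\<dots> \<le> CARD('n) * ((1 + \<Lambda>) * e)\<^sup>2"
    using mult_left_mono[OF weight_gap_le[of i j], of "CARD('n)"] by (simp add: ac_simps)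
  finally show thesis by (rule that)
qed

text \<open>Unit sums over \<open>j\<close> spread \<open>\<phi> (l i)\<close>, unit sums over
  \<open>i\<close> spread \<open>\<phi> (\<mu> j)\<close>. The difference of traces becomes a
  weighted sum of increments without any matching of the eigenvalues.\<close>

lemma sum_diff_eq:
  "(\<Sum>j\<in>UNIV. \<phi> (\<mu> j)) - (\<Sum>i\<in>UNIV. \<phi> (l i)) = (\<Sum>i\<in>UNIV. \<Sum>j\<in>UNIV. weight i j * (\<phi> (\<mu> j) - \<phi> (l i)))"
proof -
  have "(\<Sum>j\<in>UNIV. \<phi> (\<mu> j)) = (\<Sum>j\<in>UNIV. \<Sum>i\<in>UNIV. weight i j * \<phi> (\<mu> j))"
    by (simp add: sum_distrib_right[symmetric] sum_weight_left)
  also have "\<dots> = (\<Sum>i\<in>UNIV. \<Sum>j\<in>UNIV. weight i j * \<phi> (\<mu> j))" by (rule sum.swap)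
  finally show ?thesis
    by (simp add: right_diff_distrib sum_subtractf sum_distrib_right[symmetric] sum_weight_right)
qed

lemma sum_le_of_quadratic:
  fixes F :: "'n \<Rightarrow> 'n \<Rightarrow> real" and C :: real
  assumes F: "\<And>i j. \<bar>F i j\<bar> \<le> C * (\<mu> j - l i)\<^sup>2" and C: "0 \<le> C"
  shows "\<bar>\<Sum>i\<in>UNIV. \<Sum>j\<in>UNIV. weight i j * F i j\<bar> \<le> (real CARD('n))\<^sup>2 * C * ((1 + \<Lambda>) * e)\<^sup>2"
proof -
  have "\<bar>weight i j * F i j\<bar> \<le> C * ((1 + \<Lambda>) * e)\<^sup>2" for i j
  proof -
    have "\<bar>weight i j * F i j\<bar> \<le> C * (\<bar>weight i j\<bar> * (\<mu> j - l i)\<^sup>2)"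
      using mult_left_mono[OF F[of i j], of "\<bar>weight i j\<bar>"] by (simp add: abs_mult ac_simps)
    also have "\<dots> \<le> C * ((1 + \<Lambda>) * e)\<^sup>2" by (intro mult_left_mono weight_gap_le C)
    finally show ?thesis .
  qed
  then have "(\<Sum>i\<in>UNIV. \<Sum>j\<in>UNIV. \<bar>weight i j * F i j\<bar>) \<le> (\<Sum>i\<in>(UNIV::'n set). \<Sum>j\<in>(UNIV::'n set). C * ((1 + \<Lambda>) * e)\<^sup>2)"
    by (intro sum_mono)
  moreover have "\<bar>\<Sum>i\<in>UNIV. \<Sum>j\<in>UNIV. weight i j * F i j\<bar> \<le> (\<Sum>i\<in>UNIV. \<Sum>j\<in>UNIV. \<bar>weight i j * F i j\<bar>)"
    by (rule order_trans[OF sum_abs sum_mono[OF sum_abs]])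
  ultimately show ?thesis by (simp add: power2_eq_square ac_simps)
qed

text \<open>Summation over \<open>j\<close> against the coefficients of \<open>v i\<close> in the
  frame \<open>w\<close> replaces \<open>w j\<close> by \<open>v i\<close>. Only the coefficient
  \<open>\<mu> j\<close> in \<open>gap_left\<close> resists this; exchanging it for
  \<open>l i\<close> leaves the last sum, whose terms are products of two small factors.\<close>

lemma first_order:
  "(\<Sum>j\<in>UNIV. weight i j * (\<mu> j - l i)) =
     v i \<bullet> ((B' - B) *v v i) - l i * (v i \<bullet> ((G' - G) *v v i))
     - (\<Sum>j\<in>UNIV. ((\<mu> j - l i) * (w j \<bullet> (G' *v v i))) * (v i \<bullet> ((G' - G) *v w j)))"
proof -
  let ?a = "\<lambda>j. w j \<bullet> (G' *v v i)"
  have ex: "(\<Sum>j\<in>UNIV. ?a j * (v i \<bullet> (X *v w j))) = v i \<bullet> (X *v v i)" for X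
  proof -
    have "v i \<bullet> (X *v v i) = v i \<bullet> (X *v (\<Sum>j\<in>UNIV. ?a j *\<^sub>R w j))"
      by (simp add: eigen_frame_expand[OF w])
    then show ?thesis
      by (simp add: linear_sum[OF matrix_vector_mul_linear] inner_sum_right matrix_vector_mult_scaleR)
  qed
  have "weight i j * (\<mu> j - l i) = ?a j * (v i \<bullet> ((B' - B) *v w j)) - l i * (?a j * (v i \<bullet> ((G' - G) *v w j)))
      - ((\<mu> j - l i) * ?a j) * (v i \<bullet> ((G' - G) *v w j))" for j
  proof -
    have "weight i j * (\<mu> j - l i) = ?a j * ((\<mu> j - l i) * (v i \<bullet> (G *v w j)))"
      by (simp add: weight_def)
    also have "\<dots> = ?a j * (v i \<bullet> ((B' - B) *v w j) - \<mu> j * (v i \<bullet> ((G' - G) *v w j)))"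
      by (simp only: gap_left)
    finally show ?thesis by (simp add: algebra_simps)
  qed
  then show ?thesis by (simp add: sum_subtractf sum_distrib_left[symmetric] ex)
qed

text \<open>\<open>?R\<close> collects the Taylor remainders, quadratic in the gaps and so
  controlled by the weights; \<open>?S\<close> is the product term left by
  \<open>first_order\<close>. The Taylor bound is asked only at the eigenvalues that occur, so
  \<open>\<phi>\<close> may jump elsewhere.\<close>

lemma trace_function_expansion:
  fixes \<phi> \<phi>' :: "real \<Rightarrow> real" and C X :: real
  assumes F: "\<And>i j. \<bar>\<phi> (\<mu> j) - \<phi> (l i) - \<phi>' (l i) * (\<mu> j - l i)\<bar> \<le> C * (\<mu> j - l i)\<^sup>2"
    and C: "0 \<le> C" and X: "\<And>i. \<bar>\<phi>' (l i)\<bar> \<le> X"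
  shows "\<bar>(\<Sum>j\<in>UNIV. \<phi> (\<mu> j)) - (\<Sum>i\<in>UNIV. \<phi> (l i))
      - (\<Sum>i\<in>UNIV. \<phi>' (l i) * (v i \<bullet> ((B' - B) *v v i) - l i * (v i \<bullet> ((G' - G) *v v i))))\<bar>
      \<le> (real CARD('n))\<^sup>2 * (C * (1 + \<Lambda>)\<^sup>2 + X * (1 + \<Lambda>)) * e\<^sup>2"
proof -
  let ?fo = "\<lambda>i. v i \<bullet> ((B' - B) *v v i) - l i * (v i \<bullet> ((G' - G) *v v i))"
  let ?r = "\<lambda>i j. ((\<mu> j - l i) * (w j \<bullet> (G' *v v i))) * (v i \<bullet> ((G' - G) *v w j))"
  let ?R = "\<Sum>i\<in>UNIV. \<Sum>j\<in>UNIV. weight i j * (\<phi> (\<mu> j) - \<phi> (l i) - \<phi>' (l i) * (\<mu> j - l i))"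
  let ?S = "\<Sum>i\<in>UNIV. \<Sum>j\<in>UNIV. \<phi>' (l i) * ?r i j"
  have X0: "0 \<le> X" using X abs_ge_zero order_trans by blast
  have "(\<Sum>j\<in>UNIV. \<phi> (\<mu> j)) - (\<Sum>i\<in>UNIV. \<phi> (l i)) = ?R + (\<Sum>i\<in>UNIV. \<phi>' (l i) * (\<Sum>j\<in>UNIV. weight i j * (\<mu> j - l i)))"
    unfolding sum_diff_eq sum_distrib_left sum.distrib[symmetric]
    by (intro sum.cong refl) (simp add: algebra_simps)
  also have "\<dots> = ?R + (\<Sum>i\<in>UNIV. \<phi>' (l i) * ?fo i) - ?S"
    unfolding first_order by (simp add: right_diff_distrib sum_subtractf sum_distrib_left)
  finally have eq: "(\<Sum>j\<in>UNIV. \<phi> (\<mu> j)) - (\<Sum>i\<in>UNIV. \<phi> (l i)) - (\<Sum>i\<in>UNIV. \<phi>' (l i) * ?fo i) = ?R - ?S"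
    by simp
  have R: "\<bar>?R\<bar> \<le> (real CARD('n))\<^sup>2 * C * ((1 + \<Lambda>) * e)\<^sup>2"
    by (rule sum_le_of_quadratic[OF F C])
  have "\<bar>\<phi>' (l i) * ?r i j\<bar> \<le> X * (((1 + \<Lambda>) * e) * e)" for i j
    unfolding abs_mult[of "\<phi>' (l i)"] abs_mult[of _ "v i \<bullet> _"]
    using Lambda_nonneg e_nonneg by (intro mult_mono X gap_right_le dG) (auto simp: X0)
  then have "(\<Sum>i\<in>UNIV. \<Sum>j\<in>UNIV. \<bar>\<phi>' (l i) * ?r i j\<bar>) \<le> (\<Sum>i\<in>(UNIV::'n set). \<Sum>j\<in>(UNIV::'n set). X * (((1 + \<Lambda>) * e) * e))"
    by (intro sum_mono)
  moreover have "\<bar>?S\<bar> \<le> (\<Sum>i\<in>UNIV. \<Sum>j\<in>UNIV. \<bar>\<phi>' (l i) * ?r i j\<bar>)"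
    by (rule order_trans[OF sum_abs sum_mono[OF sum_abs]])
  ultimately have S: "\<bar>?S\<bar> \<le> (real CARD('n))\<^sup>2 * (X * (1 + \<Lambda>)) * e\<^sup>2" by (simp add: power2_eq_square ac_simps)
  have "\<bar>?R - ?S\<bar> \<le> \<bar>?R\<bar> + \<bar>?S\<bar>" by (rule abs_triangle_ineq4)
  also have "\<dots> \<le> (real CARD('n))\<^sup>2 * C * ((1 + \<Lambda>) * e)\<^sup>2 + (real CARD('n))\<^sup>2 * (X * (1 + \<Lambda>)) * e\<^sup>2"
    by (rule add_mono[OF R S])
  also have "\<dots> = (real CARD('n))\<^sup>2 * (C * (1 + \<Lambda>)\<^sup>2 + X * (1 + \<Lambda>)) * e\<^sup>2"
    by algebra
  finally show ?thesis unfolding eq .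
qed

end

text \<open>The cut logarithm jumps at \<open>m\<close>, but \<open>s\<close> keeps distance
  \<open>\<delta>\<close> from \<open>m\<close>. If both points lie above \<open>m\<close>, Taylor's
  bound with \<open>1 / m\<^sup>2\<close> applies; below \<open>m\<close> everything is zero. If
  \<open>t\<close> crosses \<open>m\<close>, then \<open>\<bar>t - s\<bar>\<close> is at least
  \<open>\<delta>\<close>, and the terms with \<open>\<delta>\<close> in the denominator dominate
  the values themselves.\<close>

lemma cut_ln_remainder:
  fixes m \<delta> s t :: real
  defines "\<phi> \<equiv> (\<lambda>s. if m < s then ln s else 0)" and "\<phi>' \<equiv> (\<lambda>s. if m < s then 1 / s else 0)"
  assumes m: "0 < m" and \<delta>: "0 < \<delta>" and s: "\<delta> \<le> \<bar>s - m\<bar>"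
  shows "\<bar>\<phi> t - \<phi> s - \<phi>' s * (t - s)\<bar> \<le> (1 / m\<^sup>2 + \<bar>ln m\<bar> / \<delta>\<^sup>2 + 2 / (m * \<delta>)) * (t - s)\<^sup>2"
proof -
  let ?a = "1 / m\<^sup>2 * (t - s)\<^sup>2" and ?b = "\<bar>ln m\<bar> / \<delta>\<^sup>2 * (t - s)\<^sup>2" and ?c = "2 / (m * \<delta>) * (t - s)\<^sup>2"
  have nn: "0 \<le> ?a" "0 \<le> ?b" "0 \<le> ?c" using m \<delta> by auto
  have ln_le: "\<bar>ln r\<bar> \<le> \<bar>ln m\<bar> + (r - m) / m" if "m < r" for r
  proof -
    have "ln r - ln m = ln (r / m)" using m that by (simp add: ln_div)
    also have "\<dots> \<le> r / m - 1" using m that by (intro ln_le_minus_one) auto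
    finally have "ln r - ln m \<le> (r - m) / m" using m by (simp add: field_simps)
    moreover have "ln m \<le> ln r" using m that by simp
    ultimately show ?thesis by (auto simp: abs_if)
  qed
  have far: "\<bar>ln m\<bar> + 2 * \<bar>t - s\<bar> / m \<le> ?b + ?c" if "\<delta> \<le> \<bar>t - s\<bar>"
  proof -
    have "\<delta>\<^sup>2 \<le> (t - s)\<^sup>2" using that \<delta> by (metis abs_le_square_iff abs_of_pos)
    then have "\<bar>ln m\<bar> * 1 \<le> \<bar>ln m\<bar> * ((t - s)\<^sup>2 / \<delta>\<^sup>2)" using \<delta> by (intro mult_left_mono) auto
    then have 1: "\<bar>ln m\<bar> \<le> ?b" by simp
    have "\<bar>t - s\<bar> * \<delta> \<le> \<bar>t - s\<bar> * \<bar>t - s\<bar>" using that by (intro mult_left_mono) auto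
    then have "2 / m * \<bar>t - s\<bar> \<le> 2 / m * ((t - s)\<^sup>2 / \<delta>)"
      using m \<delta> by (intro mult_left_mono) (auto simp: field_simps power2_eq_square)
    then have 2: "2 * \<bar>t - s\<bar> / m \<le> ?c" using m \<delta> by (simp add: field_simps)
    show ?thesis using 1 2 by linarith
  qed
  have "\<bar>\<phi> t - \<phi> s - \<phi>' s * (t - s)\<bar> \<le> ?a + ?b + ?c"
  proof (cases "m < s")
    case ms: True
    then have s0: "s > 0" using m by linarith
    show ?thesis
    proof (cases "m < t")
      case True
      then have t0: "t > 0" using m by linarith
      \<comment> \<open>The inequality \<open>ln r \<le> r - 1\<close> for \<open>t / s\<close> and
        for \<open>s / t\<close> encloses \<open>ln t - ln s\<close> from both sides; the width of
        the enclosure is exactly \<open>(t - s)\<^sup>2 / (s * t)\<close>.\<close>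
      have "ln t - ln s = ln (t / s)" "ln s - ln t = ln (s / t)" using s0 t0 by (simp_all add: ln_div)
      moreover have "ln (t / s) \<le> t / s - 1" "ln (s / t) \<le> s / t - 1" using s0 t0 by (auto intro: ln_le_minus_one)
      ultimately have "\<bar>ln t - ln s - (t - s) / s\<bar> \<le> t / s - 1 + (s / t - 1)"
        using s0 by (simp add: diff_divide_distrib)
      also have "\<dots> = 1 / (s * t) * (t - s)\<^sup>2" using s0 t0 by (simp add: field_simps power2_eq_square)
      also have "\<dots> \<le> ?a"
      proof (intro mult_right_mono divide_left_mono)
        show "m\<^sup>2 \<le> s * t" unfolding power2_eq_square using ms True m by (intro mult_mono) auto
      qed (use m s0 t0 in auto)
      finally have "\<bar>ln t - ln s - (t - s) / s\<bar> \<le> ?a + ?b + ?c" using nn by linarith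
      then show ?thesis using ms True by (simp add: \<phi>_def \<phi>'_def)
    next
      case False
      have d: "\<delta> \<le> \<bar>t - s\<bar>" using s ms False by linarith
      have "\<bar>ln s\<bar> + \<bar>t - s\<bar> / s \<le> (\<bar>ln m\<bar> + (s - m) / m) + \<bar>t - s\<bar> / m"
        using m ms by (intro add_mono ln_le divide_left_mono) auto
      also have "(s - m) / m \<le> \<bar>t - s\<bar> / m" using m False ms by (intro divide_right_mono) auto
      finally have "\<bar>ln s\<bar> + \<bar>t - s\<bar> / s \<le> \<bar>ln m\<bar> + 2 * \<bar>t - s\<bar> / m" by simp
      moreover have "\<bar>- ln s - (t - s) / s\<bar> \<le> \<bar>ln s\<bar> + \<bar>t - s\<bar> / s"
        using abs_triangle_ineq4[of "- ln s" "(t - s) / s"] s0 by simp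
      ultimately have "\<bar>- ln s - (t - s) / s\<bar> \<le> ?a + ?b + ?c" using far[OF d] nn by linarith
      then show ?thesis using ms False by (simp add: \<phi>_def \<phi>'_def)
    qed
  next
    case ms: False
    show ?thesis
    proof (cases "m < t")
      case True
      have d: "\<delta> \<le> \<bar>t - s\<bar>" using s ms True by linarith
      have "(t - m) / m \<le> \<bar>t - s\<bar> / m" using m True ms by (intro divide_right_mono) auto
      moreover have "0 \<le> \<bar>t - s\<bar> / m" using m by simp
      ultimately have "\<bar>ln t\<bar> \<le> \<bar>ln m\<bar> + 2 * \<bar>t - s\<bar> / m" using ln_le[OF True] by simp
      then have "\<bar>ln t\<bar> \<le> ?a + ?b + ?c" using far[OF d] nn by linarith
      then show ?thesis using ms True by (simp add: \<phi>_def \<phi>'_def)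
    next
      case False
      then show ?thesis using nn ms by (simp add: \<phi>_def \<phi>'_def)
    qed
  qed
  then show ?thesis by (simp add: algebra_simps)
qed

text \<open>The first-order term of \<open>\<Sum>ln (l i)\<close>, summed over the eigenvalues above the level \<open>m\<close>, when \<open>G\<close>
  and \<open>B\<close> are varied by \<open>H\<close> and \<open>E\<close>.\<close>

definition top_variation ::
    "real \<Rightarrow> ('n \<Rightarrow> real^'n) \<Rightarrow> ('n \<Rightarrow> real) \<Rightarrow> real^'n^'n \<Rightarrow> real^'n^'n \<Rightarrow> real" where
  "top_variation m v l H E =
     (\<Sum>i | m < l i. (v i \<bullet> (E *v v i) - l i * (v i \<bullet> (H *v v i))) / l i)"

definition top_ln :: "real \<Rightarrow> ('n::finite \<Rightarrow> real) \<Rightarrow> real" where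
  "top_ln m l = (\<Sum>i | m < l i. ln (l i))"

text \<open>All constants depend on the centre pencil and the level \<open>m\<close> alone, while
  both pencils in the last conclusion vary freely nearby. This gives an expansion uniform over
  neighbouring points of the manifold. The constant count lets one level \<open>m\<close> select the
  same number of eigenvalues throughout.\<close>

lemma top_ln_local:
  fixes G0 B0 :: "real^'n^'n"
  assumes G0: "spd G0" and B0: "transpose B0 = B0" and f0: "eigen_frame G0 B0 v0 l0"
    and m: "0 < m" and ne: "\<And>i. l0 i \<noteq> m"
  obtains \<epsilon> C K where "\<epsilon> > 0" "C \<ge> 0" "K \<ge> 0"
    "\<And>G. transpose G = G \<Longrightarrow> norm (G - G0) < \<epsilon> \<Longrightarrow> spd G"
    "\<And>G B v l i. transpose G = G \<Longrightarrow> transpose B = B \<Longrightarrow> norm (G - G0) < \<epsilon> \<Longrightarrow> norm (B - B0) < \<epsilon>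
       \<Longrightarrow> eigen_frame G B v l \<Longrightarrow>
       card {i. m < l i} = card {i. m < l0 i} \<and> norm (v i) \<le> K \<and> \<bar>l i\<bar> \<le> K \<and> l i \<noteq> m"
    "\<And>G B v l G' B' w \<mu>. transpose G = G \<Longrightarrow> transpose B = B \<Longrightarrow> norm (G - G0) < \<epsilon> \<Longrightarrow> norm (B - B0) < \<epsilon>
       \<Longrightarrow> eigen_frame G B v l
       \<Longrightarrow> transpose G' = G' \<Longrightarrow> transpose B' = B' \<Longrightarrow> norm (G' - G0) < \<epsilon> \<Longrightarrow> norm (B' - B0) < \<epsilon>
       \<Longrightarrow> eigen_frame G' B' w \<mu>
       \<Longrightarrow> \<bar>top_ln m \<mu> - top_ln m l - top_variation m v l (G' - G) (B' - B)\<bar>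
            \<le> C * (norm (G' - G) + norm (B' - B))\<^sup>2"
proof -
  obtain \<kappa> where \<kappa>: "\<kappa> > 0" "\<And>G v. norm (G - G0) < \<kappa> \<Longrightarrow> \<kappa> * (v \<bullet> v) \<le> v \<bullet> (G *v v)"
    "\<And>G. transpose G = G \<Longrightarrow> norm (G - G0) < \<kappa> \<Longrightarrow> spd G"
    using spd_nearby[OF G0] by blast
  define N where "N = real CARD('n)"
  have N: "N \<ge> 1" unfolding N_def by (metis One_nat_def Suc_leI of_nat_1 of_nat_le_iff zero_less_card_finite)
  define K where "K = sqrt (1 / \<kappa>)"
  have K0: "K > 0" using \<kappa> by (simp add: K_def)
  define \<Lambda> where "\<Lambda> = (norm B0 + 1) * K\<^sup>2"
  have L0: "\<Lambda> \<ge> 0" unfolding \<Lambda>_def by simp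
  \<comment> \<open>Half the distance from the spectrum to \<open>m\<close>: an eigenvalue displaced
    by less than \<open>\<delta>\<close> still keeps distance \<open>\<delta>\<close> from
    \<open>m\<close>.\<close>
  define \<delta> where "\<delta> = Min (range (\<lambda>i. \<bar>l0 i - m\<bar>)) / 2"
  have d0: "\<delta> > 0" using ne by (simp add: \<delta>_def)
  have dl: "2 * \<delta> \<le> \<bar>l0 i - m\<bar>" for i by (simp add: \<delta>_def)
  \<comment> \<open>\<open>P * \<epsilon>\<close> bounds the displacement of eigenvalues when the
    matrices move by less than \<open>\<epsilon>\<close>, since
    \<open>\<epsilon> * K\<^sup>2\<close> bounds the perturbation tested on frame vectors. The
    factor \<open>N\<close> generously replaces its square root.\<close>
  define P where "P = N * (1 + \<Lambda>) * K\<^sup>2"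
  have P0: "P > 0" using N L0 K0 by (simp add: P_def)
  define \<epsilon> where "\<epsilon> = min (min 1 \<kappa>) (\<delta> / (2 * P))"
  have e0: "\<epsilon> > 0" using \<kappa> d0 P0 by (simp add: \<epsilon>_def)
  have eP: "P * \<epsilon> < \<delta>"
  proof -
    have "P * \<epsilon> \<le> P * (\<delta> / (2 * P))" using P0 by (intro mult_left_mono) (auto simp: \<epsilon>_def)
    also have "\<dots> < \<delta>" using P0 d0 by simp
    finally show ?thesis .
  qed
  have vK: "norm (v i) \<le> K" if "norm (G - G0) < \<epsilon>" "eigen_frame G B v l" for G B v l i
  proof -
    have "\<kappa> * (v i \<bullet> v i) \<le> v i \<bullet> (G *v v i)" using that by (intro \<kappa>) (simp add: \<epsilon>_def)
    also have "\<dots> = 1" using that by (simp add: eigen_frame_def)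
    finally have "(norm (v i))\<^sup>2 \<le> 1 / \<kappa>" using \<kappa> by (simp add: power2_norm_eq_inner field_simps)
    then show ?thesis unfolding K_def by (rule real_le_rsqrt)
  qed
  have lL: "\<bar>l i\<bar> \<le> \<Lambda>" if "norm (G - G0) < \<epsilon>" "norm (B - B0) < \<epsilon>" "eigen_frame G B v l" for G B v l i
  proof -
    have "l i = v i \<bullet> (B *v v i)" using that by (simp add: eigen_frame_def)
    then have "\<bar>l i\<bar> \<le> norm B * norm (v i) * norm (v i)" using abs_inner_matrix_le[of "v i" B "v i"] by simp
    also have "norm B \<le> norm B0 + 1" using that norm_triangle_sub[of B B0] by (simp add: \<epsilon>_def)
    finally have "\<bar>l i\<bar> \<le> (norm B0 + 1) * norm (v i) * norm (v i)" by (simp add: mult_right_mono)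
    also have "\<dots> \<le> (norm B0 + 1) * K * K" using vK[OF that(1,3)] K0 by (intro mult_mono) auto
    finally show ?thesis by (simp add: \<Lambda>_def power2_eq_square)
  qed
  have tf: "two_frames G B G' B' v w l \<mu> (\<eta> * K\<^sup>2) \<Lambda>"
    if "transpose G = G" "transpose B = B" "norm (G - G0) < \<epsilon>" "norm (B - B0) < \<epsilon>" "eigen_frame G B v l"
      "transpose G' = G'" "transpose B' = B'" "norm (G' - G0) < \<epsilon>" "norm (B' - B0) < \<epsilon>" "eigen_frame G' B' w \<mu>"
      "norm (G' - G) \<le> \<eta>" "norm (B' - B) \<le> \<eta>" for G B G' B' v w l \<mu> \<eta>
  proof -
    have le: "\<bar>v i \<bullet> (X *v w j)\<bar> \<le> \<eta> * K\<^sup>2" if "norm X \<le> \<eta>" for X i j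
    proof -
      have \<eta>: "0 \<le> \<eta>" using that norm_ge_zero order_trans by blast
      have "\<bar>v i \<bullet> (X *v w j)\<bar> \<le> norm X * norm (v i) * norm (w j)" by (rule abs_inner_matrix_le)
      also have "\<dots> \<le> \<eta> * K * K" using vK[OF \<open>norm (G - G0) < \<epsilon>\<close> \<open>eigen_frame G B v l\<close>, of i]
          vK[OF \<open>norm (G' - G0) < \<epsilon>\<close> \<open>eigen_frame G' B' w \<mu>\<close>, of j] that K0 \<eta> by (intro mult_mono) auto
      finally show ?thesis by (simp add: power2_eq_square ac_simps)
    qed
    show ?thesis
      using that by unfold_locales (auto intro: le lL)
  qed
  have near: "card {i. m < l i} = card {i. m < l0 i} \<and> \<delta> \<le> \<bar>l j - m\<bar>"
    if "transpose G = G" "transpose B = B" "norm (G - G0) < \<epsilon>" "norm (B - B0) < \<epsilon>" "eigen_frame G B v l"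
    for G B v l j
  proof -
    interpret F: two_frames G0 B0 G B v0 v l0 l "\<epsilon> * K\<^sup>2" \<Lambda>
      using that G0 B0 f0 e0 by (intro tf) (auto simp: spd_def)
    have small: "N * ((1 + \<Lambda>) * (\<epsilon> * K\<^sup>2)) < \<delta>" using eP by (simp add: P_def ac_simps)
    then have "(N * ((1 + \<Lambda>) * (\<epsilon> * K\<^sup>2)))\<^sup>2 < \<delta>\<^sup>2"
      using N L0 e0 by (intro power_strict_mono) auto
    then have sq: "N\<^sup>2 * ((1 + \<Lambda>) * (\<epsilon> * K\<^sup>2))\<^sup>2 < \<delta>\<^sup>2" by (simp add: power_mult_distrib)
    have close: "\<delta> \<le> \<bar>l j - m\<bar>" for j
    proof -
      obtain i where "(l j - l0 i)\<^sup>2 \<le> N * ((1 + \<Lambda>) * (\<epsilon> * K\<^sup>2))\<^sup>2"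
        using F.eigenvalue_close[of j] unfolding N_def by blast
      also have "\<dots> \<le> N\<^sup>2 * ((1 + \<Lambda>) * (\<epsilon> * K\<^sup>2))\<^sup>2"
        using N by (intro mult_right_mono) (auto simp: power2_eq_square)
      also have "\<dots> < \<delta>\<^sup>2" by (rule sq)
      finally have "\<bar>l j - l0 i\<bar> < \<delta>" using d0 by (metis abs_le_square_iff abs_of_pos not_le)
      then show ?thesis using dl[of i] by linarith
    qed
    \<comment> \<open>For the indicator of the region above \<open>m\<close> the difference of
      traces is a difference of two counts. The weighted sum makes it smaller than 1 in absolute
      value, so it is 0.\<close>
    let ?I = "\<lambda>s. if m < s then 1 else (0::real)"
    have "\<bar>?I (l j) - ?I (l0 i)\<bar> \<le> 1 / \<delta>\<^sup>2 * (l j - l0 i)\<^sup>2" for i j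
    proof (cases "(m < l j) = (m < l0 i)")
      case False
      then have "\<delta> \<le> \<bar>l j - l0 i\<bar>" using close[of j] dl[of i] d0 by (auto simp: abs_if split: if_splits)
      then have "\<delta>\<^sup>2 \<le> (l j - l0 i)\<^sup>2" using d0 by (metis abs_le_square_iff abs_of_pos)
      then have "1 \<le> 1 / \<delta>\<^sup>2 * (l j - l0 i)\<^sup>2" using d0 by simp
      then show ?thesis using False by auto
    qed auto
    from F.sum_le_of_quadratic[OF this]
    have "\<bar>(\<Sum>j\<in>UNIV. ?I (l j)) - (\<Sum>i\<in>UNIV. ?I (l0 i))\<bar> \<le> N\<^sup>2 * (1 / \<delta>\<^sup>2) * ((1 + \<Lambda>) * (\<epsilon> * K\<^sup>2))\<^sup>2"
      unfolding F.sum_diff_eq[of ?I] N_def by simp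
    also have "\<dots> < 1" using sq d0 by (simp add: field_simps)
    finally have "\<bar>real (card {i. m < l i}) - real (card {i. m < l0 i})\<bar> < 1"
      by (simp add: sum.If_cases)
    then have "card {i. m < l i} = card {i. m < l0 i}" by linarith
    then show ?thesis using close by simp
  qed
  define Q where "Q = 1 / m\<^sup>2 + \<bar>ln m\<bar> / \<delta>\<^sup>2 + 2 / (m * \<delta>)"
  have Q0: "Q \<ge> 0" using m d0 by (simp add: Q_def)
  define C where "C = N\<^sup>2 * (Q * (1 + \<Lambda>)\<^sup>2 + 1 / m * (1 + \<Lambda>)) * K^4"
  have C0: "C \<ge> 0" using Q0 m L0 by (simp add: C_def)
  have main: "\<bar>top_ln m \<mu> - top_ln m l - top_variation m v l (G' - G) (B' - B)\<bar>
            \<le> C * (norm (G' - G) + norm (B' - B))\<^sup>2"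
    if *: "transpose G = G" "transpose B = B" "norm (G - G0) < \<epsilon>" "norm (B - B0) < \<epsilon>" "eigen_frame G B v l"
      "transpose G' = G'" "transpose B' = B'" "norm (G' - G0) < \<epsilon>" "norm (B' - B0) < \<epsilon>" "eigen_frame G' B' w \<mu>"
    for G B G' B' v w l \<mu>
  proof -
    define \<eta> where "\<eta> = norm (G' - G) + norm (B' - B)"
    interpret F: two_frames G B G' B' v w l \<mu> "\<eta> * K\<^sup>2" \<Lambda>
      using that by (intro tf) (auto simp: \<eta>_def)
    let ?f = "\<lambda>s. if m < s then ln s else 0" and ?f' = "\<lambda>s. if m < s then 1 / s else 0"
    have 1: "\<bar>?f (\<mu> j) - ?f (l i) - ?f' (l i) * (\<mu> j - l i)\<bar> \<le> Q * (\<mu> j - l i)\<^sup>2" for i j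
      unfolding Q_def using near[OF *(1-5)] m d0 by (intro cut_ln_remainder) auto
    have 2: "\<bar>?f' (l i)\<bar> \<le> 1 / m" for i
      using m by (auto intro: divide_left_mono)
    have S: "(\<Sum>i\<in>UNIV. ?f (l i)) = top_ln m l" for l :: "'n \<Rightarrow> real"
      unfolding top_ln_def by (intro sum.mono_neutral_cong_right) auto
    have T: "(\<Sum>i\<in>UNIV. ?f' (l i) * (v i \<bullet> ((B' - B) *v v i) - l i * (v i \<bullet> ((G' - G) *v v i))))
        = top_variation m v l (G' - G) (B' - B)"
      unfolding top_variation_def by (intro sum.mono_neutral_cong_right) auto
    have "\<bar>top_ln m \<mu> - top_ln m l - top_variation m v l (G' - G) (B' - B)\<bar>
        \<le> N\<^sup>2 * (Q * (1 + \<Lambda>)\<^sup>2 + 1 / m * (1 + \<Lambda>)) * (\<eta> * K\<^sup>2)\<^sup>2"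
      using F.trace_function_expansion[of ?f ?f' Q "1 / m", OF 1 Q0 2] unfolding S T N_def .
    also have "\<dots> = C * \<eta>\<^sup>2" unfolding C_def by algebra
    finally show ?thesis unfolding \<eta>_def .
  qed
  show thesis
  proof (rule that[of \<epsilon> C "max K \<Lambda>"])
    show "card {i. m < l i} = card {i. m < l0 i} \<and> norm (v i) \<le> max K \<Lambda> \<and> \<bar>l i\<bar> \<le> max K \<Lambda> \<and> l i \<noteq> m"
      if "transpose G = G" "transpose B = B" "norm (G - G0) < \<epsilon>" "norm (B - B0) < \<epsilon>" "eigen_frame G B v l"
      for G B v l i
      using near[OF that, of i] vK[OF that(3,5), of i] lL[OF that(3-5), of i] d0 by auto
    show "spd G" if "transpose G = G" "norm (G - G0) < \<epsilon>" for G
      using that by (intro \<kappa>) (auto simp: \<epsilon>_def)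
  qed (use e0 C0 K0 main in auto)
qed

section \<open>Singular values and singular vectors\<close>

lemma ginner_eq: "ginner G v w = v \<bullet> (G *v w)"
  by (simp add: ginner_def)

lemma spd_invertible:
  fixes G :: "real^'n^'n"
  assumes "spd G"
  shows "invertible G"
proof -
  have "v = 0" if "G *v v = 0" for v
    using assms that unfolding spd_def by (metis inner_zero_right less_irrefl)
  then show ?thesis
    using matrix_left_invertible_ker[of G] invertible_left_inverse by metis
qed

lemma spd_eqI:
  fixes G :: "real^'n^'n"
  assumes "spd G" "G *v x = G *v y"
  shows "x = y"
  by (metis assms spd_invertible invertible_def matrix_vector_mul_assoc matrix_vector_mul_lid)

text \<open>\<open>metric_adjoint\<close> is a definite description, so existence and uniqueness
  come first. The formula is stated after multiplication by the injective \<open>G\<close>, which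
  avoids inverse matrices later.\<close>

lemma metric_adjoint_eq:
  fixes G G' A :: "real^'n^'n"
  assumes G: "spd G" and G': "transpose G' = G'"
  shows "G *v metric_adjoint G G' ((*v) A) w = transpose A *v (G' *v w)"
proof -
  obtain I where I: "G ** I = mat 1" using spd_invertible[OF G] by (auto simp: invertible_def)
  let ?P = "\<lambda>L'. \<forall>v w. ginner G' (A *v v) w = ginner G v (L' w)"
  have iff: "?P L' \<longleftrightarrow> (\<forall>w. G *v L' w = transpose A *v (G' *v w))" for L'
  proof -
    have "ginner G' (A *v v) w = v \<bullet> (transpose A *v (G' *v w))" for v w
      by (simp add: ginner_eq inner_transpose_matrix del: transpose_matrix_vector)
    then have "?P L' \<longleftrightarrow> (\<forall>w v. v \<bullet> (transpose A *v (G' *v w)) = v \<bullet> (G *v L' w))"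
      by (auto simp: ginner_eq)
    then show ?thesis by (metis vector_eq_ldot)
  qed
  have ex: "?P (\<lambda>w. I *v (transpose A *v (G' *v w)))"
    unfolding iff by (metis I matrix_vector_mul_assoc matrix_vector_mul_lid)
  have uniq: "L1 = L2" if "?P L1" "?P L2" for L1 L2
    using that unfolding iff by - (rule ext, rule spd_eqI[OF G], simp)
  have "\<exists>!L'. ?P L'"
  proof (rule ex1I)
    show "?P (\<lambda>w. I *v (transpose A *v (G' *v w)))" by (rule ex)
    show "L' = (\<lambda>w. I *v (transpose A *v (G' *v w)))" if "?P L'" for L' by (rule uniq[OF that ex])
  qed
  then have "?P (metric_adjoint G G' ((*v) A))"
    unfolding metric_adjoint_def by (rule theI')
  then show ?thesis unfolding iff by blast
qed

text \<open>Multiplication by \<open>G\<close> turns the eigenvalue problem of the composed map into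
  that of the symmetric pencil formed by \<open>G\<close> and the pull-back of \<open>G'\<close>
  under \<open>A\<close>.\<close>

lemma adjoint_eigen_iff:
  fixes G G' A :: "real^'n^'n"
  assumes "spd G" "transpose G' = G'"
  shows "metric_adjoint G G' ((*v) A) (A *v x) = s *\<^sub>R x \<longleftrightarrow>
    (transpose A ** G' ** A) *v x = s *\<^sub>R (G *v x)"
proof -
  have "(transpose A ** G' ** A) *v x = G *v metric_adjoint G G' ((*v) A) (A *v x)"
    by (simp add: metric_adjoint_eq[OF assms] matrix_vector_mul_assoc[symmetric] del: transpose_matrix_vector)
  then show ?thesis
    using spd_eqI[OF assms(1)] by (metis matrix_vector_mult_scaleR)
qed

text \<open>By symmetry, a solution has zero coefficients along the frame vectors whose eigenvalue
  differs from \<open>s\<close>.\<close>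

lemma eigen_space_frame:
  fixes G B :: "real^'n^'n"
  assumes sym: "transpose G = G" "transpose B = B" and f: "eigen_frame G B v l"
  shows "{x. B *v x = s *\<^sub>R (G *v x)} = span (v ` {i. l i = s})"
proof
  show "{x. B *v x = s *\<^sub>R (G *v x)} \<subseteq> span (v ` {i. l i = s})"
  proof clarify
    fix x assume x: "B *v x = s *\<^sub>R (G *v x)"
    have "v i \<bullet> (G *v x) = 0" if "l i \<noteq> s" for i
    proof -
      have "v i \<bullet> (B *v x) = x \<bullet> (B *v v i)" by (rule sym_matrix_inner[OF sym(2)])
      then have "s * (v i \<bullet> (G *v x)) = l i * (x \<bullet> (G *v v i))" using f x by (simp add: eigen_frame_def)
      then show ?thesis using that sym_matrix_inner[OF sym(1), of "v i" x] by simp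
    qed
    then have "(v i \<bullet> (G *v x)) *\<^sub>R v i \<in> span (v ` {i. l i = s})" for i
      by (cases "l i = s") (auto intro: span_scale span_base span_zero)
    then have "(\<Sum>i\<in>UNIV. (v i \<bullet> (G *v x)) *\<^sub>R v i) \<in> span (v ` {i. l i = s})" by (rule span_sum)
    then show "x \<in> span (v ` {i. l i = s})" by (simp add: eigen_frame_expand[OF f])
  qed
  have "subspace {x. B *v x = s *\<^sub>R (G *v x)}"
    by (auto simp: subspace_def matrix_vector_right_distrib matrix_vector_mult_scaleR algebra_simps)
  moreover have "v ` {i. l i = s} \<subseteq> {x. B *v x = s *\<^sub>R (G *v x)}"
    using f by (auto simp: eigen_frame_def)
  ultimately show "span (v ` {i. l i = s}) \<subseteq> {x. B *v x = s *\<^sub>R (G *v x)}"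
    by (intro span_minimal)
qed

lemma eigen_frame_independent:
  fixes G B :: "real^'n^'n"
  assumes f: "eigen_frame G B v l"
  shows "inj v" "independent (range v)"
proof -
  show "inj v"
    using f unfolding eigen_frame_def inj_def by (metis zero_neq_one)
  have "x \<in> span (range v)" for x
    by (subst eigen_frame_expand[OF f, symmetric, of x]) (intro span_sum span_scale span_base rangeI)
  moreover have "card (range v) = dim (UNIV :: (real^'n) set)"
    using \<open>inj v\<close> by (simp add: card_image)
  ultimately show "independent (range v)"
    by (intro card_le_dim_spanning[of _ UNIV]) (auto simp: card_image)
qed

text \<open>Multiplicities in \<open>eigenvalue_mset\<close> are dimensions of eigenspaces. Each
  eigenspace is spanned by the independent frame vectors with that eigenvalue, so dimensions become
  numbers of indices.\<close>

lemma eigenvalue_mset_frame: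
  fixes G G' A :: "real^'n^'n"
  assumes G: "spd G" and G': "transpose G' = G'" and f: "eigen_frame G (transpose A ** G' ** A) v l"
  shows "eigenvalue_mset (metric_adjoint G G' ((*v) A) \<circ> (*v) A) = image_mset l (mset_set UNIV)"
proof -
  let ?B = "transpose A ** G' ** A" and ?T = "metric_adjoint G G' ((*v) A) \<circ> (*v) A"
  have sym: "transpose G = G" "transpose ?B = ?B"
    using G G' by (auto simp: spd_def matrix_transpose_mul matrix_mul_assoc)
  have es: "{x. ?T x = s *\<^sub>R x} = span (v ` {i. l i = s})" for s
    using eigen_space_frame[OF sym f] by (simp add: adjoint_eigen_iff[OF G G'])
  have dim: "dim {x. ?T x = s *\<^sub>R x} = card {i. l i = s}" for s
  proof -
    have "independent (v ` {i. l i = s})"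
      using eigen_frame_independent(2)[OF f] by (rule independent_mono) auto
    then have "dim {x. ?T x = s *\<^sub>R x} = card (v ` {i. l i = s})"
      unfolding es by (rule dim_span_eq_card_independent)
    also have "\<dots> = card {i. l i = s}"
      using eigen_frame_independent(1)[OF f] by (intro card_image) (auto intro: inj_on_subset)
    finally show ?thesis .
  qed
  have ev: "{s. \<exists>x. x \<noteq> 0 \<and> ?T x = s *\<^sub>R x} = range l"
  proof -
    have "(\<exists>x. x \<noteq> 0 \<and> ?T x = s *\<^sub>R x) \<longleftrightarrow> s \<in> range l" for s
    proof
      assume "\<exists>x. x \<noteq> 0 \<and> ?T x = s *\<^sub>R x"
      then have "\<not> {x. ?T x = s *\<^sub>R x} \<subseteq> {0}" by blast
      then have "dim {x. ?T x = s *\<^sub>R x} \<noteq> 0" by simp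
      then show "s \<in> range l" unfolding dim by (auto simp: card_eq_0_iff)
    next
      assume "s \<in> range l"
      then obtain i where "s = l i" by blast
      moreover have "v i \<noteq> 0" using f unfolding eigen_frame_def by (metis inner_zero_left zero_neq_one)
      moreover have "v i \<in> {x. ?T x = l i *\<^sub>R x}" unfolding es by (intro span_base) auto
      ultimately show "\<exists>x. x \<noteq> 0 \<and> ?T x = s *\<^sub>R x" by blast
    qed
    then show ?thesis by blast
  qed
  show ?thesis
  proof (rule multiset_eqI)
    fix s
    have "count (eigenvalue_mset ?T) s = (\<Sum>r\<in>range l. if r = s then card {i. l i = r} else 0)"
      unfolding eigenvalue_mset_def ev dim by (simp add: count_sum)
    also have "\<dots> = card {i. l i = s}" by (auto simp: card_eq_0_iff)
    also have "\<dots> = count (image_mset l (mset_set UNIV)) s"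
      by (simp add: count_image_mset vimage_def)
    finally show "count (eigenvalue_mset ?T) s = count (image_mset l (mset_set UNIV)) s" .
  qed
qed

lemma filter_greater_eq_take:
  fixes xs :: "'a::linorder list"
  assumes "sorted_wrt (\<ge>) xs"
  shows "filter (\<lambda>s. b < s) xs = take (length (filter (\<lambda>s. b < s) xs)) xs"
  using assms
proof (induction xs)
  case (Cons x xs)
  show ?case
  proof (cases "b < x")
    case False
    then have "filter (\<lambda>s. b < s) xs = []" using Cons.prems by (auto simp: filter_empty_conv)
    then show ?thesis using False by simp
  qed (use Cons in auto)
qed simp

lemma singular_values_frame:
  fixes G G' A :: "real^'n^'n"
  assumes G: "spd G" and G': "transpose G' = G'" and f: "eigen_frame G (transpose A ** G' ** A) v l"
  obtains xs where "sorted_wrt (\<ge>) xs" "mset xs = image_mset (\<lambda>i. sqrt (l i)) (mset_set UNIV)"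
    "length xs = CARD('n)" "\<And>i. singular_value i G G' ((*v) A) = xs ! (i - 1)"
proof
  let ?xs = "rev (sorted_list_of_multiset (image_mset sqrt
    (eigenvalue_mset (metric_adjoint G G' ((*v) A) \<circ> (*v) A))))"
  show m: "mset ?xs = image_mset (\<lambda>i. sqrt (l i)) (mset_set UNIV)"
    unfolding mset_rev mset_sorted_list_of_multiset eigenvalue_mset_frame[OF G G' f]
    by (simp add: multiset.map_comp comp_def)
  show "sorted_wrt (\<ge>) ?xs" by (simp add: sorted_wrt_rev)
  have "length ?xs = size (mset ?xs)" by (rule size_mset[symmetric])
  then show "length ?xs = CARD('n)" unfolding m by simp
  show "singular_value i G G' ((*v) A) = ?xs ! (i - 1)" for i by (simp add: singular_value_def)
qed

text \<open>In a nonincreasing list the entries above \<open>sqrt m\<close> form an initial segment,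
  here of length \<open>k\<close>. Its product and its set of values depend only on the multiset, so
  no enumeration of the indices by size has to be chosen.\<close>

lemma singular_values_above:
  fixes G G' A :: "real^'n^'n"
  assumes G: "spd G" and G': "transpose G' = G'" and f: "eigen_frame G (transpose A ** G' ** A) v l"
    and k: "card {i. m < l i} = k"
  shows "(\<Prod>i=1..k. singular_value i G G' ((*v) A)) = (\<Prod>i | m < l i. sqrt (l i))"
    and "(\<lambda>i. singular_value i G G' ((*v) A)) ` {1..k} = (\<lambda>i. sqrt (l i)) ` {i. m < l i}"
proof -
  obtain xs where srt: "sorted_wrt (\<ge>) xs" and m: "mset xs = image_mset (\<lambda>i. sqrt (l i)) (mset_set UNIV)"
    and len: "length xs = CARD('n)" and sv: "\<And>i. singular_value i G G' ((*v) A) = xs ! (i - 1)"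
    using singular_values_frame[OF G G' f] by blast
  let ?ys = "filter (\<lambda>s. sqrt m < s) xs"
  have mf: "mset ?ys = image_mset (\<lambda>i. sqrt (l i)) (mset_set {i. m < l i})"
    by (simp add: mset_filter m filter_mset_image_mset filter_mset_mset_set)
  have "length ?ys = size (mset ?ys)" by (rule size_mset[symmetric])
  also have "\<dots> = k" unfolding mf using k by simp
  finally have leny: "length ?ys = k" .
  then have ys: "?ys = take k xs" using filter_greater_eq_take[OF srt, of "sqrt m"] by simp
  have kl: "k \<le> length xs" using leny length_filter_le[of "\<lambda>s. sqrt m < s" xs] by simp
  have nth: "take k xs = map (\<lambda>i. singular_value i G G' ((*v) A)) [1..<Suc k]"
    using kl by (intro nth_equalityI) (auto simp: sv simp del: upt_Suc)
  have "(\<Prod>i=1..k. singular_value i G G' ((*v) A)) = prod_list (take k xs)"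
    unfolding nth by (simp add: prod.distinct_set_conv_list[symmetric] atLeastLessThanSuc_atLeastAtMost del: upt_Suc)
  also have "\<dots> = prod_mset (mset ?ys)" by (simp add: ys prod_mset_prod_list)
  also have "\<dots> = (\<Prod>i | m < l i. sqrt (l i))" unfolding mf by (simp add: prod_unfold_prod_mset)
  finally show "(\<Prod>i=1..k. singular_value i G G' ((*v) A)) = (\<Prod>i | m < l i. sqrt (l i))" .
  have "(\<lambda>i. singular_value i G G' ((*v) A)) ` {1..k} = set (take k xs)"
    unfolding nth by (simp add: atLeastLessThanSuc_atLeastAtMost del: upt_Suc)
  also have "\<dots> = set_mset (mset ?ys)" unfolding ys[symmetric] by simp
  also have "\<dots> = (\<lambda>i. sqrt (l i)) ` {i. m < l i}" unfolding mf by simp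
  finally show "(\<lambda>i. singular_value i G G' ((*v) A)) ` {1..k} = (\<lambda>i. sqrt (l i)) ` {i. m < l i}" .
qed

text \<open>The level is the square of a number \<open>b\<close> strictly between two consecutive
  singular values; \<open>b\<close> is positive because the smaller of them is nonnegative.\<close>

lemma singular_value_gap_level:
  fixes G G' A :: "real^'n^'n"
  assumes G: "spd G" and G': "spd G'" and f: "eigen_frame G (transpose A ** G' ** A) v l"
    and k: "1 \<le> k" "k < CARD('n)"
    and gap: "singular_value (k + 1) G G' ((*v) A) < singular_value k G G' ((*v) A)"
  obtains m where "0 < m" "card {i. m < l i} = k" "\<And>i. l i \<noteq> m"
proof -
  have G's: "transpose G' = G'" using G' by (simp add: spd_def)
  obtain xs where srt: "sorted_wrt (\<ge>) xs" and ms: "mset xs = image_mset (\<lambda>i. sqrt (l i)) (mset_set UNIV)"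
    and len: "length xs = CARD('n)" and sv: "\<And>i. singular_value i G G' ((*v) A) = xs ! (i - 1)"
    using singular_values_frame[OF G G's f] by blast
  have set: "set xs = range (\<lambda>i. sqrt (l i))" using arg_cong[OF ms, of set_mset] by simp
  have lpos: "0 \<le> l i" for i
  proof -
    have "l i = v i \<bullet> ((transpose A ** G' ** A) *v v i)" using f by (simp add: eigen_frame_def)
    also have "\<dots> = (A *v v i) \<bullet> (G' *v (A *v v i))"
      by (simp add: matrix_vector_mul_assoc[symmetric] inner_transpose_matrix del: transpose_matrix_vector)
    also have "\<dots> \<ge> 0" using G' unfolding spd_def by (metis inner_zero_left less_eq_real_def)
    finally show ?thesis .
  qed
  have nn: "0 \<le> xs ! k" using k len lpos set nth_mem[of k xs] by auto
  \<comment> \<open>List positions start at 0 and singular values at 1, so these are the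
    \<open>(k + 1)\<close>-st and the \<open>k\<close>-th singular value.\<close>
  have "xs ! k < xs ! (k - 1)" using gap by (simp add: sv)
  then obtain b where b: "xs ! k < b" "b < xs ! (k - 1)" using dense by blast
  have b0: "0 < b" using nn b by linarith
  have up: "b < xs ! i" if "i < k" for i
  proof (cases "i = k - 1")
    case False
    then have "i < k - 1" using that by linarith
    then have "xs ! (k - 1) \<le> xs ! i" using k len by (intro sorted_wrt_nth_less[OF srt]) auto
    then show ?thesis using b by linarith
  qed (use b in simp)
  have low: "xs ! i < b" if "k \<le> i" "i < length xs" for i
    using that b sorted_wrt_nth_less[OF srt, of k i] by (cases "i = k") auto
  have "filter (\<lambda>s. b < s) xs = filter (\<lambda>s. b < s) (take k xs) @ filter (\<lambda>s. b < s) (drop k xs)"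
    by (metis append_take_drop_id filter_append)
  also have "filter (\<lambda>s. b < s) (take k xs) = take k xs"
    using up by (auto simp: filter_id_conv in_set_conv_nth)
  also have "filter (\<lambda>s. b < s) (drop k xs) = []"
    using low by (auto simp: filter_empty_conv in_set_conv_nth) (metis add.commute le_add1 less_asym' less_diff_conv)
  finally have "length (filter (\<lambda>s. b < s) xs) = k" using k len by simp
  then have "size (filter_mset (\<lambda>s. b < s) (mset xs)) = k" by (metis mset_filter size_mset)
  then have "card {i. b < sqrt (l i)} = k"
    by (simp add: ms filter_mset_image_mset filter_mset_mset_set)
  moreover have "b < sqrt (l i) \<longleftrightarrow> b\<^sup>2 < l i" for i
    using b0 by (metis less_imp_le real_less_rsqrt real_sqrt_abs abs_of_pos real_sqrt_less_iff)
  ultimately have "card {i. b\<^sup>2 < l i} = k" by simp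
  moreover have "l i \<noteq> b\<^sup>2" for i
  proof
    assume "l i = b\<^sup>2"
    then have "b \<in> set xs" unfolding set using b0 by (metis abs_of_pos rangeI real_sqrt_abs)
    then obtain i where "i < length xs" "xs ! i = b" by (auto simp: in_set_conv_nth)
    then show False using up[of i] low[of i] by (cases "i < k") auto
  qed
  ultimately show thesis using that[of "b\<^sup>2"] b0 by simp
qed

text \<open>By the count, the first \<open>k\<close> singular values are those above
  \<open>sqrt m\<close>, and the eigenspace of each is spanned by frame vectors whose eigenvalue
  again lies above \<open>m\<close>.\<close>

lemma right_singular_space_frame:
  fixes G G' A :: "real^'n^'n"
  assumes G: "spd G" and G': "transpose G' = G'" and f: "eigen_frame G (transpose A ** G' ** A) v l"
    and k: "card {i. m < l i} = k" and m: "0 < m"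
  shows "right_singular_space k G G' ((*v) A) = span (v ` {i. m < l i})"
proof -
  let ?B = "transpose A ** G' ** A"
  have sym: "transpose G = G" "transpose ?B = ?B"
    using G G' by (auto simp: spd_def matrix_transpose_mul matrix_mul_assoc)
  let ?S = "{w. \<exists>i\<in>{1..k}. metric_adjoint G G' ((*v) A) (A *v w) = (singular_value i G G' ((*v) A))\<^sup>2 *\<^sub>R w}"
  have "?S = {w. \<exists>s\<in>(\<lambda>i. singular_value i G G' ((*v) A)) ` {1..k}. ?B *v w = s\<^sup>2 *\<^sub>R (G *v w)}"
    by (simp add: adjoint_eigen_iff[OF G G'])
  also have "\<dots> = {w. \<exists>j\<in>{i. m < l i}. ?B *v w = (sqrt (l j))\<^sup>2 *\<^sub>R (G *v w)}"
    unfolding singular_values_above(2)[OF G G' f k] by simp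
  also have "\<dots> = (\<Union>j\<in>{i. m < l i}. span (v ` {i. l i = l j}))"
    using m by (auto simp: eigen_space_frame[OF sym f, symmetric])
  finally have S: "?S = (\<Union>j\<in>{i. m < l i}. span (v ` {i. l i = l j}))" .
  have "span ?S = span (v ` {i. m < l i})"
  proof
    have "?S \<subseteq> span (v ` {i. m < l i})"
      unfolding S by (intro UN_least span_mono image_mono) auto
    then show "span ?S \<subseteq> span (v ` {i. m < l i})" by (rule span_minimal) simp
    have "v ` {i. m < l i} \<subseteq> ?S" unfolding S by (auto intro!: span_base)
    then show "span (v ` {i. m < l i}) \<subseteq> span ?S" by (rule span_mono)
  qed
  then show ?thesis unfolding right_singular_space_def .
qed

text \<open>\<open>A\<close> carries right singular vectors to multiples of left ones. The factor
  \<open>1 / sqrt (l i)\<close> normalises the images with respect to \<open>G'\<close> and does not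
  affect the span.\<close>

lemma left_singular_space_frame:
  fixes G G' A :: "real^'n^'n"
  assumes G: "spd G" and G': "transpose G' = G'" and f: "eigen_frame G (transpose A ** G' ** A) v l"
    and k: "card {i. m < l i} = k" and m: "0 < m"
  shows "left_singular_space k G G' ((*v) A) = span ((\<lambda>i. (1 / sqrt (l i)) *\<^sub>R (A *v v i)) ` {i. m < l i})"
proof -
  let ?B = "transpose A ** G' ** A" and ?ad = "metric_adjoint G G' ((*v) A)"
  let ?u = "\<lambda>i. (1 / sqrt (l i)) *\<^sub>R (A *v v i)"
  have sym: "transpose G = G" "transpose ?B = ?B"
    using G G' by (auto simp: spd_def matrix_transpose_mul matrix_mul_assoc)
  let ?S = "{w. \<exists>i\<in>{1..k}. A *v (?ad w) = (singular_value i G G' ((*v) A))\<^sup>2 *\<^sub>R w}"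
  have "?S = {w. \<exists>s\<in>(\<lambda>i. singular_value i G G' ((*v) A)) ` {1..k}. A *v (?ad w) = s\<^sup>2 *\<^sub>R w}"
    by simp
  also have "\<dots> = {w. \<exists>j\<in>{i. m < l i}. A *v (?ad w) = (sqrt (l j))\<^sup>2 *\<^sub>R w}"
    unfolding singular_values_above(2)[OF G G' f k] by simp
  also have "\<dots> = {w. \<exists>j\<in>{i. m < l i}. A *v (?ad w) = l j *\<^sub>R w}"
    using m by auto
  finally have S: "?S = {w. \<exists>j\<in>{i. m < l i}. A *v (?ad w) = l j *\<^sub>R w}" .
  have span_Av: "span (?u ` {i. m < l i}) = (*v) A ` span (v ` {i. m < l i})"
  proof -
    have "span (?u ` {i. m < l i}) = span ((\<lambda>i. A *v v i) ` {i. m < l i})"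
    proof
      show "span (?u ` {i. m < l i}) \<subseteq> span ((\<lambda>i. A *v v i) ` {i. m < l i})"
        by (intro span_minimal) (auto intro!: span_scale[OF span_base])
      have "A *v v i \<in> span (?u ` {i. m < l i})" if "m < l i" for i
      proof -
        have "sqrt (l i) *\<^sub>R ?u i \<in> span (?u ` {i. m < l i})"
          using that by (intro span_scale span_base) auto
        then show ?thesis using that m by simp
      qed
      then show "span ((\<lambda>i. A *v v i) ` {i. m < l i}) \<subseteq> span (?u ` {i. m < l i})"
        by (intro span_minimal) auto
    qed
    also have "\<dots> = (*v) A ` span (v ` {i. m < l i})"
      by (simp add: linear_span_image[OF matrix_vector_mul_linear, symmetric] image_image)
    finally show ?thesis .
  qed
  have "span ?S = span (?u ` {i. m < l i})"
  proof
    have "?S \<subseteq> span (?u ` {i. m < l i})"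
      unfolding S
    proof clarify
      \<comment> \<open>The adjoint sends such a \<open>w\<close> to a solution of the pencil
        equation with the same eigenvalue, and \<open>w\<close> is recovered by applying
        \<open>A\<close> and dividing by \<open>l j\<close>.\<close>
      fix w j assume j: "m < l j" and w: "A *v (?ad w) = l j *\<^sub>R w"
      have "?B *v (?ad w) = transpose A *v (G' *v (A *v ?ad w))"
        by (simp add: matrix_vector_mul_assoc matrix_mul_assoc)
      also have "\<dots> = l j *\<^sub>R (G *v ?ad w)"
        by (simp add: w matrix_vector_mult_scaleR metric_adjoint_eq[OF G G'] del: transpose_matrix_vector)
      finally have "?ad w \<in> span (v ` {i. l i = l j})"
        using eigen_space_frame[OF sym f, of "l j"] by blast
      also have "\<dots> \<subseteq> span (v ` {i. m < l i})" using j by (intro span_mono) auto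
      finally have "A *v ?ad w \<in> span (?u ` {i. m < l i})" unfolding span_Av by blast
      then have "(1 / l j) *\<^sub>R (A *v ?ad w) \<in> span (?u ` {i. m < l i})" by (rule span_scale)
      then show "w \<in> span (?u ` {i. m < l i})" using j m by (simp add: w)
    qed
    then show "span ?S \<subseteq> span (?u ` {i. m < l i})" by (rule span_minimal) simp
    have "?u i \<in> ?S" if "m < l i" for i
    proof -
      have "G *v ?ad (?u i) = (1 / sqrt (l i)) *\<^sub>R (?B *v v i)"
        by (simp add: metric_adjoint_eq[OF G G'] matrix_vector_mult_scaleR matrix_vector_mul_assoc[symmetric]
            del: transpose_matrix_vector)
      also have "\<dots> = G *v ((1 / sqrt (l i)) *\<^sub>R (l i *\<^sub>R v i))"
        using f by (simp add: eigen_frame_def matrix_vector_mult_scaleR)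
      finally have "?ad (?u i) = (1 / sqrt (l i)) *\<^sub>R (l i *\<^sub>R v i)" by (rule spd_eqI[OF G])
      then have "A *v ?ad (?u i) = l i *\<^sub>R ?u i" by (simp add: matrix_vector_mult_scaleR)
      then show ?thesis unfolding S using that by blast
    qed
    then show "span (?u ` {i. m < l i}) \<subseteq> span ?S" by (intro span_mono) auto
  qed
  then show ?thesis unfolding left_singular_space_def .
qed

text \<open>As \<open>orth_projection\<close> is a definite description, uniqueness is part of the
  claim: the difference of two candidates lies in the span and is \<open>G\<close>-orthogonal to
  itself.\<close>

lemma orth_projection_frame:
  fixes G :: "real^'n^'n"
  assumes G: "spd G" and I: "finite I" and on: "\<And>i j. i \<in> I \<Longrightarrow> j \<in> I \<Longrightarrow> u i \<bullet> (G *v u j) = (if i = j then 1 else 0)"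
  shows "orth_projection G (span (u ` I)) x = (\<Sum>i\<in>I. (u i \<bullet> (G *v x)) *\<^sub>R u i)"
proof -
  let ?p = "\<Sum>i\<in>I. (u i \<bullet> (G *v x)) *\<^sub>R u i"
  have sym: "transpose G = G" using G by (simp add: spd_def)
  have p: "?p \<in> span (u ` I)" by (intro span_sum span_scale span_base) auto
  have "u j \<bullet> (G *v (x - ?p)) = 0" if "j \<in> I" for j
  proof -
    have "(\<Sum>i\<in>I. (u i \<bullet> (G *v x)) * (u j \<bullet> (G *v u i))) = (\<Sum>i\<in>I. if i = j then u i \<bullet> (G *v x) else 0)"
      using that by (intro sum.cong) (auto simp: on)
    then show ?thesis using that I
      by (simp add: matrix_vector_mult_diff_distrib inner_diff_right linear_sum[OF matrix_vector_mul_linear]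
          inner_sum_right matrix_vector_mult_scaleR)
  qed
  then have "\<forall>w\<in>u ` I. w \<in> {w. w \<bullet> (G *v (x - ?p)) = 0}" by auto
  moreover have "subspace {w. w \<bullet> (G *v (x - ?p)) = 0}" by (auto simp: subspace_def inner_simps)
  ultimately have "span (u ` I) \<subseteq> {w. w \<bullet> (G *v (x - ?p)) = 0}" by (intro span_minimal) auto
  then have o: "\<forall>w\<in>span (u ` I). ginner G (x - ?p) w = 0"
    by (auto simp: ginner_eq sym_matrix_inner[OF sym, of "x - ?p"])
  show ?thesis
    unfolding orth_projection_def
  proof (rule the_equality)
    show "?p \<in> span (u ` I) \<and> (\<forall>w\<in>span (u ` I). ginner G (x - ?p) w = 0)" using p o by blast
    fix q assume q: "q \<in> span (u ` I) \<and> (\<forall>w\<in>span (u ` I). ginner G (x - q) w = 0)"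
    define d where "d = q - ?p"
    have "d \<in> span (u ` I)" unfolding d_def using p q by (simp add: span_diff)
    then have "ginner G (x - ?p) d = 0" "ginner G (x - q) d = 0" using o q by blast+
    moreover have "ginner G d d = ginner G (x - ?p) d - ginner G (x - q) d"
      by (simp add: ginner_eq inner_diff_left d_def)
    ultimately have "d \<bullet> (G *v d) = 0" by (simp add: ginner_eq)
    moreover have "d \<noteq> 0 \<Longrightarrow> 0 < d \<bullet> (G *v d)" using G unfolding spd_def by blast
    ultimately have "d = 0" by auto
    then show "q = ?p" by (simp add: d_def)
  qed
qed

section \<open>Pairing of tensors with orthogonal projections\<close>

lemma matrix_add_rdistrib: "(A + B) ** C = A ** C + B ** C" for A B :: "real^'n^'m" and C :: "real^'k^'n"
  by (simp add: vec_eq_iff matrix_matrix_mult_def sum.distrib distrib_right)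

lemma trace_scaleR: "trace (r *\<^sub>R A) = r * trace A" for A :: "real^'n^'n"
  by (simp add: trace_def sum_distrib_left)

text \<open>Multiplication by the symmetric \<open>J\<close> on both sides turns the rank-one matrix
  of \<open>z\<close> into that of \<open>J *v z\<close>, and the trace of a rank-one matrix is an
  inner product.\<close>

lemma trace_outer_sandwich:
  fixes J H :: "real^'n^'n"
  assumes "transpose J = J"
  shows "trace (J ** (\<chi> p q. z $ p * z $ q) ** J ** H) = (J *v z) \<bullet> (H *v (J *v z))"
proof -
  let ?O = "\<lambda>x y::real^'n. (\<chi> p q. x $ p * y $ q) :: real^'n^'n"
  have 1: "J ** ?O z z = ?O (J *v z) z"
    by (simp add: vec_eq_iff matrix_matrix_mult_def matrix_vector_mult_def sum_distrib_right mult.assoc)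
  have 2: "?O x y ** X = ?O x (transpose X *v y)" for x y :: "real^'n" and X :: "real^'n^'n"
    by (simp add: vec_eq_iff matrix_matrix_mult_def matrix_vector_mult_def transpose_def sum_distrib_left ac_simps
        del: transpose_matrix_vector)
  have 3: "trace (?O x y) = x \<bullet> y" for x y :: "real^'n" by (simp add: trace_def inner_vec_def)
  show ?thesis
    unfolding 1 2 3 assms by (simp only: inner_transpose_matrix inner_commute)
qed

lemma matrix_inv_works:
  fixes M :: "real^'n^'n"
  assumes "invertible M"
  shows "M ** matrix_inv M = mat 1 \<and> matrix_inv M ** M = mat 1"
  using assms unfolding invertible_def matrix_inv_def by (rule someI_ex)

text \<open>The rank-one map built from \<open>u\<close> has as its tensor the rank-one matrix of
  \<open>G *v u\<close>. The two inverses of \<open>G\<close> in \<open>tensor_inner\<close> strip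
  off both copies of \<open>G\<close> and leave \<open>h\<close> evaluated on
  \<open>u\<close>.\<close>

lemma tensor_inner_frames:
  fixes G h :: "real^'n^'n"
  assumes G: "spd G"
  shows "tensor_inner G (tensor_of_map G (\<lambda>x. (\<Sum>i\<in>I. (u i \<bullet> (G *v x)) *\<^sub>R u i) - (\<Sum>i\<in>J. (v i \<bullet> (G *v x)) *\<^sub>R v i))) h
    = (\<Sum>i\<in>I. u i \<bullet> (h *v u i)) - (\<Sum>i\<in>J. v i \<bullet> (h *v v i))"
proof -
  have sym: "transpose G = G" using G by (simp add: spd_def)
  let ?O = "\<lambda>z. (\<chi> p q. z $ p * z $ q) :: real^'n^'n"
  let ?J = "matrix_inv G"
  have inv: "?J ** G = mat 1" "G ** ?J = mat 1" using matrix_inv_works[OF spd_invertible[OF G]] by auto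
  have symJ: "transpose ?J = ?J"
  proof -
    have "transpose ?J ** G = mat 1" using inv(2) by (metis matrix_transpose_mul sym transpose_mat)
    then show ?thesis using inv(2) by (metis matrix_mul_assoc matrix_mul_lid matrix_mul_rid)
  qed
  have e: "axis p 1 \<bullet> x = x $ p" for p and x :: "real^'n" by (simp add: inner_axis inner_commute)
  have uG: "u \<bullet> (G *v axis p 1) = (G *v u) $ p" for u p
    using sym_matrix_inner[OF sym, of u "axis p 1"] by (simp add: e)
  have T: "tensor_of_map G (\<lambda>x. (\<Sum>i\<in>I. (u i \<bullet> (G *v x)) *\<^sub>R u i) - (\<Sum>i\<in>J. (v i \<bullet> (G *v x)) *\<^sub>R v i))
      = (\<Sum>i\<in>I. ?O (G *v u i)) - (\<Sum>i\<in>J. ?O (G *v v i))"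
    by (simp add: vec_eq_iff tensor_of_map_def ginner_eq uG matrix_vector_mult_diff_distrib
        linear_sum[OF matrix_vector_mul_linear] matrix_vector_mult_scaleR)
  have tr: "trace (?J ** ?O (G *v u) ** ?J ** h) = u \<bullet> (h *v u)" for u
    by (simp add: trace_outer_sandwich[OF symJ] matrix_vector_mul_assoc inv)
  have lin: "linear (\<lambda>X. trace (?J ** X ** ?J ** h))"
    by (intro linearI) (simp_all add: matrix_add_ldistrib matrix_add_rdistrib trace_add trace_scaleR
        scalar_matrix_assoc[symmetric] matrix_scalar_ac)
  show ?thesis
    unfolding T tensor_inner_def
    by (simp only: linear_diff[OF lin] linear_sum[OF lin] tr)
qed

lemma tensor_inner_frame:
  fixes G h :: "real^'n^'n"
  assumes G: "spd G"
  shows "tensor_inner G (tensor_of_map G (\<lambda>x. \<Sum>i\<in>I. (u i \<bullet> (G *v x)) *\<^sub>R u i)) h = (\<Sum>i\<in>I. u i \<bullet> (h *v u i))"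
  using tensor_inner_frames[OF G, where I = I and u = u and J = "{}"] by simp

section \<open>Calculus of iterated partial derivatives\<close>

lemma Ck_on_SucD: "Ck_on (Suc n) S F \<Longrightarrow> Ck_on n S F"
proof (induction n arbitrary: F)
  case 0
  then show ?case by (simp add: differentiable_imp_continuous_on)
next
  case (Suc n)
  then have "F differentiable_on S" "\<forall>b\<in>Basis. Ck_on (Suc n) S (\<lambda>x. frechet_derivative F (at x) b)"
    unfolding Ck_on.simps(2)[of "Suc n"] by blast+
  then show ?case using Suc.IH by simp
qed

lemma Ck_on_differentiable: "Ck_on (Suc n) S F \<Longrightarrow> open S \<Longrightarrow> x \<in> S \<Longrightarrow> F differentiable (at x)"
  by (metis Ck_on.simps(2) at_within_open differentiable_on_def)

lemma smooth_on_differentiable: "smooth_on S F \<Longrightarrow> open S \<Longrightarrow> x \<in> S \<Longrightarrow> F differentiable (at x)"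
  unfolding smooth_on_def using Ck_on_differentiable by blast

lemma smooth_on_imp_continuous_on: "smooth_on S F \<Longrightarrow> continuous_on S F"
  unfolding smooth_on_def by (metis Ck_on.simps(1))

lemma frechet_derivative_cong_open:
  assumes S: "open S" "x \<in> S" and eq: "\<And>y. y \<in> S \<Longrightarrow> F y = G y"
  shows "frechet_derivative F (at x) = frechet_derivative G (at x)"
proof -
  have "(F has_derivative F') (at x) \<longleftrightarrow> (G has_derivative F') (at x)" for F'
    using has_derivative_transform_within_open[OF _ S, of F F' UNIV G]
      has_derivative_transform_within_open[OF _ S, of G F' UNIV F] eq by auto
  then show ?thesis unfolding frechet_derivative_def by simp
qed

text \<open>Derivatives at points of an open set see only values inside it, so behaviour outside
  \<open>S\<close> is irrelevant at every order.\<close>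

lemma Ck_on_cong:
  assumes S: "open S" and eq: "\<And>x. x \<in> S \<Longrightarrow> F x = G x" and F: "Ck_on n S F"
  shows "Ck_on n S G"
  using eq F
proof (induction n arbitrary: F G)
  case 0
  then show ?case using continuous_on_cong[of S S F G] by simp
next
  case (Suc n)
  have D: "frechet_derivative F (at x) = frechet_derivative G (at x)" if "x \<in> S" for x
    using frechet_derivative_cong_open[OF S that] Suc.prems(1) by blast
  have "F differentiable_on S" using Suc.prems(2) by simp
  then have "G differentiable_on S"
    unfolding differentiable_on_def differentiable_def using Suc.prems(1) by (metis has_derivative_transform)
  moreover have "Ck_on n S (\<lambda>x. frechet_derivative G (at x) b)" if "b \<in> Basis" for b
  proof (rule Suc.IH)
    show "Ck_on n S (\<lambda>x. frechet_derivative F (at x) b)" using Suc.prems(2) that by simp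
  qed (simp add: D)
  ultimately show ?case by simp
qed

text \<open>The working form of the recursion: a derivative in closed form replaces
  \<open>frechet_derivative\<close>, so that closure properties follow by induction from the
  ordinary rules of differentiation.\<close>

lemma Ck_on_has_derivI:
  assumes S: "open S" and F: "\<And>x. x \<in> S \<Longrightarrow> (F has_derivative F' x) (at x)"
    and n: "\<And>b. b \<in> Basis \<Longrightarrow> Ck_on n S (\<lambda>x. F' x b)"
  shows "Ck_on (Suc n) S F"
proof -
  have *: "F' x b = frechet_derivative F (at x) b" if "x \<in> S" for x b
    using frechet_derivative_at[OF F[OF that]] by simp
  have "Ck_on n S (\<lambda>x. frechet_derivative F (at x) b)" if "b \<in> Basis" for b
    by (rule Ck_on_cong[OF S _ n[OF that]]) (simp add: *)
  moreover have "F differentiable_on S"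
    unfolding differentiable_on_def using F S by (metis at_within_open differentiable_def)
  ultimately show ?thesis by simp
qed

lemma Ck_on_has_derivative:
  assumes "Ck_on (Suc n) S F" "open S" "x \<in> S"
  shows "(F has_derivative frechet_derivative F (at x)) (at x)"
  using Ck_on_differentiable[OF assms] frechet_derivative_works by blast

lemma Ck_on_deriv: "Ck_on (Suc n) S F \<Longrightarrow> b \<in> Basis \<Longrightarrow> Ck_on n S (\<lambda>x. frechet_derivative F (at x) b)"
  by simp

lemma Ck_on_const: "open S \<Longrightarrow> Ck_on n S (\<lambda>x. k)"
proof (induction n arbitrary: k)
  case (Suc n)
  then show ?case by (intro Ck_on_has_derivI[where F' = "\<lambda>x h. 0"]) auto
qed simp

lemma Ck_on_bounded_linear: "open S \<Longrightarrow> bounded_linear L \<Longrightarrow> Ck_on n S L"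
proof (induction n)
  case 0
  then show ?case by (simp add: linear_continuous_on)
next
  case (Suc n)
  then show ?case
    by (intro Ck_on_has_derivI[where F' = "\<lambda>x. L"]) (auto intro: Ck_on_const bounded_linear_imp_has_derivative)
qed

lemma Ck_on_linear_comp:
  assumes "open S" "bounded_linear L" "Ck_on n S F"
  shows "Ck_on n S (\<lambda>x. L (F x))"
  using assms(3)
proof (induction n arbitrary: F)
  case 0
  then show ?case using assms(2) by (simp add: bounded_linear.continuous_on)
next
  case (Suc n)
  show ?case
  proof (rule Ck_on_has_derivI[OF assms(1)])
    show "((\<lambda>x. L (F x)) has_derivative (\<lambda>h. L (frechet_derivative F (at x) h))) (at x)" if "x \<in> S" for x
      by (rule bounded_linear.has_derivative[OF assms(2) Ck_on_has_derivative[OF Suc.prems assms(1) that]])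
    show "Ck_on n S (\<lambda>x. L (frechet_derivative F (at x) b))" if "b \<in> Basis" for b
      by (rule Suc.IH[OF Ck_on_deriv[OF Suc.prems that]])
  qed
qed

lemma Ck_on_add:
  assumes "open S" "Ck_on n S F" "Ck_on n S G"
  shows "Ck_on n S (\<lambda>x. F x + G x)"
  using assms(2,3)
proof (induction n arbitrary: F G)
  case 0
  then show ?case by (simp add: continuous_on_add)
next
  case (Suc n)
  show ?case
  proof (rule Ck_on_has_derivI[OF assms(1)])
    show "((\<lambda>x. F x + G x) has_derivative
      (\<lambda>h. frechet_derivative F (at x) h + frechet_derivative G (at x) h)) (at x)" if "x \<in> S" for x
      by (intro has_derivative_add Ck_on_has_derivative[OF Suc.prems(1) assms(1) that]
          Ck_on_has_derivative[OF Suc.prems(2) assms(1) that])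
    show "Ck_on n S (\<lambda>x. frechet_derivative F (at x) b + frechet_derivative G (at x) b)" if "b \<in> Basis" for b
      by (rule Suc.IH[OF Ck_on_deriv[OF Suc.prems(1) that] Ck_on_deriv[OF Suc.prems(2) that]])
  qed
qed

text \<open>The product rule gives two terms of the same shape: one argument is differentiated, the
  other loses one order through \<open>Ck_on_SucD\<close>, and the induction hypothesis covers
  both.\<close>

lemma Ck_on_bilinear:
  assumes "open S" and B: "bounded_bilinear B" and "Ck_on n S F" "Ck_on n S G"
  shows "Ck_on n S (\<lambda>x. B (F x) (G x))"
  using assms(3,4)
proof (induction n arbitrary: F G)
  case 0
  then show ?case using B by (simp add: bounded_bilinear.continuous_on)
next
  case (Suc n)
  show ?case
  proof (rule Ck_on_has_derivI[OF assms(1)])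
    show "((\<lambda>x. B (F x) (G x)) has_derivative
      (\<lambda>h. B (F x) (frechet_derivative G (at x) h) + B (frechet_derivative F (at x) h) (G x))) (at x)" if "x \<in> S" for x
      by (rule bounded_bilinear.FDERIV[OF B Ck_on_has_derivative[OF Suc.prems(1) assms(1) that]
          Ck_on_has_derivative[OF Suc.prems(2) assms(1) that]])
    show "Ck_on n S (\<lambda>x. B (F x) (frechet_derivative G (at x) b) + B (frechet_derivative F (at x) b) (G x))"
      if "b \<in> Basis" for b
      by (intro Ck_on_add assms(1) Suc.IH Ck_on_SucD[OF Suc.prems(1)] Ck_on_SucD[OF Suc.prems(2)]
          Ck_on_deriv[OF Suc.prems(1) that] Ck_on_deriv[OF Suc.prems(2) that])
  qed
qed

lemma Ck_on_sum:
  assumes "open S" "\<And>i. i \<in> I \<Longrightarrow> Ck_on n S (F i)"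
  shows "Ck_on n S (\<lambda>x. \<Sum>i\<in>I. F i x)"
  using assms(2)
proof (induction I rule: infinite_finite_induct)
  case (insert i I)
  then show ?case by (simp add: Ck_on_add assms(1))
qed (simp_all add: Ck_on_const assms(1))

lemma Ck_on_prod:
  fixes F :: "'i \<Rightarrow> 'a::euclidean_space \<Rightarrow> real"
  assumes "open S" "\<And>i. i \<in> I \<Longrightarrow> Ck_on n S (F i)"
  shows "Ck_on n S (\<lambda>x. \<Prod>i\<in>I. F i x)"
  using assms(2)
proof (induction I rule: infinite_finite_induct)
  case (insert i I)
  then show ?case by (simp add: Ck_on_bilinear[OF assms(1) bounded_bilinear_mult])
qed (simp_all add: Ck_on_const assms(1))

text \<open>The exponent is generalised in the induction because each differentiation lowers it by
  1.\<close>

lemma Ck_on_powr: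
  fixes u :: "'a::euclidean_space \<Rightarrow> real"
  assumes S: "open S" and u: "Ck_on n S u" "\<And>x. x \<in> S \<Longrightarrow> 0 < u x"
  shows "Ck_on n S (\<lambda>x. u x powr a)"
  using u(1)
proof (induction n arbitrary: a)
  case 0
  then show ?case using u(2) by (auto intro!: continuous_intros simp: less_imp_neq[symmetric])
next
  case (Suc n)
  show ?case
  proof (rule Ck_on_has_derivI[OF S])
    show "((\<lambda>x. u x powr a) has_derivative
      (\<lambda>h. (a * u x powr (a - 1)) * frechet_derivative u (at x) h)) (at x)" if "x \<in> S" for x
    proof -
      have "((\<lambda>r. r powr a) has_derivative (\<lambda>h. (a * u x powr (a - 1)) * h)) (at (u x))"
        using has_real_derivative_powr[OF u(2)[OF that], of a] by (simp add: has_field_derivative_def)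
      from diff_chain_at[OF Ck_on_has_derivative[OF Suc.prems S that] this] show ?thesis by (simp add: comp_def)
    qed
    show "Ck_on n S (\<lambda>x. a * u x powr (a - 1) * frechet_derivative u (at x) b)" if "b \<in> Basis" for b
      by (intro Ck_on_bilinear[OF S bounded_bilinear_mult] Ck_on_const S Suc.IH Ck_on_SucD[OF Suc.prems]
          Ck_on_deriv[OF Suc.prems that])
  qed
qed

lemma Ck_on_snd:
  fixes F :: "'a::euclidean_space \<Rightarrow> 'b::real_normed_vector"
  assumes I: "open (I :: 'c::euclidean_space set)" and U: "open U" and F: "Ck_on n U F"
  shows "Ck_on n (I \<times> U) (\<lambda>z. F (snd z))"
  using F
proof (induction n arbitrary: F)
  case 0
  then show ?case by (auto intro!: continuous_on_compose2[of U F] continuous_intros)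
next
  case (Suc n)
  show ?case
  proof (rule Ck_on_has_derivI)
    show "((\<lambda>z. F (snd z)) has_derivative (\<lambda>h. frechet_derivative F (at (snd z)) (snd h))) (at z)" if "z \<in> I \<times> U" for z
      using diff_chain_at[of snd snd z F] Ck_on_has_derivative[OF Suc.prems U, of "snd z"] that
      by (auto simp: comp_def has_derivative_snd intro: bounded_linear_imp_has_derivative bounded_linear_snd)
    show "Ck_on n (I \<times> U) (\<lambda>z. frechet_derivative F (at (snd z)) (snd b))" if b: "b \<in> Basis" for b
    \<comment> \<open>A basis vector of the product either points along the first factor, where the
      derivative vanishes, or projects to a basis vector of the second, where the induction
      hypothesis applies.\<close>
    proof (cases "snd b = 0")
      case True
      then have "Ck_on n (I \<times> U) (\<lambda>z. 0 :: 'b)" by (intro Ck_on_const open_Times I U)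
      moreover have "frechet_derivative F (at (snd z)) (snd b) = 0" if "z \<in> I \<times> U" for z
        using has_derivative_linear[OF Ck_on_has_derivative[OF Suc.prems U, of "snd z"]] that True
        by (auto simp: linear_0)
      ultimately show ?thesis by - (rule Ck_on_cong[OF open_Times[OF I U], where F = "\<lambda>z. 0"], auto)
    next
      case False
      then have "snd b \<in> Basis" using b by (auto simp: Basis_prod_def)
      then show ?thesis by (intro Suc.IH Ck_on_deriv[OF Suc.prems])
    qed
  qed (intro open_Times I U)+
qed

lemma slice_has_derivative:
  assumes "(F has_derivative F') (at (t, y))"
  shows "((\<lambda>y. F (t, y)) has_derivative (\<lambda>h. F' (0, h))) (at y)"
    and "((\<lambda>t. F (t, y)) has_derivative (\<lambda>h. F' (h, 0))) (at t)"
proof -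
  have "((\<lambda>y. (t, y)) has_derivative (\<lambda>h. (0, h))) (at y)" "((\<lambda>t. (t, y)) has_derivative (\<lambda>h. (h, 0))) (at t)"
    by (auto intro!: derivative_eq_intros)
  with assms show "((\<lambda>y. F (t, y)) has_derivative (\<lambda>h. F' (0, h))) (at y)"
    "((\<lambda>t. F (t, y)) has_derivative (\<lambda>h. F' (h, 0))) (at t)"
    using diff_chain_at[of "\<lambda>y. (t, y)" "\<lambda>h. (0, h)" y F F'] diff_chain_at[of "\<lambda>t. (t, y)" "\<lambda>h. (h, 0)" t F F']
    by (auto simp: comp_def)
qed

lemma Ck_on_slice:
  fixes F :: "'c::euclidean_space \<times> 'a::euclidean_space \<Rightarrow> 'b::real_normed_vector"
  assumes I: "open I" and U: "open U" and F: "Ck_on n (I \<times> U) F" and t: "t \<in> I"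
  shows "Ck_on n U (\<lambda>y. F (t, y))"
  using F
proof (induction n arbitrary: F)
  case 0
  then show ?case using t by (auto intro!: continuous_on_compose2[of "I \<times> U" F] continuous_intros)
next
  case (Suc n)
  show ?case
  proof (rule Ck_on_has_derivI[OF U])
    show "((\<lambda>y. F (t, y)) has_derivative (\<lambda>h. frechet_derivative F (at (t, y)) (0, h))) (at y)" if "y \<in> U" for y
      using that t by (intro slice_has_derivative(1) Ck_on_has_derivative[OF Suc.prems open_Times[OF I U]]) auto
    show "Ck_on n U (\<lambda>y. frechet_derivative F (at (t, y)) (0, b))" if "b \<in> Basis" for b
      using that by (intro Suc.IH[of "\<lambda>z. frechet_derivative F (at z) (0, b)"] Ck_on_deriv[OF Suc.prems])
        (auto simp: Basis_prod_def)
  qed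
qed

lemma smooth_on_deriv: "smooth_on S F \<Longrightarrow> b \<in> Basis \<Longrightarrow> smooth_on S (\<lambda>x. frechet_derivative F (at x) b)"
  unfolding smooth_on_def using Ck_on_deriv by blast

lemma smooth_on_has_derivative:
  "smooth_on S F \<Longrightarrow> open S \<Longrightarrow> x \<in> S \<Longrightarrow> (F has_derivative frechet_derivative F (at x)) (at x)"
  unfolding smooth_on_def using Ck_on_has_derivative by blast

lemma smooth_on_iterated_partial: "smooth_on S F \<Longrightarrow> set bs \<subseteq> Basis \<Longrightarrow> smooth_on S (iterated_partial bs F)"
  by (induction bs) (auto intro: smooth_on_deriv)

lemma iterated_partial_cong:
  assumes S: "open S" and eq: "\<And>x. x \<in> S \<Longrightarrow> F x = G x" and x: "x \<in> S"
  shows "iterated_partial bs F x = iterated_partial bs G x"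
  using x
proof (induction bs arbitrary: x)
  case (Cons b bs)
  then show ?case using frechet_derivative_cong_open[OF S Cons.prems, of "iterated_partial bs F" "iterated_partial bs G"] by simp
qed (simp add: eq)

lemma iterated_partial_diff_quotient:
  assumes S: "open S" and F: "smooth_on S F" and G: "smooth_on S G" and bs: "set bs \<subseteq> Basis" and x: "x \<in> S"
  shows "iterated_partial bs (\<lambda>y. (F y - G y) /\<^sub>R s) x = (iterated_partial bs F x - iterated_partial bs G x) /\<^sub>R s"
  using bs x
proof (induction bs arbitrary: x)
  case (Cons b bs)
  let ?F = "iterated_partial bs F" and ?G = "iterated_partial bs G"
  have "(?F has_derivative frechet_derivative ?F (at x)) (at x)" "(?G has_derivative frechet_derivative ?G (at x)) (at x)"
    using Cons.prems F G S by (auto intro!: smooth_on_has_derivative smooth_on_iterated_partial)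
  then have "((\<lambda>y. (?F y - ?G y) /\<^sub>R s) has_derivative
      (\<lambda>h. (frechet_derivative ?F (at x) h - frechet_derivative ?G (at x) h) /\<^sub>R s)) (at x)"
    by (intro has_derivative_scaleR_right has_derivative_diff)
  moreover have "frechet_derivative (iterated_partial bs (\<lambda>y. (F y - G y) /\<^sub>R s)) (at x)
      = frechet_derivative (\<lambda>y. (?F y - ?G y) /\<^sub>R s) (at x)"
    using Cons by (intro frechet_derivative_cong_open[OF S]) auto
  ultimately show ?case by (simp flip: frechet_derivative_at)
qed simp

lemma iterated_partial_slice:
  fixes F :: "real \<times> 'a::euclidean_space \<Rightarrow> 'b::real_normed_vector"
  assumes I: "open I" and U: "open U" and F: "smooth_on (I \<times> U) F" and bs: "set bs \<subseteq> Basis" and t: "t \<in> I" and y: "y \<in> U"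
  shows "iterated_partial bs (\<lambda>y. F (t, y)) y = iterated_partial (map (Pair 0) bs) F (t, y)"
  using bs y
proof (induction bs arbitrary: y)
  case (Cons b bs)
  let ?F = "iterated_partial (map (Pair 0) bs) F"
  have B: "set (map (Pair (0::real)) bs) \<subseteq> Basis" using Cons.prems by (auto simp: Basis_prod_def)
  have "(?F has_derivative frechet_derivative ?F (at (t, y))) (at (t, y))"
    using Cons.prems t by (intro smooth_on_has_derivative[OF smooth_on_iterated_partial[OF F B] open_Times[OF I U]]) auto
  from slice_has_derivative(1)[OF this]
  have "frechet_derivative (\<lambda>y. ?F (t, y)) (at y) = (\<lambda>h. frechet_derivative ?F (at (t, y)) (0, h))"
    by (rule frechet_derivative_at[symmetric])
  moreover have "frechet_derivative (iterated_partial bs (\<lambda>y. F (t, y))) (at y) = frechet_derivative (\<lambda>y. ?F (t, y)) (at y)"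
    using Cons by (intro frechet_derivative_cong_open[OF U]) auto
  ultimately show ?case by simp
qed simp

text \<open>The second difference of \<open>F\<close> is evaluated by the mean value theorem in both orders.\<close>

lemma mixed_partials_point:
  fixes F :: "'a::euclidean_space \<Rightarrow> real"
  assumes S: "open S" and F: "Ck_on 2 S F" and b: "b \<in> Basis" "b' \<in> Basis" and h: "0 < h" and r: "ball x r \<subseteq> S" "2 * h < r"
  obtains p where "dist p x \<le> 2 * h"
    "F (x + h *\<^sub>R b + h *\<^sub>R b') - F (x + h *\<^sub>R b) - F (x + h *\<^sub>R b') + F x
      = h * h * frechet_derivative (\<lambda>z. frechet_derivative F (at z) b) (at p) b'"
proof -
  let ?D = "\<lambda>z. frechet_derivative F (at z) b"
  have C1: "Ck_on (Suc 1) S F" using F by (simp add: numeral_2_eq_2)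
  have D: "Ck_on (Suc 0) S ?D" using Ck_on_deriv[OF C1 b(1)] by simp
  have in_S: "x + s *\<^sub>R b + s' *\<^sub>R b' \<in> S" and near: "dist (x + s *\<^sub>R b + s' *\<^sub>R b') x \<le> 2 * h"
    if "0 \<le> s" "s \<le> h" "0 \<le> s'" "s' \<le> h" for s s'
  proof -
    have "norm (s *\<^sub>R b + s' *\<^sub>R b') \<le> norm (s *\<^sub>R b) + norm (s' *\<^sub>R b')" by (rule norm_triangle_ineq)
    also have "\<dots> \<le> 2 * h" using that b by simp
    finally show n: "dist (x + s *\<^sub>R b + s' *\<^sub>R b') x \<le> 2 * h" by (simp add: dist_norm add.assoc)
    then show "x + s *\<^sub>R b + s' *\<^sub>R b' \<in> S" using r by (auto simp: dist_commute)
  qed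
  have line: "((\<lambda>s. G (p + s *\<^sub>R e)) has_real_derivative frechet_derivative G (at (p + s *\<^sub>R e)) e) (at s)"
    if "Ck_on (Suc n) S G" "p + s *\<^sub>R e \<in> S" for G :: "'a \<Rightarrow> real" and p e s n
  proof -
    have d: "(G has_derivative frechet_derivative G (at (p + s *\<^sub>R e))) (at (p + s *\<^sub>R e))"
      by (rule Ck_on_has_derivative[OF that(1) S that(2)])
    have "((\<lambda>s. p + s *\<^sub>R e) has_derivative (\<lambda>k. k *\<^sub>R e)) (at s)" by (auto intro!: derivative_eq_intros)
    from diff_chain_at[OF this d]
    have "((\<lambda>s. G (p + s *\<^sub>R e)) has_derivative (\<lambda>k. frechet_derivative G (at (p + s *\<^sub>R e)) (k *\<^sub>R e))) (at s)"
      by (simp add: comp_def)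
    moreover have "frechet_derivative G (at (p + s *\<^sub>R e)) (k *\<^sub>R e) = frechet_derivative G (at (p + s *\<^sub>R e)) e * k" for k
      using linear_scale[OF has_derivative_linear[OF d]] by simp
    ultimately show ?thesis by (simp add: has_field_derivative_def)
  qed
  let ?f = "\<lambda>s. F (x + h *\<^sub>R b' + s *\<^sub>R b) - F (x + s *\<^sub>R b)"
  have df: "(?f has_real_derivative (?D (x + h *\<^sub>R b' + s *\<^sub>R b) - ?D (x + s *\<^sub>R b))) (at s)" if "0 \<le> s" "s \<le> h" for s
    using in_S[OF that, of h] in_S[OF that, of 0] h by (intro DERIV_diff line[OF C1]) (auto simp: algebra_simps)
  obtain \<xi> where \<xi>: "0 < \<xi>" "\<xi> < h" "?f h - ?f 0 = (h - 0) * (?D (x + h *\<^sub>R b' + \<xi> *\<^sub>R b) - ?D (x + \<xi> *\<^sub>R b))"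
    using MVT2[OF h df] by blast
  let ?g = "\<lambda>s. ?D (x + \<xi> *\<^sub>R b + s *\<^sub>R b')"
  have dg: "(?g has_real_derivative frechet_derivative ?D (at (x + \<xi> *\<^sub>R b + s *\<^sub>R b')) b') (at s)" if "0 \<le> s" "s \<le> h" for s
    using in_S[of \<xi> s] \<xi> that by (intro line[OF D]) auto
  obtain \<zeta> where \<zeta>: "0 < \<zeta>" "\<zeta> < h" "?g h - ?g 0 = (h - 0) * frechet_derivative ?D (at (x + \<xi> *\<^sub>R b + \<zeta> *\<^sub>R b')) b'"
    using MVT2[OF h dg] by blast
  show thesis
  proof (rule that)
    show "dist (x + \<xi> *\<^sub>R b + \<zeta> *\<^sub>R b') x \<le> 2 * h" using \<xi> \<zeta> by (intro near) auto
    show "F (x + h *\<^sub>R b + h *\<^sub>R b') - F (x + h *\<^sub>R b) - F (x + h *\<^sub>R b') + F x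
      = h * h * frechet_derivative ?D (at (x + \<xi> *\<^sub>R b + \<zeta> *\<^sub>R b')) b'"
      using \<xi>(3) \<zeta>(3) by (simp add: algebra_simps)
  qed
qed

text \<open>One and the same second difference equals \<open>h * h\<close> times either mixed
  derivative, taken at points within \<open>2 * h\<close> of \<open>x\<close>. Continuity of both
  derivatives makes them agree in the limit.\<close>

lemma mixed_partials_real:
  fixes F :: "'a::euclidean_space \<Rightarrow> real"
  assumes S: "open S" and F: "Ck_on 2 S F" and b: "b \<in> Basis" "b' \<in> Basis" and x: "x \<in> S"
  shows "frechet_derivative (\<lambda>z. frechet_derivative F (at z) b) (at x) b'
    = frechet_derivative (\<lambda>z. frechet_derivative F (at z) b') (at x) b"
proof -
  let ?A = "\<lambda>z. frechet_derivative (\<lambda>z. frechet_derivative F (at z) b) (at z) b'"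
  let ?B = "\<lambda>z. frechet_derivative (\<lambda>z. frechet_derivative F (at z) b') (at z) b"
  have C1: "Ck_on (Suc (Suc 0)) S F" using F by (simp add: numeral_2_eq_2)
  have "continuous_on S ?A" "continuous_on S ?B"
    using Ck_on_deriv[OF Ck_on_deriv[OF C1 b(1)] b(2)] Ck_on_deriv[OF Ck_on_deriv[OF C1 b(2)] b(1)] by simp_all
  then have cont: "isCont ?A x" "isCont ?B x" using S x by (auto simp: continuous_on_eq_continuous_at)
  obtain r where r: "r > 0" "ball x r \<subseteq> S" using S x open_contains_ball by blast
  have "\<bar>?A x - ?B x\<bar> \<le> e" if e: "0 < e" for e
  proof -
    obtain d1 where d1: "d1 > 0" "\<And>z. dist z x < d1 \<Longrightarrow> dist (?A z) (?A x) < e / 2"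
      using cont(1) e unfolding continuous_at_eps_delta by (metis half_gt_zero)
    obtain d2 where d2: "d2 > 0" "\<And>z. dist z x < d2 \<Longrightarrow> dist (?B z) (?B x) < e / 2"
      using cont(2) e unfolding continuous_at_eps_delta by (metis half_gt_zero)
    define h where "h = min (min d1 d2) r / 4"
    have h: "0 < h" "2 * h < r" "2 * h < d1" "2 * h < d2" using d1 d2 r by (auto simp: h_def)
    obtain p where p: "dist p x \<le> 2 * h"
      "F (x + h *\<^sub>R b + h *\<^sub>R b') - F (x + h *\<^sub>R b) - F (x + h *\<^sub>R b') + F x = h * h * ?A p"
      using mixed_partials_point[OF S F b h(1) r(2) h(2)] by blast
    obtain q where q: "dist q x \<le> 2 * h"
      "F (x + h *\<^sub>R b' + h *\<^sub>R b) - F (x + h *\<^sub>R b') - F (x + h *\<^sub>R b) + F x = h * h * ?B q"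
      using mixed_partials_point[OF S F b(2,1) h(1) r(2) h(2)] by blast
    have "h * h * ?A p = h * h * ?B q" using p(2) q(2) by (simp add: algebra_simps)
    then have "?A p = ?B q" using h by simp
    moreover have "dist (?A p) (?A x) < e / 2" "dist (?B q) (?B x) < e / 2" using p q h d1 d2 by auto
    ultimately show ?thesis unfolding dist_real_def by linarith
  qed
  then show ?thesis by (metis abs_ge_zero abs_le_zero_iff field_le_epsilon add_0 right_minus_eq)
qed

lemma mixed_partials:
  fixes F :: "'a::euclidean_space \<Rightarrow> 'b::euclidean_space"
  assumes S: "open S" and F: "Ck_on 2 S F" and b: "b \<in> Basis" "b' \<in> Basis" and x: "x \<in> S"
  shows "frechet_derivative (\<lambda>z. frechet_derivative F (at z) b) (at x) b'
    = frechet_derivative (\<lambda>z. frechet_derivative F (at z) b') (at x) b"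
proof (rule euclidean_eqI)
  fix e :: 'b assume "e \<in> Basis"
  let ?F = "\<lambda>z. F z \<bullet> e"
  have C1: "Ck_on (Suc 1) S F" using F by (simp add: numeral_2_eq_2)
  have Fe: "Ck_on 2 S ?F" by (rule Ck_on_linear_comp[OF S bounded_linear_inner_left F])
  have comp: "frechet_derivative (\<lambda>z. G z \<bullet> e) (at z) = (\<lambda>h. frechet_derivative G (at z) h \<bullet> e)"
    if "Ck_on (Suc n) S G" "z \<in> S" for G :: "'a \<Rightarrow> 'b" and z n
    by (rule frechet_derivative_at[symmetric])
      (rule bounded_linear.has_derivative[OF bounded_linear_inner_left Ck_on_has_derivative[OF that(1) S that(2)]])
  have two: "frechet_derivative (\<lambda>z. frechet_derivative ?F (at z) a) (at x) a'
      = frechet_derivative (\<lambda>z. frechet_derivative F (at z) a) (at x) a' \<bullet> e" if "a \<in> Basis" for a a'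
  proof -
    have "frechet_derivative (\<lambda>z. frechet_derivative ?F (at z) a) (at x)
        = frechet_derivative (\<lambda>z. frechet_derivative F (at z) a \<bullet> e) (at x)"
      by (rule frechet_derivative_cong_open[OF S x]) (simp add: comp[OF C1])
    moreover have "Ck_on (Suc 0) S (\<lambda>z. frechet_derivative F (at z) a)" using Ck_on_deriv[OF C1 that] by simp
    ultimately show ?thesis using comp[OF _ x] by metis
  qed
  show "frechet_derivative (\<lambda>z. frechet_derivative F (at z) b) (at x) b' \<bullet> e
    = frechet_derivative (\<lambda>z. frechet_derivative F (at z) b') (at x) b \<bullet> e"
    using mixed_partials_real[OF S Fe b x] by (simp add: two b)
qed

text \<open>Applied with \<open>b\<close> the time direction, this moves a time derivative past all
  spatial partials, as the Frechet topology demands.\<close>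

lemma iterated_partial_commute:
  fixes F :: "'a::euclidean_space \<Rightarrow> 'b::euclidean_space"
  assumes S: "open S" and F: "smooth_on S F" and bs: "set bs \<subseteq> Basis" and b: "b \<in> Basis" and x: "x \<in> S"
  shows "iterated_partial bs (\<lambda>z. frechet_derivative F (at z) b) x = frechet_derivative (iterated_partial bs F) (at x) b"
  using bs x
proof (induction bs arbitrary: x)
  case (Cons a bs)
  have "frechet_derivative (iterated_partial bs (\<lambda>z. frechet_derivative F (at z) b)) (at x)
      = frechet_derivative (\<lambda>z. frechet_derivative (iterated_partial bs F) (at z) b) (at x)"
    using Cons by (intro frechet_derivative_cong_open[OF S]) auto
  moreover have "Ck_on 2 S (iterated_partial bs F)"
    using smooth_on_iterated_partial[OF F] Cons.prems by (simp add: smooth_on_def)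
  ultimately show ?case
    using mixed_partials[OF S _ b, of "iterated_partial bs F" a x] Cons.prems by simp
qed simp

text \<open>The time derivative is uniformly continuous on a compact time interval around
  \<open>t\<close> times \<open>K\<close>. The mean value inequality turns its oscillation there
  into a bound for the difference quotient that is uniform in \<open>y\<close>.\<close>

lemma uniform_difference_quotient:
  fixes \<Psi> :: "real \<times> 'a::euclidean_space \<Rightarrow> 'b::euclidean_space"
  assumes I: "open I" and U: "open U" and F: "smooth_on (I \<times> U) \<Psi>" and t: "t \<in> I" and K: "compact K" "K \<subseteq> U"
  shows "uniform_limit K (\<lambda>s y. (\<Psi> (t + s, y) - \<Psi> (t, y)) /\<^sub>R s) (\<lambda>y. frechet_derivative \<Psi> (at (t, y)) (1, 0)) (at 0)"
proof (rule uniform_limitI)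
  fix e :: real assume e: "0 < e"
  let ?D = "\<lambda>z. frechet_derivative \<Psi> (at z) (1, 0)"
  obtain r where r: "r > 0" "cball t r \<subseteq> I" using I t open_contains_cball by blast
  have "smooth_on (I \<times> U) ?D" using F by (rule smooth_on_deriv) (auto simp: Basis_prod_def)
  then have "continuous_on (cball t r \<times> K) ?D"
    by (rule continuous_on_subset[OF smooth_on_imp_continuous_on]) (use r K in auto)
  then have "uniformly_continuous_on (cball t r \<times> K) ?D"
    by (intro compact_uniformly_continuous compact_Times K compact_cball)
  then obtain d where d: "d > 0"
    "\<And>z z'. z \<in> cball t r \<times> K \<Longrightarrow> z' \<in> cball t r \<times> K \<Longrightarrow> dist z' z < d \<Longrightarrow> dist (?D z') (?D z) < e / 2"
    using e unfolding uniformly_continuous_on_def by (metis half_gt_zero)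
  have "\<forall>\<^sub>F s in at (0::real). \<bar>s\<bar> < min d r"
    using d r by (auto simp: eventually_at dist_real_def intro!: exI[of _ "min d r"])
  then show "\<forall>\<^sub>F s in at 0. \<forall>y\<in>K. dist ((\<Psi> (t + s, y) - \<Psi> (t, y)) /\<^sub>R s) (?D (t, y)) < e"
    using eventually_neq_at_within[of 0]
  proof eventually_elim
    case (elim s)
    show ?case
    proof
      fix y assume y: "y \<in> K"
      let ?S = "ball t (min d r)"
      have "norm (\<Psi> (t + s, y) - \<Psi> (t, y) - ((t + s) - t) *\<^sub>R ?D (t, y)) \<le> norm ((t + s) - t) * (e / 2)"
      proof (rule vector_differentiable_bound_linearization[where S = ?S and f' = "\<lambda>\<tau>. ?D (\<tau>, y)" and f = "\<lambda>\<tau>. \<Psi> (\<tau>, y)"])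
        fix \<tau> assume \<tau>: "\<tau> \<in> ?S"
        then have \<tau>': "(\<tau>, y) \<in> I \<times> U" "(\<tau>, y) \<in> cball t r \<times> K" using r K y by auto
        have d1: "(\<Psi> has_derivative frechet_derivative \<Psi> (at (\<tau>, y))) (at (\<tau>, y))"
          by (rule smooth_on_has_derivative[OF F open_Times[OF I U] \<tau>'(1)])
        have "(\<lambda>k. frechet_derivative \<Psi> (at (\<tau>, y)) (k, 0)) = (\<lambda>k. k *\<^sub>R ?D (\<tau>, y))"
        proof
          fix k :: real
          show "frechet_derivative \<Psi> (at (\<tau>, y)) (k, 0) = k *\<^sub>R ?D (\<tau>, y)"
            using linear_scale[OF has_derivative_linear[OF d1], of k "(1, 0)"] by simp
        qed
        then have "((\<lambda>\<tau>. \<Psi> (\<tau>, y)) has_vector_derivative ?D (\<tau>, y)) (at \<tau>)"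
          using slice_has_derivative(2)[OF d1] unfolding has_vector_derivative_def by metis
        then show "((\<lambda>\<tau>. \<Psi> (\<tau>, y)) has_vector_derivative ?D (\<tau>, y)) (at \<tau> within ?S)"
          by (rule has_vector_derivative_at_within)
        have "dist (?D (\<tau>, y)) (?D (t, y)) < e / 2"
          using \<tau> \<tau>' y r by (intro d(2)) (auto simp: dist_prod_def dist_commute)
        then show "norm (?D (\<tau>, y) - ?D (t, y)) \<le> e / 2" by (simp add: dist_norm)
      next
        show "closed_segment t (t + s) \<subseteq> ?S"
          using elim d r by (intro closed_segment_subset convex_ball) (auto simp: dist_real_def)
        show "t \<in> ?S" using d r by simp
      qed
      then have "norm (\<Psi> (t + s, y) - \<Psi> (t, y) - s *\<^sub>R ?D (t, y)) / \<bar>s\<bar> \<le> e / 2"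
        using elim(2) by (simp add: divide_le_eq mult.commute)
      moreover have "(\<Psi> (t + s, y) - \<Psi> (t, y)) /\<^sub>R s - ?D (t, y) = (\<Psi> (t + s, y) - \<Psi> (t, y) - s *\<^sub>R ?D (t, y)) /\<^sub>R s"
        using elim(2) by (simp add: scaleR_diff_right)
      moreover have "norm (X /\<^sub>R s) = norm X / \<bar>s\<bar>" for X :: 'b by (simp add: divide_inverse)
      ultimately have "norm ((\<Psi> (t + s, y) - \<Psi> (t, y)) /\<^sub>R s - ?D (t, y)) \<le> e / 2"
        by (simp only:)
      then show "dist ((\<Psi> (t + s, y) - \<Psi> (t, y)) /\<^sub>R s) (?D (t, y)) < e" using e by (simp add: dist_norm)
    qed
  qed
qed

text \<open>The spatial partials of the quotient are difference quotients of the jointly smooth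
  function \<open>?\<Psi>\<close>, so \<open>uniform_difference_quotient\<close> applies to each
  list \<open>bs\<close>; commuting derivatives identifies the limit.\<close>

lemma uniform_partials_of_quotient:
  fixes F :: "real \<times> 'a::euclidean_space \<Rightarrow> 'b::euclidean_space"
  assumes I: "open I" and U: "open U" and F: "smooth_on (I \<times> U) F" and t: "t \<in> I"
    and K: "compact K" "K \<subseteq> U" and bs: "set bs \<subseteq> Basis"
  shows "uniform_limit K (\<lambda>s. iterated_partial bs (\<lambda>y. (F (t + s, y) - F (t, y)) /\<^sub>R s))
    (iterated_partial bs (\<lambda>y. frechet_derivative F (at (t, y)) (1, 0))) (at 0)"
proof -
  let ?bs = "map (Pair (0::real)) bs" and ?one = "(1, 0) :: real \<times> 'a"
  let ?\<Psi> = "iterated_partial ?bs F"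
  have B: "set ?bs \<subseteq> Basis" "?one \<in> Basis" using bs by (auto simp: Basis_prod_def)
  have \<Psi>: "smooth_on (I \<times> U) ?\<Psi>" by (rule smooth_on_iterated_partial[OF F B(1)])
  have slice: "smooth_on U (\<lambda>y. F (\<tau>, y))" if "\<tau> \<in> I" for \<tau>
    using F Ck_on_slice[OF I U _ that] by (auto simp: smooth_on_def)
  have dF: "smooth_on (I \<times> U) (\<lambda>z. frechet_derivative F (at z) ?one)" by (rule smooth_on_deriv[OF F B(2)])
  have lim: "iterated_partial bs (\<lambda>y. frechet_derivative F (at (t, y)) ?one) y = frechet_derivative ?\<Psi> (at (t, y)) ?one"
    if "y \<in> K" for y
    using iterated_partial_slice[OF I U dF bs t, of y] iterated_partial_commute[OF open_Times[OF I U] F B, of "(t, y)"] that t K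
    by auto
  have "\<forall>\<^sub>F s in at 0. s \<in> (\<lambda>s. t + s) -` I"
    using t I by (intro eventually_at_in_open' open_vimage continuous_intros) auto
  then have "\<forall>\<^sub>F s in at 0. \<forall>y\<in>K. iterated_partial bs (\<lambda>y. (F (t + s, y) - F (t, y)) /\<^sub>R s) y
      = (?\<Psi> (t + s, y) - ?\<Psi> (t, y)) /\<^sub>R s"
  proof eventually_elim
    case (elim s)
    then have ts: "t + s \<in> I" by simp
    show ?case
    proof
      fix y assume "y \<in> K"
      then have y: "y \<in> U" using K by auto
      show "iterated_partial bs (\<lambda>y. (F (t + s, y) - F (t, y)) /\<^sub>R s) y = (?\<Psi> (t + s, y) - ?\<Psi> (t, y)) /\<^sub>R s"
        unfolding iterated_partial_diff_quotient[OF U slice[OF ts] slice[OF t] bs y]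
          iterated_partial_slice[OF I U F bs ts y] iterated_partial_slice[OF I U F bs t y] ..
    qed
  qed
  from uniform_limit_cong[OF this lim] show ?thesis
    using uniform_difference_quotient[OF I U \<Psi> t K] by simp
qed

section \<open>Charts\<close>

lemma norm_matrix_sq: "(norm A)\<^sup>2 = (\<Sum>i\<in>UNIV. \<Sum>j\<in>UNIV. (A $ i $ j)\<^sup>2)" for A :: "real^'n^'m"
  unfolding power2_norm_eq_inner inner_vec_def by (simp add: power2_eq_square)

lemma norm_transpose_matrix: "norm (transpose A) = norm A" for A :: "real^'n^'m"
proof -
  have "(norm (transpose A))\<^sup>2 = (norm A)\<^sup>2"
    unfolding norm_matrix_sq transpose_def by (simp, rule sum.swap)
  then show ?thesis by simp
qed

lemma norm_matrix_mult_le: "norm (A ** B) \<le> norm A * norm B" for A :: "real^'n^'m" and B :: "real^'k^'n"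
proof -
  have row: "(A ** B) $ i = transpose B *v (A $ i)" for i
    by (simp add: vec_eq_iff matrix_matrix_mult_def matrix_vector_mult_def transpose_def ac_simps
        del: transpose_matrix_vector)
  have "norm (transpose B *v (A $ i)) \<le> norm (A $ i) * norm B" for i
    using norm_matrix_vector_mult_le[of "transpose B" "A $ i"] unfolding norm_transpose_matrix by (simp only: mult.commute)
  then have le: "norm ((A ** B) $ i) \<le> norm (A $ i) * norm B" for i unfolding row .
  have "norm (A ** B) = L2_set (\<lambda>i. norm ((A ** B) $ i)) UNIV" by (simp add: norm_vec_def)
  also have "\<dots> \<le> L2_set (\<lambda>i. norm (A $ i) * norm B) UNIV"
    by (intro L2_set_mono le) simp
  also have "\<dots> = norm A * norm B" by (simp add: norm_vec_def[of A] L2_set_left_distrib)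
  finally show ?thesis .
qed

lemma bounded_bilinear_matrix_mult:
  "bounded_bilinear ((**) :: real^'n^'m \<Rightarrow> real^'k^'n \<Rightarrow> real^'k^'m)"
proof
  show "\<exists>K. \<forall>(A :: real^'n^'m) (B :: real^'k^'n). norm (A ** B) \<le> norm A * norm B * K"
    by (rule exI[of _ 1]) (simp add: norm_matrix_mult_le)
qed (simp_all add: matrix_add_ldistrib matrix_add_rdistrib scalar_matrix_assoc matrix_scalar_ac)

lemma bounded_linear_transpose: "bounded_linear (transpose :: real^'n^'m \<Rightarrow> real^'m^'n)"
  by (rule bounded_linear_intro[of _ 1]) (simp_all add: transpose_def vec_eq_iff norm_transpose_matrix[unfolded transpose_def])

section \<open>Charts, transition maps and the change of coordinate frames\<close>

locale manifold =
  fixes \<A> :: "('m::{t2_space,second_countable_topology}, 'n::finite) chart set"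
  assumes atlas: "smooth_atlas \<A>"
begin

lemma chartD:
  assumes "c \<in> \<A>"
  shows "open (chart_dom c)" "open (chart_range c)"
    "continuous_on (chart_dom c) (chart_map c)" "continuous_on (chart_range c) (chart_inv c)"
    "\<And>x. x \<in> chart_dom c \<Longrightarrow> chart_map c x \<in> chart_range c"
    "\<And>x. x \<in> chart_dom c \<Longrightarrow> chart_inv c (chart_map c x) = x"
    "\<And>y. y \<in> chart_range c \<Longrightarrow> chart_inv c y \<in> chart_dom c"
    "\<And>y. y \<in> chart_range c \<Longrightarrow> chart_map c (chart_inv c y) = y"
proof -
  have "is_chart c" using atlas assms by (auto simp: smooth_atlas_def)
  then have *: "open (chart_dom c)" "open (chart_range c)"
    "homeomorphism (chart_dom c) (chart_range c) (chart_map c) (chart_inv c)"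
    by (auto simp: is_chart_def)
  show "open (chart_dom c)" "open (chart_range c)" using * by auto
  show "continuous_on (chart_dom c) (chart_map c)" "continuous_on (chart_range c) (chart_inv c)"
    "\<And>x. x \<in> chart_dom c \<Longrightarrow> chart_map c x \<in> chart_range c"
    "\<And>x. x \<in> chart_dom c \<Longrightarrow> chart_inv c (chart_map c x) = x"
    "\<And>y. y \<in> chart_range c \<Longrightarrow> chart_inv c y \<in> chart_dom c"
    "\<And>y. y \<in> chart_range c \<Longrightarrow> chart_map c (chart_inv c y) = y"
    using *(3) unfolding homeomorphism_def by auto
qed

lemma chart_around: obtains c where "c \<in> \<A>" "x \<in> chart_dom c"
  using atlas unfolding smooth_atlas_def by blast

lemma pref_chart: "pref_chart \<A> x \<in> \<A>" "x \<in> chart_dom (pref_chart \<A> x)"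
proof -
  have "\<exists>c. c \<in> \<A> \<and> x \<in> chart_dom c" using chart_around by blast
  then show "pref_chart \<A> x \<in> \<A>" "x \<in> chart_dom (pref_chart \<A> x)"
    using someI_ex[of "\<lambda>c. c \<in> \<A> \<and> x \<in> chart_dom c"] unfolding pref_chart_def by auto
qed

lemma open_chart_image:
  assumes c: "c \<in> \<A>" and W: "open W"
  shows "open (chart_map c ` (chart_dom c \<inter> W))"
proof -
  have "chart_map c ` (chart_dom c \<inter> W) = chart_range c \<inter> chart_inv c -` W"
    using chartD(5-8)[OF c] by force
  then show ?thesis
    using continuous_open_preimage[OF chartD(4,2)[OF c] W] by simp
qed

lemma transition_derivative:
  assumes c: "c \<in> \<A>" "c' \<in> \<A>" and x: "x \<in> chart_dom c" "x \<in> chart_dom c'"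
  shows "((chart_map c' \<circ> chart_inv c) has_derivative
     (*v) (jacobian (chart_map c' \<circ> chart_inv c) (at (chart_map c x)))) (at (chart_map c x))"
proof -
  have "smooth_on (chart_map c ` (chart_dom c \<inter> chart_dom c')) (chart_map c' \<circ> chart_inv c)"
    using atlas c by (auto simp: smooth_atlas_def)
  then have "(chart_map c' \<circ> chart_inv c) differentiable (at (chart_map c x))"
    using open_chart_image[OF c(1) chartD(1)[OF c(2)]] x by (intro smooth_on_differentiable) auto
  then show ?thesis unfolding jacobian_works .
qed

text \<open>\<open>frame_matrix\<close> parametrised by the point instead of its coordinates: the
  change of basis from the coordinate frame of \<open>c\<close> to that of the preferred
  chart.\<close>

definition frame :: "('m, 'n) chart \<Rightarrow> 'm \<Rightarrow> real^'n^'n" where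
  "frame c x = frame_matrix \<A> c (chart_map c x)"

lemma frame_eq:
  assumes "c \<in> \<A>" "x \<in> chart_dom c"
  shows "frame c x = jacobian (chart_map (pref_chart \<A> x) \<circ> chart_inv c) (at (chart_map c x))"
  using assms by (simp add: frame_def frame_matrix_def chartD)

lemma frame_derivative:
  assumes "c \<in> \<A>" "x \<in> chart_dom c"
  shows "((chart_map (pref_chart \<A> x) \<circ> chart_inv c) has_derivative (*v) (frame c x)) (at (chart_map c x))"
  unfolding frame_eq[OF assms] by (intro transition_derivative assms pref_chart)

lemma local_tensor_chart:
  assumes "c \<in> \<A>" "x \<in> chart_dom c"
  shows "local_tensor \<A> c a (chart_map c x) = transpose (frame c x) ** a x ** frame c x"
  using assms by (simp add: local_tensor_def frame_def chartD)

text \<open>The transition in the opposite direction composes with this one to the identity near the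
  point, so the chain rule provides a left inverse.\<close>

lemma frame_invertible:
  assumes c: "c \<in> \<A>" and x: "x \<in> chart_dom c"
  shows "invertible (frame c x)"
proof -
  let ?p = "pref_chart \<A> x" and ?y = "chart_map c x"
  let ?J = "jacobian (chart_map c \<circ> chart_inv ?p) (at (chart_map ?p x))"
  have "((chart_map c \<circ> chart_inv ?p) has_derivative (*v) ?J) (at (chart_map ?p x))"
    by (intro transition_derivative c x pref_chart)
  then have "((chart_map c \<circ> chart_inv ?p) \<circ> (chart_map ?p \<circ> chart_inv c) has_derivative
      (*v) ?J \<circ> (*v) (frame c x)) (at ?y)"
    by (intro diff_chain_at frame_derivative c x) (simp add: chartD[OF c] x)
  then have "((\<lambda>y. y) has_derivative (*v) ?J \<circ> (*v) (frame c x)) (at ?y)"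
  proof (rule has_derivative_transform_within_open)
    show "open (chart_map c ` (chart_dom c \<inter> chart_dom ?p))"
      by (intro open_chart_image c chartD pref_chart)
    show "?y \<in> chart_map c ` (chart_dom c \<inter> chart_dom ?p)" using x pref_chart by auto
    show "((chart_map c \<circ> chart_inv ?p) \<circ> (chart_map ?p \<circ> chart_inv c)) y = y"
      if "y \<in> chart_map c ` (chart_dom c \<inter> chart_dom ?p)" for y
      using that c pref_chart by (auto simp: chartD)
  qed
  then have "(*v) ?J \<circ> (*v) (frame c x) = (\<lambda>h. h)"
    using has_derivative_unique has_derivative_ident by blast
  then have "\<forall>h. (?J ** frame c x) *v h = mat 1 *v h"
    by (simp add: fun_eq_iff matrix_vector_mul_assoc)
  then have "?J ** frame c x = mat 1" by (simp add: matrix_eq)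
  then show ?thesis using invertible_left_inverse by blast
qed

text \<open>With \<open>R\<close> the inverse of the frame matrix, a tensor in preferred coordinates
  is recovered from its expression in \<open>c\<close>.\<close>

lemma pull_inverse:
  assumes "c \<in> \<A>" "x \<in> chart_dom c"
  obtains R where "\<And>X. transpose R ** (transpose (frame c x) ** X ** frame c x) ** R = X"
proof -
  obtain R where R: "frame c x ** R = mat 1" using frame_invertible[OF assms] by (auto simp: invertible_def)
  then have "transpose R ** transpose (frame c x) = mat 1" by (metis matrix_transpose_mul transpose_mat)
  then have "transpose R ** (transpose (frame c x) ** X ** frame c x) ** R = X" for X
    by (metis R matrix_mul_assoc matrix_mul_lid matrix_mul_rid)
  then show thesis using that by blast
qed

end

lemma spd_congruence:
  fixes G P :: "real^'n^'n"
  assumes "invertible P"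
  shows "spd (transpose P ** G ** P) \<longleftrightarrow> spd G"
proof -
  have 1: "spd (transpose P ** G ** P)" if G: "spd G" and P: "invertible P" for G P :: "real^'n^'n"
    unfolding spd_def
  proof safe
    show "transpose (transpose P ** G ** P) = transpose P ** G ** P"
      using G by (simp add: spd_def matrix_transpose_mul matrix_mul_assoc)
    fix v :: "real^'n" assume v: "v \<noteq> 0"
    have "P *v v \<noteq> 0" using P v
      by (metis invertible_def matrix_vector_mul_assoc matrix_vector_mul_lid matrix_vector_mult_0_right)
    then have "0 < (P *v v) \<bullet> (G *v (P *v v))" using G by (simp add: spd_def)
    then show "0 < v \<bullet> ((transpose P ** G ** P) *v v)"
      by (simp add: matrix_vector_mul_assoc[symmetric] inner_transpose_matrix del: transpose_matrix_vector)
  qed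
  obtain R where R: "P ** R = mat 1" "R ** P = mat 1" using assms by (auto simp: invertible_def)
  have "transpose R ** transpose P = mat 1" by (metis R(1) matrix_transpose_mul transpose_mat)
  then have "transpose R ** (transpose P ** G ** P) ** R = G"
    by (metis R(1) matrix_mul_assoc matrix_mul_lid matrix_mul_rid)
  moreover have "invertible R" using R by (auto simp: invertible_def)
  ultimately show ?thesis using 1 assms by metis
qed

text \<open>Congruence keeps the eigenvalues of a pencil and transports its frames by
  \<open>P\<close>. Singular values, defined in preferred charts, can therefore be computed in any
  charts.\<close>

lemma eigen_frame_congruence:
  fixes G B P :: "real^'n^'n"
  assumes P: "invertible P" and f: "eigen_frame (transpose P ** G ** P) (transpose P ** B ** P) v l"
  shows "eigen_frame G B (\<lambda>i. P *v v i) l"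
proof -
  have inj: "x = y" if "transpose P *v x = transpose P *v y" for x y
  proof -
    have "invertible (transpose P)" using P by (rule transpose_invertible)
    then show ?thesis using that
      by (metis invertible_def matrix_vector_mul_assoc matrix_vector_mul_lid)
  qed
  have 1: "(transpose P ** X ** P) *v w = transpose P *v (X *v (P *v w))" for X and w :: "real^'n"
    by (simp add: matrix_vector_mul_assoc matrix_mul_assoc)
  show ?thesis
    unfolding eigen_frame_def
  proof (intro conjI allI)
    show "(P *v v i) \<bullet> (G *v (P *v v j)) = (if i = j then 1 else 0)" for i j
      using f by (simp add: eigen_frame_def 1 inner_transpose_matrix del: transpose_matrix_vector)
    show "B *v (P *v v i) = l i *\<^sub>R (G *v (P *v v i))" for i
    proof (rule inj)
      have "(transpose P ** B ** P) *v v i = l i *\<^sub>R ((transpose P ** G ** P) *v v i)"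
        using f by (simp add: eigen_frame_def)
      then show "transpose P *v (B *v (P *v v i)) = transpose P *v (l i *\<^sub>R (G *v (P *v v i)))"
        by (simp only: 1 matrix_vector_mult_scaleR)
    qed
  qed
qed

lemma top_variation_congruence:
  "top_variation m (\<lambda>i. P *v v i) l H E = top_variation m v l (transpose P ** H ** P) (transpose P ** E ** P)"
  unfolding top_variation_def
  by (simp add: matrix_vector_mul_assoc[symmetric] inner_transpose_matrix del: transpose_matrix_vector)

section \<open>The differential of the dynamics in pairs of charts\<close>

locale C1_dynamics = manifold \<A> for \<A> :: "('m::{t2_space,second_countable_topology}, 'n::finite) chart set" +
  fixes f :: "'m \<Rightarrow> 'm"
  assumes C1: "C1_map \<A> f"
begin

lemma f_cont: "continuous_on UNIV f" using C1 by (simp add: C1_map_def)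

lemma open_vimage_f: "open W \<Longrightarrow> open (f -` W)"
  by (rule open_vimage[OF _ f_cont])

definition jac :: "('m, 'n) chart \<Rightarrow> ('m, 'n) chart \<Rightarrow> 'm \<Rightarrow> real^'n^'n" where
  "jac c c' x = jacobian (chart_map c' \<circ> f \<circ> chart_inv c) (at (chart_map c x))"

lemma jac_derivative:
  assumes c: "c \<in> \<A>" "c' \<in> \<A>" and x: "x \<in> chart_dom c" "f x \<in> chart_dom c'"
  shows "((chart_map c' \<circ> f \<circ> chart_inv c) has_derivative (*v) (jac c c' x)) (at (chart_map c x))"
proof -
  let ?S = "chart_map c ` (chart_dom c \<inter> f -` chart_dom c')"
  have "Ck_on 1 ?S (chart_map c' \<circ> f \<circ> chart_inv c)" using C1 c unfolding C1_map_def by blast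
  moreover have "open ?S" by (intro open_chart_image open_vimage_f chartD c)
  ultimately have "(chart_map c' \<circ> f \<circ> chart_inv c) differentiable (at (chart_map c x))"
    using x by (intro Ck_on_differentiable[of 0]) auto
  then show ?thesis unfolding jacobian_works jac_def .
qed

lemma jac_continuous:
  assumes c: "c \<in> \<A>" "c' \<in> \<A>"
  shows "continuous_on (chart_dom c \<inter> f -` chart_dom c') (jac c c')"
proof -
  let ?D = "chart_dom c \<inter> f -` chart_dom c'"
  let ?F = "chart_map c' \<circ> f \<circ> chart_inv c"
  have "Ck_on 1 (chart_map c ` ?D) ?F" using C1 c unfolding C1_map_def by blast
  then have "continuous_on (chart_map c ` ?D) (\<lambda>y. frechet_derivative ?F (at y) (axis j 1))" for j
    by (auto simp: Basis_vec_def)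
  then have "continuous_on (chart_map c ` ?D) (\<lambda>y. frechet_derivative ?F (at y) (axis j 1) $ i)" for i j
    by (intro continuous_intros)
  then have "continuous_on (chart_map c ` ?D) (\<lambda>y. jacobian ?F (at y))"
    unfolding jacobian_def matrix_def by (intro continuous_on_vec_lambda)
  then have "continuous_on ?D ((\<lambda>y. jacobian ?F (at y)) \<circ> chart_map c)"
    by (intro continuous_on_compose continuous_on_subset[OF chartD(3)[OF c(1)]]) auto
  then show ?thesis by (simp add: jac_def comp_def)
qed

definition tangent_matrix :: "'m \<Rightarrow> real^'n^'n" where
  "tangent_matrix x = jac (pref_chart \<A> x) (pref_chart \<A> (f x)) x"

lemma tangent_map_eq: "tangent_map \<A> f x = (*v) (tangent_matrix x)"
  unfolding tangent_map_def tangent_matrix_def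
  using frechet_derivative_at[OF jac_derivative[OF pref_chart(1) pref_chart(1) pref_chart(2) pref_chart(2)]]
  by metis

text \<open>Both sides are the derivative of \<open>f\<close> read from \<open>c\<close> into the
  preferred chart at \<open>f x\<close>, factored once through the preferred chart at
  \<open>x\<close> and once through \<open>c'\<close>.\<close>

lemma tangent_matrix_frame:
  assumes c: "c \<in> \<A>" "c' \<in> \<A>" and x: "x \<in> chart_dom c" "f x \<in> chart_dom c'"
  shows "tangent_matrix x ** frame c x = frame c' (f x) ** jac c c' x"
proof -
  let ?p = "pref_chart \<A> x" and ?p' = "pref_chart \<A> (f x)" and ?y = "chart_map c x"
  let ?h = "chart_map ?p' \<circ> f \<circ> chart_inv c"
  let ?U = "chart_map c ` (chart_dom c \<inter> (chart_dom ?p \<inter> f -` (chart_dom c' \<inter> chart_dom ?p')))"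
  have U: "open ?U" using c by (intro open_chart_image open_vimage_f open_Int chartD pref_chart)
  have y: "?y \<in> ?U" using x pref_chart by auto
  have inv: "chart_inv c ?y = x" using c x by (simp add: chartD)
  have "((chart_map ?p' \<circ> f \<circ> chart_inv ?p) \<circ> (chart_map ?p \<circ> chart_inv c) has_derivative
      (*v) (tangent_matrix x) \<circ> (*v) (frame c x)) (at ?y)"
    unfolding tangent_matrix_def using frame_derivative[OF c(1) x(1)] jac_derivative[OF pref_chart(1) pref_chart(1) pref_chart(2) pref_chart(2), of x]
    by (intro diff_chain_at) (auto simp: inv)
  then have 1: "(?h has_derivative (*v) (tangent_matrix x) \<circ> (*v) (frame c x)) (at ?y)"
    by (rule has_derivative_transform_within_open[OF _ U y]) (use c pref_chart in \<open>auto simp: chartD\<close>)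
  have "((chart_map ?p' \<circ> chart_inv c') \<circ> (chart_map c' \<circ> f \<circ> chart_inv c) has_derivative
      (*v) (frame c' (f x)) \<circ> (*v) (jac c c' x)) (at ?y)"
    using frame_derivative[OF c(2) x(2)] jac_derivative[OF c x]
    by (intro diff_chain_at) (auto simp: inv)
  then have 2: "(?h has_derivative (*v) (frame c' (f x)) \<circ> (*v) (jac c c' x)) (at ?y)"
    by (rule has_derivative_transform_within_open[OF _ U y]) (use c pref_chart in \<open>auto simp: chartD\<close>)
  have "(*v) (tangent_matrix x) \<circ> (*v) (frame c x) = (*v) (frame c' (f x)) \<circ> (*v) (jac c c' x)"
    using has_derivative_unique[OF 1 2] .
  then show ?thesis by (simp add: matrix_eq matrix_vector_mul_assoc[symmetric] fun_eq_iff)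
qed

lemma pull_back_chart:
  assumes c: "c \<in> \<A>" "c' \<in> \<A>" and x: "x \<in> chart_dom c" "f x \<in> chart_dom c'"
  shows "transpose (frame c x) ** (transpose (tangent_matrix x) ** a (f x) ** tangent_matrix x) ** frame c x =
    transpose (jac c c' x) ** local_tensor \<A> c' a (chart_map c' (f x)) ** jac c c' x"
proof -
  have "transpose (frame c x) ** (transpose (tangent_matrix x) ** a (f x) ** tangent_matrix x) ** frame c x
      = transpose (tangent_matrix x ** frame c x) ** a (f x) ** (tangent_matrix x ** frame c x)"
    by (simp add: matrix_transpose_mul matrix_mul_assoc)
  then show ?thesis
    unfolding tangent_matrix_frame[OF c x] local_tensor_chart[OF c(2) x(2)]
    by (simp add: matrix_transpose_mul matrix_mul_assoc)
qed

end

section \<open>Differentiation of the integrand\<close>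

lemma top_variation_diff:
  "top_variation m v l (H - H') (E - E') = top_variation m v l H E - top_variation m v l H' E'"
  unfolding top_variation_def sum_subtractf[symmetric]
  by (intro sum.cong refl)
    (simp add: matrix_vector_mult_diff_rdistrib inner_diff_right diff_divide_distrib[symmetric], simp add: algebra_simps)

lemma top_variation_scaleR:
  "top_variation m v l (r *\<^sub>R H) (r *\<^sub>R E) = r * top_variation m v l H E"
  unfolding top_variation_def sum_distrib_left
  by (intro sum.cong refl) (simp add: scaleR_matrix_vector_assoc[symmetric] algebra_simps)

text \<open>On the selected indices division by \<open>l i\<close> costs at most
  \<open>1 / m\<close>, and there are at most \<open>CARD('n)\<close> of them.\<close>

lemma top_variation_le:
  fixes v :: "'n::finite \<Rightarrow> real^'n"
  assumes m: "0 < m" and v: "\<And>i. norm (v i) \<le> K" and l: "\<And>i. \<bar>l i\<bar> \<le> K"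
  shows "\<bar>top_variation m v l H E\<bar> \<le> CARD('n) * (K\<^sup>2 * (1 + K) / m) * (norm H + norm E)"
proof -
  have K: "0 \<le> K" using v norm_ge_zero order_trans by blast
  have q: "\<bar>v i \<bullet> (X *v v i)\<bar> \<le> K\<^sup>2 * norm X" for X :: "real^'n^'n" and i
  proof -
    have "\<bar>v i \<bullet> (X *v v i)\<bar> \<le> norm X * norm (v i) * norm (v i)" by (rule abs_inner_matrix_le)
    also have "\<dots> \<le> norm X * K * K" using v K by (intro mult_mono) auto
    finally show ?thesis by (simp add: power2_eq_square ac_simps)
  qed
  have "\<bar>(v i \<bullet> (E *v v i) - l i * (v i \<bullet> (H *v v i))) / l i\<bar> \<le> K\<^sup>2 * (1 + K) / m * (norm H + norm E)"
    if "m < l i" for i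
  proof -
    have "\<bar>v i \<bullet> (E *v v i) - l i * (v i \<bullet> (H *v v i))\<bar> \<le> \<bar>v i \<bullet> (E *v v i)\<bar> + \<bar>l i * (v i \<bullet> (H *v v i))\<bar>"
      by (rule abs_triangle_ineq4)
    also have "\<dots> \<le> K\<^sup>2 * norm E + K * (K\<^sup>2 * norm H)"
      unfolding abs_mult by (intro add_mono mult_mono q l) (auto simp: K)
    also have "\<dots> \<le> K\<^sup>2 * (1 + K) * (norm H + norm E)" using K by (simp add: algebra_simps)
    finally have "\<bar>v i \<bullet> (E *v v i) - l i * (v i \<bullet> (H *v v i))\<bar> / \<bar>l i\<bar> \<le> K\<^sup>2 * (1 + K) * (norm H + norm E) / m"
      using that m K by (intro frac_le) auto
    then show ?thesis by simp
  qed
  then have "\<bar>top_variation m v l H E\<bar> \<le> (\<Sum>i | m < l i. K\<^sup>2 * (1 + K) / m * (norm H + norm E))"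
    unfolding top_variation_def by (intro order_trans[OF sum_abs] sum_mono) auto
  also have "\<dots> = card {i. m < l i} * (K\<^sup>2 * (1 + K) / m * (norm H + norm E))" by simp
  also have "\<dots> \<le> CARD('n) * (K\<^sup>2 * (1 + K) / m * (norm H + norm E))"
    using K m by (intro mult_right_mono) (auto intro: card_mono)
  finally show ?thesis by (simp add: ac_simps)
qed

context manifold
begin

definition chart_rep :: "('m, 'n) chart \<Rightarrow> ('m, 'n) tensor_field \<Rightarrow> 'm \<Rightarrow> real^'n^'n" where
  "chart_rep c a x = local_tensor \<A> c a (chart_map c x)"

text \<open>The C^0 counterpart of \<open>sym_tensors\<close>; the integrand is differentiated
  entirely at this level of regularity.\<close>

definition cont_tensor :: "('m, 'n) tensor_field \<Rightarrow> bool" where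
  "cont_tensor a \<longleftrightarrow> (\<forall>x. transpose (a x) = a x) \<and>
     (\<forall>c\<in>\<A>. continuous_on (chart_range c) (local_tensor \<A> c a))"

lemma local_tensor_diff_quotient:
  "local_tensor \<A> c (\<lambda>x. (a x - b x) /\<^sub>R s) y = (local_tensor \<A> c a y - local_tensor \<A> c b y) /\<^sub>R s"
  unfolding local_tensor_def
  by (simp add: bounded_bilinear.diff_left[OF bounded_bilinear_matrix_mult]
      bounded_bilinear.diff_right[OF bounded_bilinear_matrix_mult]
      scalar_matrix_assoc[symmetric] matrix_scalar_ac scaleR_diff_right)

lemma chart_rep_congruence:
  assumes "c \<in> \<A>" "x \<in> chart_dom c"
  shows "chart_rep c a x = transpose (frame c x) ** a x ** frame c x"
  unfolding chart_rep_def by (rule local_tensor_chart[OF assms])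

lemma transpose_chart_rep:
  assumes "c \<in> \<A>" "x \<in> chart_dom c" "transpose (a x) = a x"
  shows "transpose (chart_rep c a x) = chart_rep c a x"
  unfolding chart_rep_congruence[OF assms(1,2)] using assms(3) by (simp add: matrix_transpose_mul matrix_mul_assoc)

lemma spd_chart_rep:
  assumes "c \<in> \<A>" "x \<in> chart_dom c"
  shows "spd (chart_rep c a x) \<longleftrightarrow> spd (a x)"
  unfolding chart_rep_congruence[OF assms] by (intro spd_congruence frame_invertible assms)

lemma chart_rep_continuous:
  assumes a: "cont_tensor a" and c: "c \<in> \<A>"
  shows "continuous_on (chart_dom c) (chart_rep c a)"
proof -
  have "continuous_on (chart_range c) (local_tensor \<A> c a)" using a c by (auto simp: cont_tensor_def)
  then show ?thesis
    unfolding chart_rep_def by (rule continuous_on_compose2[OF _ chartD(3)[OF c]]) (use chartD(5)[OF c] in blast)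
qed

text \<open>Differentiability at 0 in the Frechet topology, stripped of spatial derivatives. Affine
  lines of metrics belong to this class although they may leave the prescribed volume form; they
  serve to separate the right terms from the left ones.\<close>

definition C0_curve :: "(real \<Rightarrow> ('m, 'n) tensor_field) \<Rightarrow> ('m, 'n) tensor_field \<Rightarrow> bool" where
  "C0_curve \<gamma> h \<longleftrightarrow> (\<forall>\<^sub>F t in at 0. cont_tensor (\<gamma> t)) \<and>
     (\<forall>c\<in>\<A>. continuous_on (chart_range c) (local_tensor \<A> c h)) \<and>
     (\<forall>c\<in>\<A>. \<forall>K. compact K \<and> K \<subseteq> chart_range c \<longrightarrow>
        uniform_limit K (\<lambda>s. local_tensor \<A> c (\<lambda>x. (\<gamma> s x - \<gamma> 0 x) /\<^sub>R s)) (local_tensor \<A> c h) (at 0))"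

lemma C0_curve_quotient:
  assumes "C0_curve \<gamma> h" "c \<in> \<A>" "compact K" "K \<subseteq> chart_range c" "0 < \<eta>"
  shows "\<forall>\<^sub>F t in at 0. \<forall>x. chart_map c x \<in> K \<longrightarrow> norm ((chart_rep c (\<gamma> t) x - chart_rep c (\<gamma> 0) x) /\<^sub>R t - chart_rep c h x) \<le> \<eta>"
proof -
  have "uniform_limit K (\<lambda>s. local_tensor \<A> c (\<lambda>x. (\<gamma> s x - \<gamma> 0 x) /\<^sub>R s)) (local_tensor \<A> c h) (at 0)"
    using assms by (auto simp: C0_curve_def)
  from uniform_limitD[OF this \<open>0 < \<eta>\<close>] show ?thesis
    by eventually_elim (auto simp: chart_rep_def local_tensor_diff_quotient dist_norm intro: less_imp_le)
qed

end

context C1_dynamics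
begin

definition pull :: "('m, 'n) chart \<Rightarrow> ('m, 'n) chart \<Rightarrow> ('m, 'n) tensor_field \<Rightarrow> 'm \<Rightarrow> real^'n^'n" where
  "pull c c' a x = transpose (jac c c' x) ** chart_rep c' a (f x) ** jac c c' x"

lemma pull_congruence:
  assumes c: "c \<in> \<A>" "c' \<in> \<A>" and x: "x \<in> chart_dom c" "f x \<in> chart_dom c'"
  shows "pull c c' a x = transpose (frame c x) ** (transpose (tangent_matrix x) ** a (f x) ** tangent_matrix x) ** frame c x"
  unfolding pull_def chart_rep_def pull_back_chart[OF assms] ..

lemma transpose_pull:
  assumes c: "c \<in> \<A>" "c' \<in> \<A>" and x: "x \<in> chart_dom c" "f x \<in> chart_dom c'" and a: "transpose (a (f x)) = a (f x)"
  shows "transpose (pull c c' a x) = pull c c' a x"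
  unfolding pull_def using transpose_chart_rep[of c' "f x" a] assms by (simp add: matrix_transpose_mul matrix_mul_assoc)

lemma pull_continuous:
  assumes a: "cont_tensor a" and c: "c \<in> \<A>" "c' \<in> \<A>"
  shows "continuous_on (chart_dom c \<inter> f -` chart_dom c') (pull c c' a)"
proof -
  let ?D = "chart_dom c \<inter> f -` chart_dom c'"
  have 1: "continuous_on ?D (jac c c')" by (rule jac_continuous[OF c])
  have 2: "continuous_on ?D (\<lambda>x. chart_rep c' a (f x))"
    by (rule continuous_on_compose2[OF chart_rep_continuous[OF a c(2)] continuous_on_subset[OF f_cont]]) auto
  show ?thesis
    unfolding pull_def
    by (intro bounded_bilinear.continuous_on[OF bounded_bilinear_matrix_mult]
        bounded_linear.continuous_on[OF bounded_linear_transpose] 1 2)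
qed

text \<open>The metrics at \<open>x\<close> and at \<open>f x\<close> are independent arguments, so
  that either can be varied alone; the functional uses equal ones.\<close>

definition log_sv :: "nat \<Rightarrow> ('m, 'n) tensor_field \<Rightarrow> ('m, 'n) tensor_field \<Rightarrow> 'm \<Rightarrow> real" where
  "log_sv k a b x = ln (\<Prod>i=1..k. singular_value i (a x) (b (f x)) (tangent_map \<A> f x))"

lemma frame_global:
  assumes c: "c \<in> \<A>" "c' \<in> \<A>" and x: "x \<in> chart_dom c" "f x \<in> chart_dom c'"
    and f: "eigen_frame (chart_rep c a x) (pull c c' b x) v l"
  shows "eigen_frame (a x) (transpose (tangent_matrix x) ** b (f x) ** tangent_matrix x) (\<lambda>i. frame c x *v v i) l"
  using f unfolding chart_rep_congruence[OF c(1) x(1)] pull_congruence[OF c x]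
  by (rule eigen_frame_congruence[OF frame_invertible[OF c(1) x(1)]])

text \<open>The factor 1/2 of the final formula arises here: singular values are square roots of the
  eigenvalues whose logarithms \<open>top_ln\<close> adds up.\<close>

lemma log_sv_local:
  assumes c: "c \<in> \<A>" "c' \<in> \<A>" and x: "x \<in> chart_dom c" "f x \<in> chart_dom c'"
    and a: "spd (a x)" and b: "transpose (b (f x)) = b (f x)"
    and f: "eigen_frame (chart_rep c a x) (pull c c' b x) v l" and k: "card {i. m < l i} = k" and m: "0 < m"
  shows "log_sv k a b x = top_ln m l / 2"
proof -
  have "log_sv k a b x = ln (\<Prod>i | m < l i. sqrt (l i))"
    unfolding log_sv_def tangent_map_eq singular_values_above(1)[OF a b frame_global[OF c x f] k] ..
  also have "\<dots> = (\<Sum>i | m < l i. ln (sqrt (l i)))" using m by (subst ln_prod) auto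
  also have "\<dots> = (\<Sum>i | m < l i. ln (l i) / 2)" using m by (intro sum.cong) (auto simp: ln_sqrt)
  finally show ?thesis by (simp add: top_ln_def sum_divide_distrib)
qed

lemma local_frame_exists:
  assumes c: "c \<in> \<A>" "c' \<in> \<A>" and x: "x \<in> chart_dom c" "f x \<in> chart_dom c'"
    and a: "spd (a x)" and b: "transpose (b (f x)) = b (f x)"
  obtains v l where "eigen_frame (chart_rep c a x) (pull c c' b x) v l"
  using eigen_frame_exists[of "chart_rep c a x" "pull c c' b x"] spd_chart_rep[OF c(1) x(1)] a transpose_pull[where a = b, OF c x b] by blast

lemma level_exists:
  assumes c: "c \<in> \<A>" "c' \<in> \<A>" and x: "x \<in> chart_dom c" "f x \<in> chart_dom c'"
    and a: "spd (a x)" and b: "spd (b (f x))" and f: "eigen_frame (chart_rep c a x) (pull c c' b x) v l"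
    and k: "1 \<le> k" "k < CARD('n)"
    and gap: "singular_value (k + 1) (a x) (b (f x)) (tangent_map \<A> f x) < singular_value k (a x) (b (f x)) (tangent_map \<A> f x)"
  obtains m where "0 < m" "card {i. m < l i} = k" "\<And>i. l i \<noteq> m"
  using singular_value_gap_level[OF a b frame_global[OF c x f] k gap[unfolded tangent_map_eq]] by blast

text \<open>The expansion around the pencil at \<open>x0\<close> bounds the increment by a linear
  and a quadratic term in the displacement of the two matrices, and these are continuous in a fixed
  pair of charts.\<close>

lemma log_sv_isCont:
  assumes c: "c \<in> \<A>" "c' \<in> \<A>" and x0: "x0 \<in> chart_dom c" "f x0 \<in> chart_dom c'"
    and a: "cont_tensor a" "spd (a x0)" and b: "cont_tensor b"
    and f0: "eigen_frame (chart_rep c a x0) (pull c c' b x0) v0 l0"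
    and m: "card {i. m < l0 i} = k" "0 < m" "\<And>i. l0 i \<noteq> m"
  shows "isCont (log_sv k a b) x0"
proof -
  let ?D = "chart_dom c \<inter> f -` chart_dom c'"
  have D: "open ?D" "x0 \<in> ?D" using c x0 by (auto intro!: open_Int open_vimage_f chartD)
  have sa: "transpose (a x) = a x" and sb: "transpose (b x) = b x" for x using a b by (auto simp: cont_tensor_def)
  have G0: "spd (chart_rep c a x0)" using spd_chart_rep[OF c(1) x0(1)] a by simp
  have B0: "transpose (pull c c' b x0) = pull c c' b x0" by (rule transpose_pull[where a = b, OF c x0 sb])
  obtain \<epsilon> C K where e: "\<epsilon> > 0" "C \<ge> 0" "K \<ge> 0"
    and e1: "\<And>G. transpose G = G \<Longrightarrow> norm (G - chart_rep c a x0) < \<epsilon> \<Longrightarrow> spd G"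
    and e2: "\<And>G B v l i. transpose G = G \<Longrightarrow> transpose B = B \<Longrightarrow> norm (G - chart_rep c a x0) < \<epsilon> \<Longrightarrow> norm (B - pull c c' b x0) < \<epsilon>
       \<Longrightarrow> eigen_frame G B v l \<Longrightarrow>
       card {i. m < l i} = card {i. m < l0 i} \<and> norm (v i) \<le> K \<and> \<bar>l i\<bar> \<le> K \<and> l i \<noteq> m"
    and e3: "\<And>G B v l G' B' w \<mu>. transpose G = G \<Longrightarrow> transpose B = B \<Longrightarrow> norm (G - chart_rep c a x0) < \<epsilon> \<Longrightarrow> norm (B - pull c c' b x0) < \<epsilon>
       \<Longrightarrow> eigen_frame G B v l
       \<Longrightarrow> transpose G' = G' \<Longrightarrow> transpose B' = B' \<Longrightarrow> norm (G' - chart_rep c a x0) < \<epsilon> \<Longrightarrow> norm (B' - pull c c' b x0) < \<epsilon>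
       \<Longrightarrow> eigen_frame G' B' w \<mu>
       \<Longrightarrow> \<bar>top_ln m \<mu> - top_ln m l - top_variation m v l (G' - G) (B' - B)\<bar>
            \<le> C * (norm (G' - G) + norm (B' - B))\<^sup>2"
    using top_ln_local[OF G0 B0 f0 m(2,3)] by blast
  let ?d = "\<lambda>x. norm (chart_rep c a x - chart_rep c a x0) + norm (pull c c' b x - pull c c' b x0)"
  let ?V = "CARD('n) * (K\<^sup>2 * (1 + K) / m)"
  have "isCont (chart_rep c a) x0" "isCont (pull c c' b) x0"
    using chart_rep_continuous[OF a(1) c(1)] pull_continuous[OF b c] D x0 chartD(1)[OF c(1)]
    by (auto simp: continuous_on_eq_continuous_at)
  then have lim: "(chart_rep c a \<longlongrightarrow> chart_rep c a x0) (at x0)" "(pull c c' b \<longlongrightarrow> pull c c' b x0) (at x0)"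
    by (auto simp: isCont_def)
  have "((\<lambda>x. norm (chart_rep c a x - chart_rep c a x0)) \<longlongrightarrow> norm (chart_rep c a x0 - chart_rep c a x0)) (at x0)"
    "((\<lambda>x. norm (pull c c' b x - pull c c' b x0)) \<longlongrightarrow> norm (pull c c' b x0 - pull c c' b x0)) (at x0)"
    by (intro tendsto_intros lim)+
  then have lim0: "((\<lambda>x. norm (chart_rep c a x - chart_rep c a x0)) \<longlongrightarrow> 0) (at x0)"
    "((\<lambda>x. norm (pull c c' b x - pull c c' b x0)) \<longlongrightarrow> 0) (at x0)" by simp_all
  have "((\<lambda>x. (?V * ?d x + C * (?d x)\<^sup>2) / 2) \<longlongrightarrow> (?V * (0 + 0) + C * (0 + 0)\<^sup>2) / 2) (at x0)"
    by (intro tendsto_intros lim0) simp_all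
  then have lim1: "((\<lambda>x. (?V * ?d x + C * (?d x)\<^sup>2) / 2) \<longlongrightarrow> 0) (at x0)" by simp
  have "\<forall>\<^sub>F x in at x0. x \<in> ?D" using D by (rule eventually_at_in_open')
  moreover have "\<forall>\<^sub>F x in at x0. norm (chart_rep c a x - chart_rep c a x0) < \<epsilon>" "\<forall>\<^sub>F x in at x0. norm (pull c c' b x - pull c c' b x0) < \<epsilon>"
    using order_tendstoD(2)[OF lim0(1) e(1)] order_tendstoD(2)[OF lim0(2) e(1)] .
  ultimately have "\<forall>\<^sub>F x in at x0. norm (log_sv k a b x - log_sv k a b x0) \<le> (?V * ?d x + C * (?d x)\<^sup>2) / 2"
  proof eventually_elim
    case (elim x)
    then have x: "x \<in> chart_dom c" "f x \<in> chart_dom c'" by auto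
    have sG: "transpose (chart_rep c a x) = chart_rep c a x" and sB: "transpose (pull c c' b x) = pull c c' b x"
      by (auto intro: transpose_chart_rep transpose_pull c x sa sb)
    have ax: "spd (a x)" using e1[OF sG elim(2)] spd_chart_rep[OF c(1) x(1)] by simp
    obtain v l where vl: "eigen_frame (chart_rep c a x) (pull c c' b x) v l"
      by (rule local_frame_exists[where a = a and b = b, OF c x ax sb])
    have kx: "card {i. m < l i} = k" using e2[OF sG sB elim(2,3) vl] m by simp
    have sG0: "transpose (chart_rep c a x0) = chart_rep c a x0" by (rule transpose_chart_rep[OF c(1) x0(1) sa])
    have "\<bar>top_ln m l - top_ln m l0 - top_variation m v0 l0 (chart_rep c a x - chart_rep c a x0) (pull c c' b x - pull c c' b x0)\<bar>
        \<le> C * (?d x)\<^sup>2"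
      using e(1) by (intro e3[OF sG0 B0 _ _ f0 sG sB elim(2,3) vl]) auto
    moreover have "\<bar>top_variation m v0 l0 (chart_rep c a x - chart_rep c a x0) (pull c c' b x - pull c c' b x0)\<bar> \<le> ?V * ?d x"
      using e2[OF sG0 B0 _ _ f0] e(1) by (intro top_variation_le m) auto
    ultimately have *: "\<bar>top_ln m l - top_ln m l0\<bar> \<le> ?V * ?d x + C * (?d x)\<^sup>2" by linarith
    have half: "\<bar>p / 2 - q / 2\<bar> \<le> X / 2" if "\<bar>p - q\<bar> \<le> X" for p q X :: real
      using that by linarith
    show ?case
      unfolding log_sv_local[OF c x ax sb vl kx m(2)] log_sv_local[OF c x0 a(2) sb f0 m(1,2)] real_norm_def
      by (rule half[OF *])
  qed
  then have "((\<lambda>x. log_sv k a b x - log_sv k a b x0) \<longlongrightarrow> 0) (at x0)" by (rule Lim_null_comparison[OF _ lim1])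
  then show ?thesis unfolding isCont_def using LIM_zero_cancel by blast
qed

end

context C1_dynamics
begin

definition right_term :: "('m, 'n) tensor_field \<Rightarrow> nat \<Rightarrow> ('m, 'n) tensor_field \<Rightarrow> 'm \<Rightarrow> real" where
  "right_term g k h x = tensor_inner (g x) (tensor_of_map (g x) (Q_right \<A> f g k x)) (h x)"

definition left_term :: "('m, 'n) tensor_field \<Rightarrow> nat \<Rightarrow> ('m, 'n) tensor_field \<Rightarrow> 'm \<Rightarrow> real" where
  "left_term g k h x = tensor_inner (g x) (tensor_of_map (g x) (Q_left \<A> f g k x)) (h x)"

lemma Q_right_frame:
  assumes g: "\<And>x. spd (g x)"
    and fr: "eigen_frame (g x) (transpose (tangent_matrix x) ** g (f x) ** tangent_matrix x) v l" and k: "card {i. m < l i} = k" and m: "0 < m"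
  shows "Q_right \<A> f g k x = (\<lambda>y. \<Sum>i | m < l i. (v i \<bullet> (g x *v y)) *\<^sub>R v i)"
proof -
  have s: "transpose (g (f x)) = g (f x)" using g by (simp add: spd_def)
  show ?thesis
    unfolding Q_right_def tangent_map_eq right_singular_space_frame[OF g s fr k m]
    by (rule ext, rule orth_projection_frame[OF g]) (use fr in \<open>auto simp: eigen_frame_def\<close>)
qed

text \<open>At \<open>f x\<close> the left projection involves the differential at \<open>x\<close>,
  so the eigenframe that describes the right projection at \<open>x\<close> describes this one
  too.\<close>

lemma Q_left_frame:
  assumes g: "\<And>x. spd (g x)" and f: "inj f"
    and fr: "eigen_frame (g x) (transpose (tangent_matrix x) ** g (f x) ** tangent_matrix x) v l" and k: "card {i. m < l i} = k" and m: "0 < m"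
  shows "Q_left \<A> f g k (f x) = (\<lambda>y. \<Sum>i | m < l i.
    (((1 / sqrt (l i)) *\<^sub>R (tangent_matrix x *v v i)) \<bullet> (g (f x) *v y)) *\<^sub>R ((1 / sqrt (l i)) *\<^sub>R (tangent_matrix x *v v i)))"
proof -
  have s: "transpose (g (f x)) = g (f x)" using g by (simp add: spd_def)
  let ?u = "\<lambda>i. (1 / sqrt (l i)) *\<^sub>R (tangent_matrix x *v v i)"
  \<comment> \<open>The pull-back of the metric is diagonal in the frame with entries
    \<open>l j\<close>, so the images become orthonormal after division by the square roots.\<close>
  have on: "?u i \<bullet> (g (f x) *v ?u j) = (if i = j then 1 else 0)" if "m < l i" "m < l j" for i j
  proof -
    have "(tangent_matrix x *v v i) \<bullet> (g (f x) *v (tangent_matrix x *v v j)) = v i \<bullet> ((transpose (tangent_matrix x) ** g (f x) ** tangent_matrix x) *v v j)"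
      by (simp add: matrix_vector_mul_assoc[symmetric] inner_transpose_matrix del: transpose_matrix_vector)
    also have "\<dots> = (if i = j then l j else 0)" using fr by (simp add: eigen_frame_def)
    finally show ?thesis using that m by (auto simp: matrix_vector_mult_scaleR)
  qed
  show ?thesis
    unfolding Q_left_def inv_f_f[OF f] tangent_map_eq left_singular_space_frame[OF g s fr k m]
    by (rule ext, rule orth_projection_frame[OF g]) (use on in auto)
qed

text \<open>After division by \<open>l i\<close> the first-order term is \<open>h2\<close> on a unit
  left singular vector at \<open>f x\<close> minus \<open>h1\<close> on the matching right singular
  vector at \<open>x\<close>.\<close>

lemma variation_eq:
  assumes c: "c \<in> \<A>" "c' \<in> \<A>" and x: "x \<in> chart_dom c" "f x \<in> chart_dom c'"
    and g: "\<And>x. spd (g x)" and f: "inj f"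
    and fr: "eigen_frame (chart_rep c g x) (pull c c' g x) v l" and k: "card {i. m < l i} = k" and m: "0 < m"
  shows "left_term g k h2 (f x) - right_term g k h1 x = top_variation m v l (chart_rep c h1 x) (pull c c' h2 x)"
proof -
  let ?v = "\<lambda>i. frame c x *v v i"
  let ?u = "\<lambda>i. (1 / sqrt (l i)) *\<^sub>R (tangent_matrix x *v ?v i)"
  have fr': "eigen_frame (g x) (transpose (tangent_matrix x) ** g (f x) ** tangent_matrix x) ?v l" by (rule frame_global[OF c x fr])
  have R: "right_term g k h1 x = (\<Sum>i | m < l i. ?v i \<bullet> (h1 x *v ?v i))"
    unfolding right_term_def Q_right_frame[OF g fr' k m]
    by (rule tensor_inner_frame[OF g])
  have "left_term g k h2 (f x) = (\<Sum>i | m < l i. ?u i \<bullet> (h2 (f x) *v ?u i))"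
    unfolding left_term_def Q_left_frame[OF g f fr' k m]
    by (rule tensor_inner_frame[OF g])
  also have "\<dots> = (\<Sum>i | m < l i. (?v i \<bullet> ((transpose (tangent_matrix x) ** h2 (f x) ** tangent_matrix x) *v ?v i)) / l i)"
  proof (intro sum.cong refl)
    fix i assume "i \<in> {i. m < l i}"
    then have "l i > 0" using m by auto
    then show "?u i \<bullet> (h2 (f x) *v ?u i) = (?v i \<bullet> ((transpose (tangent_matrix x) ** h2 (f x) ** tangent_matrix x) *v ?v i)) / l i"
      by (simp add: matrix_vector_mult_scaleR matrix_vector_mul_assoc[symmetric] inner_transpose_matrix
          del: transpose_matrix_vector)
  qed
  finally have L: "left_term g k h2 (f x) = (\<Sum>i | m < l i. (?v i \<bullet> ((transpose (tangent_matrix x) ** h2 (f x) ** tangent_matrix x) *v ?v i)) / l i)" .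
  have "left_term g k h2 (f x) - right_term g k h1 x
      = top_variation m ?v l (h1 x) (transpose (tangent_matrix x) ** h2 (f x) ** tangent_matrix x)"
    unfolding L R top_variation_def sum_subtractf[symmetric] using m
    by (intro sum.cong refl) (auto simp: diff_divide_distrib)
  also have "\<dots> = top_variation m v l (chart_rep c h1 x) (pull c c' h2 x)"
    unfolding top_variation_congruence chart_rep_congruence[OF c(1) x(1)] pull_congruence[OF c x] ..
  finally show ?thesis .
qed

text \<open>At a single point the left projection comes from a frame at the preimage of
  \<open>x\<close> and the right one from a frame at \<open>x\<close>. These frames are unrelated,
  and the pairing with \<open>h\<close> is split by linearity.\<close>

lemma integrand_eq:
  assumes g: "\<And>x. spd (g x)" and f: "bij f"
    and gap: "\<And>x. singular_value (k + 1) (g x) (g (f x)) (tangent_map \<A> f x)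
      < singular_value k (g x) (g (f x)) (tangent_map \<A> f x)" and k: "1 \<le> k" "k < CARD('n)"
  shows "tensor_inner (g x) (tensor_of_map (g x) (\<lambda>v. Q_left \<A> f g k x v - Q_right \<A> f g k x v)) (h x)
    = left_term g k h x - right_term g k h x"
proof -
  have ex: "\<exists>v l m. eigen_frame (g x) (transpose (tangent_matrix x) ** g (f x) ** tangent_matrix x) v l \<and> 0 < m \<and> card {i. m < l i} = k" for x
  proof -
    have s: "transpose (g (f x)) = g (f x)" using g by (simp add: spd_def)
    obtain v l where vl: "eigen_frame (g x) (transpose (tangent_matrix x) ** g (f x) ** tangent_matrix x) v l"
      using eigen_frame_exists[OF g, of "transpose (tangent_matrix x) ** g (f x) ** tangent_matrix x"] s
      by (auto simp: matrix_transpose_mul matrix_mul_assoc)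
    show ?thesis using singular_value_gap_level[OF g g vl k gap[unfolded tangent_map_eq]] vl by blast
  qed
  obtain x' where x': "f x' = x" using f by (metis bij_pointE)
  obtain v l m where 1: "eigen_frame (g x) (transpose (tangent_matrix x) ** g (f x) ** tangent_matrix x) v l" "0 < m" "card {i. m < l i} = k"
    using ex by blast
  obtain v' l' m' where 2: "eigen_frame (g x') (transpose (tangent_matrix x') ** g (f x') ** tangent_matrix x') v' l'" "0 < m'" "card {i. m' < l' i} = k"
    using ex by blast
  note R = Q_right_frame[OF g 1(1,3,2)] and L = Q_left_frame[OF g bij_is_inj[OF f] 2(1,3,2), unfolded x']
  show ?thesis
    unfolding left_term_def right_term_def R L tensor_inner_frames[OF g] tensor_inner_frame[OF g] ..
qed

text \<open>\<open>U\<close> is chosen before \<open>t\<close> and \<open>\<eta>\<close>, and the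
  thresholds in \<open>t\<close> do not depend on the point of \<open>U\<close>. Statements of this
  form pass to a finite cover.\<close>

lemma local_uniform_derivative:
  assumes g: "cont_tensor g" "\<And>x. spd (g x)" and f: "inj f"
    and \<gamma>: "\<gamma>1 0 = g" "C0_curve \<gamma>1 h1" "\<gamma>2 0 = g" "C0_curve \<gamma>2 h2"
    and gap: "singular_value (k + 1) (g x0) (g (f x0)) (tangent_map \<A> f x0)
      < singular_value k (g x0) (g (f x0)) (tangent_map \<A> f x0)" and k: "1 \<le> k" "k < CARD('n)"
  obtains U where "open U" "x0 \<in> U" "\<And>x. x \<in> U \<Longrightarrow> isCont (log_sv k g g) x"
    "\<forall>\<^sub>F t in at 0. \<forall>x\<in>U. isCont (log_sv k (\<gamma>1 t) (\<gamma>2 t)) x"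
    "\<And>\<eta>. 0 < \<eta> \<Longrightarrow> \<forall>\<^sub>F t in at 0. \<forall>x\<in>U.
      \<bar>(log_sv k (\<gamma>1 t) (\<gamma>2 t) x - log_sv k g g x) / t - (left_term g k h2 (f x) - right_term g k h1 x) / 2\<bar> \<le> \<eta>"
proof -
  obtain c where c1: "c \<in> \<A>" "x0 \<in> chart_dom c" using chart_around by blast
  obtain c' where c2: "c' \<in> \<A>" "f x0 \<in> chart_dom c'" using chart_around by blast
  note c = c1(1) c2(1) and x0 = c1(2) c2(2)
  let ?D = "chart_dom c \<inter> f -` chart_dom c'"
  have D: "open ?D" "x0 \<in> ?D" using c x0 by (auto intro!: open_Int open_vimage_f chartD)
  have sg: "transpose (g x) = g x" for x using g by (simp add: cont_tensor_def)
  let ?G0 = "chart_rep c g x0" and ?B0 = "pull c c' g x0"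
  obtain v0 l0 where f0: "eigen_frame ?G0 ?B0 v0 l0" by (rule local_frame_exists[where a = g and b = g, OF c x0 g(2) sg])
  obtain m where m: "0 < m" "card {i. m < l0 i} = k" "\<And>i. l0 i \<noteq> m"
    using level_exists[OF c x0 g(2) g(2) f0 k gap] by blast
  have G0: "spd ?G0" using spd_chart_rep[OF c(1) x0(1)] g by simp
  have B0: "transpose ?B0 = ?B0" by (rule transpose_pull[where a = g, OF c x0 sg])
  obtain \<epsilon> C K where e: "\<epsilon> > 0" "C \<ge> 0" "K \<ge> 0"
    and e1: "\<And>G. transpose G = G \<Longrightarrow> norm (G - ?G0) < \<epsilon> \<Longrightarrow> spd G"
    and e2: "\<And>G B v l i. transpose G = G \<Longrightarrow> transpose B = B \<Longrightarrow> norm (G - ?G0) < \<epsilon> \<Longrightarrow> norm (B - ?B0) < \<epsilon>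
       \<Longrightarrow> eigen_frame G B v l \<Longrightarrow>
       card {i. m < l i} = card {i. m < l0 i} \<and> norm (v i) \<le> K \<and> \<bar>l i\<bar> \<le> K \<and> l i \<noteq> m"
    and e3: "\<And>G B v l G' B' w \<mu>. transpose G = G \<Longrightarrow> transpose B = B \<Longrightarrow> norm (G - ?G0) < \<epsilon> \<Longrightarrow> norm (B - ?B0) < \<epsilon>
       \<Longrightarrow> eigen_frame G B v l
       \<Longrightarrow> transpose G' = G' \<Longrightarrow> transpose B' = B' \<Longrightarrow> norm (G' - ?G0) < \<epsilon> \<Longrightarrow> norm (B' - ?B0) < \<epsilon>
       \<Longrightarrow> eigen_frame G' B' w \<mu>
       \<Longrightarrow> \<bar>top_ln m \<mu> - top_ln m l - top_variation m v l (G' - G) (B' - B)\<bar>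
            \<le> C * (norm (G' - G) + norm (B' - B))\<^sup>2"
    using top_ln_local[OF G0 B0 f0 m(1,3)] by blast
  \<comment> \<open>The curves converge uniformly only on compact sets of coordinates, hence closed
    balls inside the chart ranges.\<close>
  obtain r where r: "r > 0" "cball (chart_map c x0) r \<subseteq> chart_range c"
    using open_contains_cball chartD(2,5)[OF c(1)] x0 by blast
  obtain r' where r': "r' > 0" "cball (chart_map c' (f x0)) r' \<subseteq> chart_range c'"
    using open_contains_cball chartD(2,5)[OF c(2)] x0 by blast
  let ?K = "cball (chart_map c x0) r" and ?K' = "cball (chart_map c' (f x0)) r'"
  \<comment> \<open>A bound for the differential on \<open>U\<close>: pulling a matrix back
    multiplies its norm by at most \<open>M\<^sup>2\<close>.\<close>
  define M where "M = norm (jac c c' x0) + 1"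
  have M: "M > 0" unfolding M_def by (simp add: add_nonneg_pos)
  have "isCont (chart_rep c g) x0" "isCont (pull c c' g) x0" "isCont (jac c c') x0" "isCont (chart_map c) x0"
    using chart_rep_continuous[OF g(1) c(1)] pull_continuous[OF g(1) c] jac_continuous[OF c] chartD(3)[OF c(1)]
      D x0 chartD(1)[OF c(1)]
    by (auto simp: continuous_on_eq_continuous_at)
  moreover have "isCont f x0" using f_cont by (simp add: continuous_on_eq_continuous_at)
  then have "isCont (\<lambda>x. chart_map c' (f x)) x0"
    using continuous_on_eq_continuous_at[OF chartD(1)[OF c(2)]] chartD(3)[OF c(2)] x0(2)
    by (blast intro: isCont_o2)
  ultimately have lim: "(chart_rep c g \<longlongrightarrow> ?G0) (nhds x0)" "(pull c c' g \<longlongrightarrow> ?B0) (nhds x0)"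
      "(jac c c' \<longlongrightarrow> jac c c' x0) (nhds x0)" "(chart_map c \<longlongrightarrow> chart_map c x0) (nhds x0)"
      "((\<lambda>x. chart_map c' (f x)) \<longlongrightarrow> chart_map c' (f x0)) (nhds x0)"
    by (auto simp: isCont_def intro: tendsto_nhds_iff[THEN iffD2])
  have "\<forall>\<^sub>F x in nhds x0. x \<in> ?D" using D by (rule eventually_nhds_in_open)
  moreover have "\<forall>\<^sub>F x in nhds x0. dist (chart_rep c g x) ?G0 < \<epsilon> / 2" "\<forall>\<^sub>F x in nhds x0. dist (pull c c' g x) ?B0 < \<epsilon> / 2"
    "\<forall>\<^sub>F x in nhds x0. dist (jac c c' x) (jac c c' x0) < 1" "\<forall>\<^sub>F x in nhds x0. dist (chart_map c x) (chart_map c x0) < r"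
    "\<forall>\<^sub>F x in nhds x0. dist (chart_map c' (f x)) (chart_map c' (f x0)) < r'"
    by (rule tendstoD, rule lim, use e(1) r(1) r'(1) in simp)+
  ultimately have "\<forall>\<^sub>F x in nhds x0. x \<in> ?D \<and> norm (chart_rep c g x - ?G0) < \<epsilon> / 2 \<and> norm (pull c c' g x - ?B0) < \<epsilon> / 2
      \<and> norm (jac c c' x) \<le> M \<and> chart_map c x \<in> ?K \<and> chart_map c' (f x) \<in> ?K'"
  proof eventually_elim
    case (elim x)
    have "norm (jac c c' x) \<le> M"
      using elim(4) norm_triangle_sub[of "jac c c' x" "jac c c' x0"] by (simp add: M_def dist_norm)
    then show ?case using elim by (auto simp: dist_norm dist_commute norm_minus_commute)
  qed
  then obtain U where U: "open U" "x0 \<in> U"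
    and U': "\<And>x. x \<in> U \<Longrightarrow> x \<in> ?D \<and> norm (chart_rep c g x - ?G0) < \<epsilon> / 2 \<and> norm (pull c c' g x - ?B0) < \<epsilon> / 2
      \<and> norm (jac c c' x) \<le> M \<and> chart_map c x \<in> ?K \<and> chart_map c' (f x) \<in> ?K'"
    unfolding eventually_nhds by blast
  have "bounded (local_tensor \<A> c h1 ` ?K)"
    using \<gamma>(2) c r by (intro compact_imp_bounded compact_continuous_image)
       (auto simp: C0_curve_def intro: continuous_on_subset)
  then obtain H1 where H1: "\<And>x. chart_map c x \<in> ?K \<Longrightarrow> norm (chart_rep c h1 x) \<le> H1"
    unfolding bounded_iff chart_rep_def by blast
  have "bounded (local_tensor \<A> c' h2 ` ?K')"
    using \<gamma>(4) c r' by (intro compact_imp_bounded compact_continuous_image)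
       (auto simp: C0_curve_def intro: continuous_on_subset)
  then obtain H2 where H2: "\<And>x. chart_map c' x \<in> ?K' \<Longrightarrow> norm (chart_rep c' h2 x) \<le> H2"
    unfolding bounded_iff chart_rep_def by blast
  \<comment> \<open>The added 1 covers the distance between the difference quotient and its limit,
    once this distance is at most 1.\<close>
  define H where "H = max H1 H2 + 1"
  have "0 \<le> norm (chart_rep c h1 x0)" by simp
  also have "\<dots> \<le> H1" using H1[of x0] r by simp
  finally have "0 \<le> H1" .
  then have Hp: "1 \<le> H" by (simp add: H_def)
  define L where "L = (1 + M\<^sup>2) * H"
  have Lp: "0 < L" using Hp unfolding L_def by (intro mult_pos_pos add_pos_nonneg) auto
  have sandwich: "norm (transpose (jac c c' x) ** X ** jac c c' x) \<le> M\<^sup>2 * norm X" if "x \<in> U" for x X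
  proof -
    have "norm (transpose (jac c c' x) ** X ** jac c c' x) \<le> norm (transpose (jac c c' x) ** X) * norm (jac c c' x)"
      by (rule norm_matrix_mult_le)
    also have "\<dots> \<le> (norm (jac c c' x) * norm X) * norm (jac c c' x)"
      by (intro mult_right_mono order_trans[OF norm_matrix_mult_le]) (simp_all add: norm_transpose_matrix)
    also have "\<dots> \<le> (M * norm X) * M" using U'[OF that] M by (intro mult_mono) auto
    finally show ?thesis by (simp add: power2_eq_square ac_simps)
  qed
  let ?qG = "\<lambda>t x. (chart_rep c (\<gamma>1 t) x - chart_rep c g x) /\<^sub>R t" and ?qB = "\<lambda>t x. (pull c c' (\<gamma>2 t) x - pull c c' g x) /\<^sub>R t"
  have close: "\<forall>\<^sub>F t in at 0. \<forall>x\<in>U. norm (?qG t x - chart_rep c h1 x) \<le> \<eta> \<and> norm (?qB t x - pull c c' h2 x) \<le> M\<^sup>2 * \<eta>"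
    if "0 < \<eta>" for \<eta>
  proof -
    note C0_curve_quotient[OF \<gamma>(2) c(1) compact_cball r(2) that, unfolded \<gamma>(1)]
    moreover note C0_curve_quotient[OF \<gamma>(4) c(2) compact_cball r'(2) that, unfolded \<gamma>(3)]
    ultimately show ?thesis
    proof eventually_elim
      case (elim t)
      show ?case
      proof (intro ballI conjI)
        fix x assume x: "x \<in> U"
        show "norm (?qG t x - chart_rep c h1 x) \<le> \<eta>" using elim(1) U'[OF x] by blast
        have "?qB t x - pull c c' h2 x = transpose (jac c c' x) **
            ((chart_rep c' (\<gamma>2 t) (f x) - chart_rep c' g (f x)) /\<^sub>R t - chart_rep c' h2 (f x)) ** jac c c' x"
          unfolding pull_def
          by (simp add: bounded_bilinear.diff_left[OF bounded_bilinear_matrix_mult]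
              bounded_bilinear.diff_right[OF bounded_bilinear_matrix_mult]
              scalar_matrix_assoc[symmetric] matrix_scalar_ac scaleR_diff_right)
        then have "norm (?qB t x - pull c c' h2 x) \<le> M\<^sup>2 * norm ((chart_rep c' (\<gamma>2 t) (f x) - chart_rep c' g (f x)) /\<^sub>R t - chart_rep c' h2 (f x))"
          using sandwich[OF x] by simp
        also have "\<dots> \<le> M\<^sup>2 * \<eta>" using elim(2) U'[OF x] by (intro mult_left_mono) auto
        finally show "norm (?qB t x - pull c c' h2 x) \<le> M\<^sup>2 * \<eta>" .
      qed
    qed
  qed
  have unscale: "norm X \<le> r * \<bar>t\<bar>" if "norm (X /\<^sub>R t) \<le> r" "t \<noteq> 0" for X :: "real^'n^'n" and r t :: real
  proof -
    have "norm (X /\<^sub>R t) = norm X / \<bar>t\<bar>" by (simp add: divide_inverse)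
    then show ?thesis using that by (simp add: pos_divide_le_eq)
  qed
  have incr: "\<forall>\<^sub>F t in at 0. \<forall>x\<in>U. norm (chart_rep c (\<gamma>1 t) x - chart_rep c g x) + norm (pull c c' (\<gamma>2 t) x - pull c c' g x) \<le> L * \<bar>t\<bar>"
    using close[OF zero_less_one] eventually_neq_at_within[of 0]
  proof eventually_elim
    case (elim t)
    show ?case
    proof
      fix x assume x: "x \<in> U"
      have "norm (?qG t x) \<le> norm (chart_rep c h1 x) + 1"
        using elim(1) x norm_triangle_sub[of "?qG t x" "chart_rep c h1 x"] by force
      also have "\<dots> \<le> H" using H1[of x] U'[OF x] by (simp add: H_def)
      finally have 1: "norm (chart_rep c (\<gamma>1 t) x - chart_rep c g x) \<le> H * \<bar>t\<bar>" using elim(2) by (rule unscale)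
      have "norm (?qB t x) \<le> norm (pull c c' h2 x) + M\<^sup>2"
        using elim(1) x norm_triangle_sub[of "?qB t x" "pull c c' h2 x"] by force
      also have "\<dots> \<le> M\<^sup>2 * norm (chart_rep c' h2 (f x)) + M\<^sup>2" unfolding pull_def using sandwich[OF x] by simp
      also have "\<dots> \<le> M\<^sup>2 * H2 + M\<^sup>2" using H2[of "f x"] U'[OF x] by (intro add_right_mono mult_left_mono) auto
      also have "\<dots> = M\<^sup>2 * (H2 + 1)" by (simp add: algebra_simps)
      also have "\<dots> \<le> M\<^sup>2 * H" by (intro mult_left_mono) (auto simp: H_def)
      finally have 2: "norm (pull c c' (\<gamma>2 t) x - pull c c' g x) \<le> M\<^sup>2 * H * \<bar>t\<bar>" using elim(2) by (rule unscale)
      show "norm (chart_rep c (\<gamma>1 t) x - chart_rep c g x) + norm (pull c c' (\<gamma>2 t) x - pull c c' g x) \<le> L * \<bar>t\<bar>"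
        using 1 2 by (simp add: L_def algebra_simps)
    qed
  qed
  have small: "\<forall>\<^sub>F t in at (0::real). \<bar>t\<bar> < s" if "0 < s" for s
    using that by (auto simp: eventually_at dist_real_def intro!: exI[of _ s])
  \<comment> \<open>Points of \<open>U\<close> use up at most half of \<open>\<epsilon>\<close>. As
    soon as \<open>L * \<bar>t\<bar>\<close> is below the other half, the moved pencils stay within
    reach of \<open>top_ln_local\<close>.\<close>
  have good: "\<forall>\<^sub>F t in at 0. cont_tensor (\<gamma>1 t) \<and> cont_tensor (\<gamma>2 t) \<and> (\<forall>x\<in>U. norm (chart_rep c (\<gamma>1 t) x - ?G0) < \<epsilon>
      \<and> norm (pull c c' (\<gamma>2 t) x - ?B0) < \<epsilon>
      \<and> norm (chart_rep c (\<gamma>1 t) x - chart_rep c g x) + norm (pull c c' (\<gamma>2 t) x - pull c c' g x) \<le> L * \<bar>t\<bar>)"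
  proof -
    have "\<forall>\<^sub>F t in at 0. cont_tensor (\<gamma>1 t)" "\<forall>\<^sub>F t in at 0. cont_tensor (\<gamma>2 t)"
      using \<gamma> by (auto simp: C0_curve_def)
    moreover have "0 < \<epsilon> / (2 * L)" using e(1) Lp by simp
    note small[OF this]
    ultimately show ?thesis
      using incr
    proof eventually_elim
      case (elim t)
      have "L * \<bar>t\<bar> < \<epsilon> / 2" using elim(3) Lp by (simp add: field_simps)
      then show ?case
      proof (intro conjI ballI elim(1,2))
        fix x assume x: "x \<in> U" and chart_rep: "L * \<bar>t\<bar> < \<epsilon> / 2"
        have s: "norm (chart_rep c (\<gamma>1 t) x - chart_rep c g x) + norm (pull c c' (\<gamma>2 t) x - pull c c' g x) \<le> L * \<bar>t\<bar>"
          using elim(4) x by blast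
        then show "norm (chart_rep c (\<gamma>1 t) x - chart_rep c g x) + norm (pull c c' (\<gamma>2 t) x - pull c c' g x) \<le> L * \<bar>t\<bar>" .
        have "norm (chart_rep c (\<gamma>1 t) x - chart_rep c g x) < \<epsilon> / 2" "norm (pull c c' (\<gamma>2 t) x - pull c c' g x) < \<epsilon> / 2"
          using s chart_rep norm_ge_zero[of "chart_rep c (\<gamma>1 t) x - chart_rep c g x"]
            norm_ge_zero[of "pull c c' (\<gamma>2 t) x - pull c c' g x"] by linarith+
        then show "norm (chart_rep c (\<gamma>1 t) x - ?G0) < \<epsilon>" "norm (pull c c' (\<gamma>2 t) x - ?B0) < \<epsilon>"
          using U'[OF x] by (auto intro: norm_diff_triangle_less[of _ _ "\<epsilon> / 2" _ "\<epsilon> / 2", simplified])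
      qed
    qed
  qed
  have at: "isCont (log_sv k a b) x \<and> spd (a x) \<and> (\<forall>v l. eigen_frame (chart_rep c a x) (pull c c' b x) v l \<longrightarrow> log_sv k a b x = top_ln m l / 2)"
    if x: "x \<in> U" and ab: "cont_tensor a" "cont_tensor b" "norm (chart_rep c a x - ?G0) < \<epsilon>" "norm (pull c c' b x - ?B0) < \<epsilon>" for a b x
  proof -
    have xd: "x \<in> chart_dom c" "f x \<in> chart_dom c'" using U'[OF x] by auto
    have sa: "transpose (a y) = a y" and sb: "transpose (b y) = b y" for y using ab by (auto simp: cont_tensor_def)
    have sG: "transpose (chart_rep c a x) = chart_rep c a x" and sB: "transpose (pull c c' b x) = pull c c' b x"
      by (auto intro: transpose_chart_rep transpose_pull c xd sa sb)
    have ax: "spd (a x)" using e1[OF sG ab(3)] spd_chart_rep[OF c(1) xd(1)] by simp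
    have E: "card {i. m < l i} = k \<and> (\<forall>i. l i \<noteq> m)" if "eigen_frame (chart_rep c a x) (pull c c' b x) v l" for v l
      using e2[OF sG sB ab(3,4) that] m(2) by simp
    obtain v l where vl: "eigen_frame (chart_rep c a x) (pull c c' b x) v l" by (rule local_frame_exists[where a = a and b = b, OF c xd ax sb])
    have "isCont (log_sv k a b) x"
      using E[OF vl] by (intro log_sv_isCont[OF c xd ab(1) ax ab(2) vl _ m(1)]) auto
    moreover have "log_sv k a b x = top_ln m l / 2" if "eigen_frame (chart_rep c a x) (pull c c' b x) v l" for v l
      using E[OF that] by (intro log_sv_local[OF c xd ax sb that _ m(1)]) auto
    ultimately show ?thesis using ax by blast
  qed
  have base: "norm (chart_rep c g x - ?G0) < \<epsilon>" "norm (pull c c' g x - ?B0) < \<epsilon>" if "x \<in> U" for x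
    using U'[OF that] e(1) by auto
  define V where "V = CARD('n) * (K\<^sup>2 * (1 + K) / m)"
  have V: "0 \<le> V" using e m by (simp add: V_def)
  show thesis
  proof (rule that[OF U])
    show "isCont (log_sv k g g) x" if "x \<in> U" for x
      using at[OF that g(1) g(1) base[OF that]] by blast
    show "\<forall>\<^sub>F t in at 0. \<forall>x\<in>U. isCont (log_sv k (\<gamma>1 t) (\<gamma>2 t)) x"
      using good by eventually_elim (use at in blast)
    fix \<eta> :: real assume \<eta>: "0 < \<eta>"
    \<comment> \<open>Tolerance for the quotients of the matrices: the first-order term amplifies it
      by at most \<open>V * (1 + M\<^sup>2)\<close>.\<close>
    define \<eta>' where "\<eta>' = \<eta> / (V * (1 + M\<^sup>2) + 1)"
    have den: "0 < V * (1 + M\<^sup>2) + 1" using V by (intro add_nonneg_pos mult_nonneg_nonneg) auto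
    have \<eta>': "0 < \<eta>'" "V * (1 + M\<^sup>2) * \<eta>' \<le> \<eta>"
    proof -
      show "0 < \<eta>'" using \<eta> den by (simp add: \<eta>'_def)
      have "(V * (1 + M\<^sup>2)) / (V * (1 + M\<^sup>2) + 1) * \<eta> \<le> 1 * \<eta>"
        using den \<eta> by (intro mult_right_mono) (auto simp: divide_le_eq)
      then show "V * (1 + M\<^sup>2) * \<eta>' \<le> \<eta>" by (simp add: \<eta>'_def)
    qed
    \<comment> \<open>The quadratic remainder divided by \<open>\<bar>t\<bar>\<close> is at most
      \<open>C * L\<^sup>2 * \<bar>t\<bar>\<close>, which drops below \<open>\<eta>\<close> for
      \<open>\<bar>t\<bar>\<close> less than \<open>\<eta>\<close> over this denominator.\<close>
    have den2: "0 < C * L\<^sup>2 + 1" using e by (intro add_nonneg_pos mult_nonneg_nonneg) auto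
    show "\<forall>\<^sub>F t in at 0. \<forall>x\<in>U.
      \<bar>(log_sv k (\<gamma>1 t) (\<gamma>2 t) x - log_sv k g g x) / t - (left_term g k h2 (f x) - right_term g k h1 x) / 2\<bar> \<le> \<eta>"
      using good close[OF \<eta>'(1)] eventually_neq_at_within[of 0] small[OF divide_pos_pos[OF \<eta> den2]]
    proof eventually_elim
      case (elim t)
      show ?case
      proof
        fix x assume x: "x \<in> U"
        have xd: "x \<in> chart_dom c" "f x \<in> chart_dom c'" using U'[OF x] by auto
        let ?Gt = "chart_rep c (\<gamma>1 t) x" and ?Bt = "pull c c' (\<gamma>2 t) x" and ?Gx = "chart_rep c g x" and ?Bx = "pull c c' g x"
        have near: "norm (?Gt - ?G0) < \<epsilon>" "norm (?Bt - ?B0) < \<epsilon>" "norm (?Gt - ?Gx) + norm (?Bt - ?Bx) \<le> L * \<bar>t\<bar>"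
          and ct: "cont_tensor (\<gamma>1 t)" "cont_tensor (\<gamma>2 t)" using elim(1) x by auto
        have st1: "transpose (\<gamma>1 t y) = \<gamma>1 t y" and st2: "transpose (\<gamma>2 t y) = \<gamma>2 t y" for y
          using ct by (auto simp: cont_tensor_def)
        have sGt: "transpose ?Gt = ?Gt" and sBt: "transpose ?Bt = ?Bt" and sG: "transpose ?Gx = ?Gx" and sB: "transpose ?Bx = ?Bx"
          by (auto intro: transpose_chart_rep transpose_pull c xd st1 st2 sg)
        note att = at[OF x ct near(1,2)] and at0 = at[OF x g(1) g(1) base[OF x]]
        obtain v l where vl: "eigen_frame ?Gx ?Bx v l" by (rule local_frame_exists[where a = g and b = g, OF c xd g(2) sg])
        obtain w \<mu> where w: "eigen_frame ?Gt ?Bt w \<mu>" using local_frame_exists[where a = "\<gamma>1 t" and b = "\<gamma>2 t", OF c xd _ st2] att by blast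
        have bd: "norm (v i) \<le> K" "\<bar>l i\<bar> \<le> K" and kl: "card {i. m < l i} = k" for i
          using e2[OF sG sB base[OF x] vl] m(2) by auto
        let ?tv = "top_variation m v l"
        have ph: "log_sv k (\<gamma>1 t) (\<gamma>2 t) x = top_ln m \<mu> / 2" "log_sv k g g x = top_ln m l / 2"
          using att w at0 vl by blast+
        have "\<bar>top_ln m \<mu> - top_ln m l - ?tv (?Gt - ?Gx) (?Bt - ?Bx)\<bar> \<le> C * (norm (?Gt - ?Gx) + norm (?Bt - ?Bx))\<^sup>2"
          by (rule e3[OF sG sB base[OF x] vl sGt sBt near(1,2) w])
        also have "\<dots> \<le> C * (L * \<bar>t\<bar>)\<^sup>2" using near(3) e by (intro mult_left_mono power_mono) auto
        also have "\<dots> = (C * L\<^sup>2 * \<bar>t\<bar>) * \<bar>t\<bar>" by (simp add: power2_eq_square)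
        also have "\<dots> \<le> \<eta> * \<bar>t\<bar>"
        proof (rule mult_right_mono)
          have "C * L\<^sup>2 * \<bar>t\<bar> \<le> (C * L\<^sup>2 + 1) * \<bar>t\<bar>" by (intro mult_right_mono) auto
          also have "\<dots> \<le> \<eta>" using elim(4) den2 by (simp add: field_simps)
          finally show "C * L\<^sup>2 * \<bar>t\<bar> \<le> \<eta>" .
        qed simp
        finally have "\<bar>top_ln m \<mu> - top_ln m l - ?tv (?Gt - ?Gx) (?Bt - ?Bx)\<bar> / \<bar>t\<bar> \<le> \<eta>"
          using elim(3) by (simp add: divide_le_eq)
        moreover have "\<bar>top_ln m \<mu> - top_ln m l - ?tv (?Gt - ?Gx) (?Bt - ?Bx)\<bar> / \<bar>t\<bar>
            = \<bar>(top_ln m \<mu> - top_ln m l) / t - ?tv (?qG t x) (?qB t x)\<bar>"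
          unfolding top_variation_scaleR
          by (subst abs_divide[symmetric]) (simp add: divide_inverse algebra_simps)
        ultimately have 1: "\<bar>(top_ln m \<mu> - top_ln m l) / t - ?tv (?qG t x) (?qB t x)\<bar> \<le> \<eta>" by simp
        have "\<bar>?tv (?qG t x - chart_rep c h1 x) (?qB t x - pull c c' h2 x)\<bar>
            \<le> V * (norm (?qG t x - chart_rep c h1 x) + norm (?qB t x - pull c c' h2 x))"
          unfolding V_def by (rule top_variation_le[OF m(1) bd])
        also have "\<dots> \<le> V * (\<eta>' + M\<^sup>2 * \<eta>')" using elim(2) x V by (intro mult_left_mono add_mono) auto
        also have "\<dots> \<le> \<eta>" using \<eta>'(2) by (simp add: algebra_simps)
        finally have 2: "\<bar>?tv (?qG t x) (?qB t x) - ?tv (chart_rep c h1 x) (pull c c' h2 x)\<bar> \<le> \<eta>"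
          unfolding top_variation_diff .
        have 3: "left_term g k h2 (f x) - right_term g k h1 x = ?tv (chart_rep c h1 x) (pull c c' h2 x)"
          by (rule variation_eq[OF c xd g(2) f vl kl m(1)])
        have "(log_sv k (\<gamma>1 t) (\<gamma>2 t) x - log_sv k g g x) / t = (top_ln m \<mu> - top_ln m l) / t / 2"
          unfolding ph by (simp add: diff_divide_distrib)
        \<comment> \<open>The remainder of the expansion and the error of the directions are each at
          most \<open>\<eta>\<close>; the factor 1/2 absorbs their sum.\<close>
        moreover have "\<bar>a - r / 2\<bar> \<le> \<eta>" if "a = p / 2" "\<bar>p - q\<bar> \<le> \<eta>" "\<bar>q - r\<bar> \<le> \<eta>" for a p q r
          using that by linarith
        ultimately show "\<bar>(log_sv k (\<gamma>1 t) (\<gamma>2 t) x - log_sv k g g x) / t - (left_term g k h2 (f x) - right_term g k h1 x) / 2\<bar> \<le> \<eta>"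
          unfolding 3 using 1 2 by blast
      qed
    qed
  qed
qed

end

text \<open>A finite subcover suffices because \<open>eventually\<close> is closed under finite
  conjunctions; for this the neighbourhoods must not depend on \<open>t\<close>.\<close>

lemma eventually_all_of_local:
  fixes P :: "'b \<Rightarrow> 'a::topological_space \<Rightarrow> bool"
  assumes "compact (UNIV :: 'a set)"
    and "\<And>x0. \<exists>U. open U \<and> x0 \<in> U \<and> (\<forall>\<^sub>F t in F. \<forall>x\<in>U. P t x)"
  shows "\<forall>\<^sub>F t in F. \<forall>x. P t x"
proof -
  from assms(2) obtain U where U: "\<And>x0. open (U x0)" "\<And>x0. x0 \<in> U x0" "\<And>x0. \<forall>\<^sub>F t in F. \<forall>x\<in>U x0. P t x"
    by metis
  obtain D where D: "finite D" "UNIV \<subseteq> (\<Union>x0\<in>D. U x0)"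
  proof (rule compactE_image[OF assms(1), of UNIV U])
    show "UNIV \<subseteq> (\<Union>x0\<in>UNIV. U x0)" using U(2) by auto
  qed (use U(1) in auto)
  have "\<forall>\<^sub>F t in F. \<forall>x0\<in>D. \<forall>x\<in>U x0. P t x"
    using D(1) U(3) by (simp add: eventually_ball_finite_distrib)
  then show ?thesis by eventually_elim (use D(2) in blast)
qed

lemma integrable_continuous_compact:
  fixes u :: "'a::topological_space \<Rightarrow> real"
  assumes fin: "finite_measure M" and c: "compact (UNIV :: 'a set)" and M: "sets M = sets borel" and u: "continuous_on UNIV u"
  shows "integrable M u"
proof -
  have "bounded (range u)" using c u by (intro compact_imp_bounded compact_continuous_image)
  then obtain B where B: "\<And>x. norm (u x) \<le> B" by (auto simp: bounded_iff)
  have "u \<in> borel_measurable M"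
    using borel_measurable_continuous_onI[OF u] by (simp add: measurable_cong_sets[OF M refl])
  then show ?thesis using B by (intro finite_measure.integrable_const_bound[OF fin, of _ B]) auto
qed

context manifold
begin

lemma cont_tensor_add_scaleR:
  assumes "cont_tensor a" "cont_tensor b"
  shows "cont_tensor (\<lambda>x. a x + r *\<^sub>R b x)"
proof -
  have "local_tensor \<A> c (\<lambda>x. a x + r *\<^sub>R b x) y = local_tensor \<A> c a y + r *\<^sub>R local_tensor \<A> c b y" for c y
    unfolding local_tensor_def
    by (simp add: matrix_add_ldistrib matrix_add_rdistrib scalar_matrix_assoc[symmetric] matrix_scalar_ac)
  then have "local_tensor \<A> c (\<lambda>x. a x + r *\<^sub>R b x) = (\<lambda>y. local_tensor \<A> c a y + r *\<^sub>R local_tensor \<A> c b y)" for c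
    by (rule ext)
  moreover have "transpose (a x + r *\<^sub>R b x) = a x + r *\<^sub>R b x" for x
  proof -
    have "transpose (a x) = a x" "transpose (b x) = b x" using assms by (auto simp: cont_tensor_def)
    then show ?thesis
      by (simp add: linear_add[OF bounded_linear.linear[OF bounded_linear_transpose]]
          linear_scale[OF bounded_linear.linear[OF bounded_linear_transpose]])
  qed
  ultimately show ?thesis
    using assms unfolding cont_tensor_def by (auto intro!: continuous_intros)
qed

lemma C0_curve_line:
  assumes "cont_tensor a" "cont_tensor h"
  shows "C0_curve (\<lambda>t x. a x + t *\<^sub>R h x) h"
  unfolding C0_curve_def
proof (intro conjI ballI allI impI)
  show "\<forall>\<^sub>F t in at 0. cont_tensor (\<lambda>x. a x + t *\<^sub>R h x)"
    using cont_tensor_add_scaleR[OF assms] by simp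
  show "continuous_on (chart_range c) (local_tensor \<A> c h)" if "c \<in> \<A>" for c
    using assms that by (auto simp: cont_tensor_def)
  fix c and K :: "(real^'n) set"
  have "\<forall>\<^sub>F s in at (0::real). local_tensor \<A> c h = local_tensor \<A> c (\<lambda>x. ((a x + s *\<^sub>R h x) - (a x + 0 *\<^sub>R h x)) /\<^sub>R s)"
    using eventually_neq_at_within[of 0] by eventually_elim simp
  then have "\<forall>\<^sub>F s in at (0::real). \<forall>y\<in>K. local_tensor \<A> c (\<lambda>x. ((a x + s *\<^sub>R h x) - (a x + 0 *\<^sub>R h x)) /\<^sub>R s) y = local_tensor \<A> c h y"
    by eventually_elim simp
  from uniform_limit_cong[OF this refl]
  show "uniform_limit K (\<lambda>s. local_tensor \<A> c (\<lambda>x. ((a x + s *\<^sub>R h x) - (a x + 0 *\<^sub>R h x)) /\<^sub>R s)) (local_tensor \<A> c h) (at 0)"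
    by (simp only: uniform_limit_const)
qed

lemma cont_tensor_zero: "cont_tensor (\<lambda>_. 0)"
  by (simp add: cont_tensor_def local_tensor_def transpose_def vec_eq_iff zero_vec_def[symmetric])

lemma C0_curve_const:
  assumes "cont_tensor a"
  shows "C0_curve (\<lambda>t. a) (\<lambda>_. 0)"
  using C0_curve_line[OF assms cont_tensor_zero] by simp

lemma sym_tensors_cont: "a \<in> sym_tensors \<A> \<Longrightarrow> cont_tensor a"
  by (auto simp: sym_tensors_def cont_tensor_def intro: smooth_on_imp_continuous_on)

lemma metrics_spd: "g \<in> metrics \<A> \<Longrightarrow> spd (g x)"
  by (auto simp: metrics_def sym_tensors_def spd_def ginner_eq)

text \<open>The empty list of partial derivatives in \<open>tensor_tendsto\<close> yields the
  uniform convergence required.\<close>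

lemma smooth_curve_C0:
  assumes "smooth_curve_through \<A> N g h \<gamma>" and h: "h \<in> sym_tensors \<A>"
  shows "C0_curve \<gamma> h"
proof -
  obtain \<epsilon> and \<Gamma> :: "nat \<Rightarrow> real \<Rightarrow> ('m, 'n) tensor_field" where e: "\<epsilon> > 0" and \<Gamma>: "\<Gamma> 0 = \<gamma>" "\<And>n t. t \<in> {-\<epsilon><..<\<epsilon>} \<Longrightarrow> \<Gamma> n t \<in> sym_tensors \<A>"
    and d: "tensor_curve_derivative \<A> \<gamma> h 0"
  proof -
    obtain \<epsilon> where e: "\<epsilon> > 0" "smooth_tensor_curve \<A> {-\<epsilon><..<\<epsilon>} \<gamma>" and d: "tensor_curve_derivative \<A> \<gamma> h 0"
      using assms(1) unfolding smooth_curve_through_def by blast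
    then obtain \<Gamma> :: "nat \<Rightarrow> real \<Rightarrow> ('m, 'n) tensor_field" where "\<Gamma> 0 = \<gamma>"
      "\<forall>n. \<forall>t\<in>{-\<epsilon><..<\<epsilon>}. \<Gamma> n t \<in> sym_tensors \<A> \<and> tensor_curve_derivative \<A> (\<Gamma> n) (\<Gamma> (Suc n) t) t"
      unfolding smooth_tensor_curve_def by blast
    then show thesis by (intro that[OF e(1) _ _ d, of \<Gamma>]) auto
  qed
  show ?thesis
    unfolding C0_curve_def
  proof (intro conjI ballI allI impI)
    have "\<forall>\<^sub>F t in at (0::real). t \<in> {-\<epsilon><..<\<epsilon>}" using e by (intro eventually_at_in_open') auto
    then show "\<forall>\<^sub>F t in at 0. cont_tensor (\<gamma> t)"
      by eventually_elim (metis \<Gamma> sym_tensors_cont)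
    show "continuous_on (chart_range c) (local_tensor \<A> c h)" if "c \<in> \<A>" for c
      using sym_tensors_cont[OF h] that by (auto simp: cont_tensor_def)
    fix c K assume "c \<in> \<A>" "compact K \<and> K \<subseteq> chart_range c"
    then show "uniform_limit K (\<lambda>s. local_tensor \<A> c (\<lambda>x. (\<gamma> s x - \<gamma> 0 x) /\<^sub>R s)) (local_tensor \<A> c h) (at 0)"
    proof -
      have "uniform_limit K (\<lambda>s. iterated_partial [] (local_tensor \<A> c (\<lambda>x. (\<gamma> (0 + s) x - \<gamma> 0 x) /\<^sub>R s)))
          (iterated_partial [] (local_tensor \<A> c h)) (at 0)"
        using \<open>c \<in> \<A>\<close> \<open>compact K \<and> K \<subseteq> chart_range c\<close>
        by (intro d[unfolded tensor_curve_derivative_def tensor_tendsto_def, rule_format]) auto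
      then show ?thesis by simp
    qed
  qed
qed

end

context C1_dynamics
begin

text \<open>Compactness makes the local statements uniform on the whole manifold. The limit is then
  continuous as a uniform limit of continuous quotients, so the dependence of the projections on the
  point is never examined.\<close>

lemma uniform_derivative:
  assumes comp: "compact (UNIV :: 'm set)"
    and g: "cont_tensor g" "\<And>x. spd (g x)" and f: "inj f"
    and gap: "\<And>x. singular_value (k + 1) (g x) (g (f x)) (tangent_map \<A> f x)
      < singular_value k (g x) (g (f x)) (tangent_map \<A> f x)" and k: "1 \<le> k" "k < CARD('n)"
    and \<gamma>: "\<gamma>1 0 = g" "C0_curve \<gamma>1 h1" "\<gamma>2 0 = g" "C0_curve \<gamma>2 h2"
  shows "continuous_on UNIV (log_sv k g g)"
    and "\<forall>\<^sub>F t in at 0. continuous_on UNIV (log_sv k (\<gamma>1 t) (\<gamma>2 t))"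
    and "uniform_limit UNIV (\<lambda>t x. (log_sv k (\<gamma>1 t) (\<gamma>2 t) x - log_sv k g g x) / t)
      (\<lambda>x. (left_term g k h2 (f x) - right_term g k h1 x) / 2) (at 0)"
    and "continuous_on UNIV (\<lambda>x. left_term g k h2 (f x) - right_term g k h1 x)"
proof -
  note loc = local_uniform_derivative[OF g f \<gamma> gap k]
  show c0: "continuous_on UNIV (log_sv k g g)"
    unfolding continuous_on_eq_continuous_at[OF open_UNIV]
  proof
    fix x0
    show "isCont (log_sv k g g) x0" by (rule loc[of x0]) blast
  qed
  have "\<forall>\<^sub>F t in at 0. \<forall>x. isCont (log_sv k (\<gamma>1 t) (\<gamma>2 t)) x"
  proof (rule eventually_all_of_local[OF comp])
    fix x0
    show "\<exists>U. open U \<and> x0 \<in> U \<and> (\<forall>\<^sub>F t in at 0. \<forall>x\<in>U. isCont (log_sv k (\<gamma>1 t) (\<gamma>2 t)) x)"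
      by (rule loc[of x0]) blast
  qed
  then show ct: "\<forall>\<^sub>F t in at 0. continuous_on UNIV (log_sv k (\<gamma>1 t) (\<gamma>2 t))"
    by (simp add: continuous_on_eq_continuous_at)
  let ?q = "\<lambda>t x. (log_sv k (\<gamma>1 t) (\<gamma>2 t) x - log_sv k g g x) / t"
  let ?p = "\<lambda>x. (left_term g k h2 (f x) - right_term g k h1 x) / 2"
  show ul: "uniform_limit UNIV ?q ?p (at 0)"
  proof (rule uniform_limitI)
    fix e :: real assume "0 < e"
    then have e2: "0 < e / 2" by simp
    have "\<forall>\<^sub>F t in at 0. \<forall>x. \<bar>?q t x - ?p x\<bar> \<le> e / 2"
    proof (rule eventually_all_of_local[OF comp])
      fix x0
      show "\<exists>U. open U \<and> x0 \<in> U \<and> (\<forall>\<^sub>F t in at 0. \<forall>x\<in>U. \<bar>?q t x - ?p x\<bar> \<le> e / 2)"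
        by (rule loc[of x0]) (use e2 in blast)
    qed
    then show "\<forall>\<^sub>F t in at 0. \<forall>x\<in>UNIV. dist (?q t x) (?p x) < e"
    proof eventually_elim
      case (elim t)
      show ?case
      proof
        fix x
        have "\<bar>?q t x - ?p x\<bar> \<le> e / 2" using elim by blast
        then show "dist (?q t x) (?p x) < e" unfolding dist_real_def using \<open>0 < e\<close> by linarith
      qed
    qed
  qed
  have "\<forall>\<^sub>F t in at 0. continuous_on UNIV (?q t)"
    using ct eventually_neq_at_within[of 0] by eventually_elim (intro continuous_intros c0, auto)
  from uniform_limit_theorem[OF this ul] have "continuous_on UNIV ?p" by simp
  then have "continuous_on UNIV (\<lambda>x. 2 * ?p x)" by (rule continuous_on_mult_left)
  moreover have "2 * ?p x = left_term g k h2 (f x) - right_term g k h1 x" for x by simp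
  ultimately show "continuous_on UNIV (\<lambda>x. left_term g k h2 (f x) - right_term g k h1 x)" by (simp only:)
qed

text \<open>Varying only the metric on the source isolates the part coming from the right singular vectors.\<close>

lemma terms_continuous:
  assumes comp: "compact (UNIV :: 'm set)"
    and g: "cont_tensor g" "\<And>x. spd (g x)" and f: "bij f" "continuous_on UNIV (inv f)"
    and gap: "\<And>x. singular_value (k + 1) (g x) (g (f x)) (tangent_map \<A> f x)
      < singular_value k (g x) (g (f x)) (tangent_map \<A> f x)" and k: "1 \<le> k" "k < CARD('n)"
    and h: "cont_tensor h"
  shows "continuous_on UNIV (right_term g k h)" "continuous_on UNIV (left_term g k h)"
proof -
  have inj: "inj f" using f by (auto simp: bij_def)
  have g0: "(\<lambda>x. g x + 0 *\<^sub>R h x) = g" by simp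
  have z: "left_term g k (\<lambda>_. 0) x = 0" for x
    by (simp add: left_term_def tensor_inner_def trace_def)
  have "continuous_on UNIV (\<lambda>x. left_term g k (\<lambda>_. 0) (f x) - right_term g k h x)"
    using uniform_derivative(4)[OF comp g inj gap k, of "\<lambda>t x. g x + t *\<^sub>R h x", OF g0 C0_curve_line[OF g(1) h] refl C0_curve_const[OF g(1)]] .
  then have "continuous_on UNIV (\<lambda>x. - right_term g k h x)" by (simp add: z)
  then have "continuous_on UNIV (\<lambda>x. - (- right_term g k h x))" by (rule continuous_on_minus)
  then show r: "continuous_on UNIV (right_term g k h)" by (simp only: minus_minus)
  have "continuous_on UNIV (\<lambda>x. left_term g k h (f x) - right_term g k h x)"
    using uniform_derivative(4)[OF comp g inj gap k, of "\<lambda>t x. g x + t *\<^sub>R h x" h "\<lambda>t x. g x + t *\<^sub>R h x" h, OF g0 C0_curve_line[OF g(1) h] g0 C0_curve_line[OF g(1) h]] .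
  then have "continuous_on UNIV (\<lambda>x. (left_term g k h (f x) - right_term g k h x) + right_term g k h x)"
    by (rule continuous_on_add[OF _ r])
  then have "continuous_on UNIV (\<lambda>x. left_term g k h (f x))" by simp
  \<comment> \<open>Continuity of the inverse of \<open>f\<close> brings the left term back from
    \<open>f x\<close> to \<open>x\<close>.\<close>
  then have "continuous_on UNIV (\<lambda>x. left_term g k h (f (inv f x)))"
    by (rule continuous_on_compose2[OF _ f(2)]) simp
  then show "continuous_on UNIV (left_term g k h)"
    using f(1) by (simp add: bij_is_surj surj_f_inv_f)
qed

text \<open>On a probability space a uniform error passes through the integral with the same size.
  Left and right terms are integrated separately because the change of variables concerns only the
  left one.\<close>

lemma derivative_along_curve:
  assumes comp: "compact (UNIV :: 'm set)"
    and g: "cont_tensor g" "\<And>x. spd (g x)" and f: "bij f" "continuous_on UNIV (inv f)"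
    and gap: "\<And>x. singular_value (k + 1) (g x) (g (f x)) (tangent_map \<A> f x)
      < singular_value k (g x) (g (f x)) (tangent_map \<A> f x)" and k: "1 \<le> k" "k < CARD('n)"
    and h: "cont_tensor h" and \<gamma>: "\<gamma> 0 = g" "C0_curve \<gamma> h"
    and \<mu>: "prob_space \<mu>" "sets \<mu> = sets borel" "distr \<mu> \<mu> f = \<mu>"
  shows "integrable \<mu> (\<lambda>x. left_term g k h x - right_term g k h x)"
    and "((\<lambda>t. s_functional \<A> k f \<mu> (\<gamma> t)) has_real_derivative
      (1 / 2 * (\<integral>x. left_term g k h x - right_term g k h x \<partial>\<mu>))) (at 0)"
proof -
  interpret prob_space \<mu> by (rule \<mu>(1))
  have inj: "inj f" using f by (auto simp: bij_def)
  note ud = uniform_derivative[OF comp g inj gap k \<gamma> \<gamma>]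
  note tc = terms_continuous[OF comp g f gap k h]
  note int = integrable_continuous_compact[OF finite_measure_axioms comp \<mu>(2)]
  have l: "integrable \<mu> (left_term g k h)" and r: "integrable \<mu> (right_term g k h)" using int tc by auto
  then show "integrable \<mu> (\<lambda>x. left_term g k h x - right_term g k h x)" by simp
  have fm: "f \<in> measurable \<mu> \<mu>"
    using borel_measurable_continuous_onI[OF f_cont] by (simp add: measurable_cong_sets[OF \<mu>(2) \<mu>(2)])
  have lm: "left_term g k h \<in> borel_measurable \<mu>" using l by simp
  have lf: "integrable \<mu> (\<lambda>x. left_term g k h (f x))"
    by (rule int, rule continuous_on_compose2[OF tc(2) f_cont]) simp
  let ?p = "\<lambda>x. (left_term g k h (f x) - right_term g k h x) / 2"
  have ip: "integrable \<mu> ?p" using lf r by simp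
  have "(\<integral>x. left_term g k h (f x) \<partial>\<mu>) = (\<integral>x. left_term g k h x \<partial>distr \<mu> \<mu> f)"
    by (rule integral_distr[OF fm lm, symmetric])
  then have P: "(\<integral>x. ?p x \<partial>\<mu>) = 1 / 2 * (\<integral>x. left_term g k h x - right_term g k h x \<partial>\<mu>)"
    using lf l r by (simp add: \<mu>(3))
  have s: "s_functional \<A> k f \<mu> a = (\<integral>x. log_sv k a a x \<partial>\<mu>)" for a
    by (simp add: s_functional_def log_sv_def sv_def)
  have "((\<lambda>t. (s_functional \<A> k f \<mu> (\<gamma> (0 + t)) - s_functional \<A> k f \<mu> (\<gamma> 0)) / t) \<longlongrightarrow> (\<integral>x. ?p x \<partial>\<mu>)) (at 0)"
  proof (rule tendstoI)
    fix e :: real assume e: "0 < e"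
    then have "0 < e / 2" by simp
    from uniform_limitD[OF ud(3) this] ud(2) eventually_neq_at_within[of 0]
    show "\<forall>\<^sub>F t in at 0. dist ((s_functional \<A> k f \<mu> (\<gamma> (0 + t)) - s_functional \<A> k f \<mu> (\<gamma> 0)) / t) (\<integral>x. ?p x \<partial>\<mu>) < e"
    proof eventually_elim
      case (elim t)
      let ?q = "\<lambda>x. (log_sv k (\<gamma> t) (\<gamma> t) x - log_sv k g g x) / t"
      have i: "integrable \<mu> (log_sv k (\<gamma> t) (\<gamma> t))" "integrable \<mu> (log_sv k g g)" using int elim(2) ud(1) by auto
      then have iq: "integrable \<mu> ?q" by simp
      have "(s_functional \<A> k f \<mu> (\<gamma> (0 + t)) - s_functional \<A> k f \<mu> (\<gamma> 0)) / t = (\<integral>x. ?q x \<partial>\<mu>)"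
        using i by (simp add: s \<gamma>)
      then have "dist ((s_functional \<A> k f \<mu> (\<gamma> (0 + t)) - s_functional \<A> k f \<mu> (\<gamma> 0)) / t) (\<integral>x. ?p x \<partial>\<mu>)
          = norm (\<integral>x. ?q x - ?p x \<partial>\<mu>)"
        by (simp only: dist_norm Bochner_Integration.integral_diff[OF iq ip])
      also have "\<dots> \<le> (\<integral>x. norm (?q x - ?p x) \<partial>\<mu>)" by (rule integral_norm_bound)
      also have "\<dots> \<le> (\<integral>x. e / 2 \<partial>\<mu>)"
        using elim(1) iq ip by (intro integral_mono) (auto simp: dist_norm intro: less_imp_le)
      also have "\<dots> < e" using e by (simp add: prob_space)
      finally show ?case .
    qed
  qed
  then show "((\<lambda>t. s_functional \<A> k f \<mu> (\<gamma> t)) has_real_derivative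
      (1 / 2 * (\<integral>x. left_term g k h x - right_term g k h x \<partial>\<mu>))) (at 0)"
    unfolding DERIV_def P .
qed

end

section \<open>Metrics with a prescribed volume form\<close>

locale alternating_form =
  fixes \<omega> :: "('n::finite \<Rightarrow> real^'n) \<Rightarrow> real"
  assumes lin: "\<And>v i. linear (\<lambda>u. \<omega> (v(i := u)))"
    and alt: "\<And>v i j. i \<noteq> j \<Longrightarrow> v i = v j \<Longrightarrow> \<omega> v = 0"
begin

lemma add_slot: "\<omega> (v(i := x + y)) = \<omega> (v(i := x)) + \<omega> (v(i := y))"
  using linear_add[OF lin] .

lemma scale_slot: "\<omega> (v(i := r *\<^sub>R x)) = r * \<omega> (v(i := x))"
  using linear_scale[OF lin, of v i r x] by simp

lemma zero_slot: "v i = 0 \<Longrightarrow> \<omega> v = 0"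
  using linear_0[OF lin, of v i] by (metis fun_upd_triv)

text \<open>Placing \<open>v m + v n\<close> in both slots gives zero, and expansion leaves just the
  two mixed terms.\<close>

lemma swap_slots:
  assumes "m \<noteq> n"
  shows "\<omega> (\<lambda>i. v (Transposition.transpose m n i)) = - \<omega> v"
proof -
  let ?s = "v m + v n"
  have "0 = \<omega> (v(m := ?s, n := ?s))" using assms by (intro alt[of m n, symmetric]) auto
  also have "\<dots> = \<omega> (v(m := ?s, n := v m)) + \<omega> (v(m := ?s, n := v n))" by (rule add_slot)
  also have "\<omega> (v(m := ?s, n := v m)) = \<omega> (v(n := v m, m := v m)) + \<omega> (v(n := v m, m := v n))"
    using add_slot[of "v(n := v m)" m] assms by (simp add: fun_upd_twist)
  also have "\<omega> (v(m := ?s, n := v n)) = \<omega> (v(n := v n, m := v m)) + \<omega> (v(n := v n, m := v n))"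
    using add_slot[of "v(n := v n)" m] assms by (simp add: fun_upd_twist)
  also have "\<omega> (v(n := v m, m := v m)) = 0" using assms by (intro alt[of m n]) auto
  also have "\<omega> (v(n := v n, m := v n)) = 0" using assms by (intro alt[of m n]) auto
  finally have eq: "\<omega> (v(n := v m, m := v n)) + \<omega> (v(n := v n, m := v m)) = 0" by linarith
  have "v(n := v m, m := v n) = (\<lambda>i. v (Transposition.transpose m n i))"
    using assms by (auto simp: fun_eq_iff Transposition.transpose_def)
  moreover have "v(n := v n, m := v m) = v" by simp
  ultimately show ?thesis using eq by simp
qed

lemma scale_slots: "\<omega> (\<lambda>i. a i *\<^sub>R v i) = (\<Prod>i\<in>UNIV. a i) * \<omega> v"
proof -
  have "\<omega> (\<lambda>i. if i \<in> S then a i *\<^sub>R v i else v i) = (\<Prod>i\<in>S. a i) * \<omega> v" if "finite S" for S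
    using that
  proof (induction S)
    case (insert k S)
    let ?w = "\<lambda>i. if i \<in> S then a i *\<^sub>R v i else v i"
    have "(\<lambda>i. if i \<in> insert k S then a i *\<^sub>R v i else v i) = ?w(k := a k *\<^sub>R v k)"
      by (auto simp: fun_eq_iff)
    moreover have "?w(k := v k) = ?w" using insert by (auto simp: fun_eq_iff)
    ultimately show ?case using insert scale_slot[of ?w k "a k" "v k"] by simp
  qed simp
  from this[of UNIV] show ?thesis by simp
qed

text \<open>Both sides behave multiplicatively in \<open>A\<close>, so elementary cases suffice: a
  zero row, diagonal matrices, swaps and row additions. This is the uniqueness of the determinant
  among alternating forms.\<close>

lemma det_form: "\<omega> (\<lambda>i. \<Sum>j\<in>UNIV. (A $ i $ j) *\<^sub>R v j) = det A * \<omega> v"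
proof -
  have "\<forall>v. \<omega> (\<lambda>i. \<Sum>j\<in>UNIV. (A $ i $ j) *\<^sub>R v j) = det A * \<omega> v"
  proof (induction A rule: induct_matrix_elementary)
    case (1 A B)
    show ?case
    proof
      fix v :: "'n \<Rightarrow> real^'n"
      have "(\<lambda>i. \<Sum>j\<in>UNIV. ((A ** B) $ i $ j) *\<^sub>R v j) = (\<lambda>i. \<Sum>k\<in>UNIV. (A $ i $ k) *\<^sub>R (\<Sum>j\<in>UNIV. (B $ k $ j) *\<^sub>R v j))"
      proof
        fix i
        have "(\<Sum>j\<in>UNIV. ((A ** B) $ i $ j) *\<^sub>R v j) = (\<Sum>j\<in>UNIV. \<Sum>k\<in>UNIV. (A $ i $ k * B $ k $ j) *\<^sub>R v j)"
          by (simp only: matrix_matrix_mult_def vec_lambda_beta scaleR_sum_left)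
        also have "\<dots> = (\<Sum>k\<in>UNIV. \<Sum>j\<in>UNIV. (A $ i $ k * B $ k $ j) *\<^sub>R v j)" by (rule sum.swap)
        finally show "(\<Sum>j\<in>UNIV. ((A ** B) $ i $ j) *\<^sub>R v j) = (\<Sum>k\<in>UNIV. (A $ i $ k) *\<^sub>R (\<Sum>j\<in>UNIV. (B $ k $ j) *\<^sub>R v j))"
          by (simp add: scaleR_sum_right)
      qed
      then show "\<omega> (\<lambda>i. \<Sum>j\<in>UNIV. ((A ** B) $ i $ j) *\<^sub>R v j) = det (A ** B) * \<omega> v"
        using 1 by (simp add: det_mul)
    qed
  next
    case (2 A i)
    then have "A $ i = 0" by (simp add: row_def vec_eq_iff)
    then show ?case using det_zero_row(1)[OF 2] by (auto intro!: zero_slot[of _ i])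
  next
    case (3 A)
    show ?case
    proof
      fix v :: "'n \<Rightarrow> real^'n"
      have "(\<Sum>j\<in>UNIV. (A $ i $ j) *\<^sub>R v j) = (\<Sum>j\<in>UNIV. if j = i then (A $ i $ i) *\<^sub>R v i else 0)" for i
        using 3 by (intro sum.cong) auto
      then show "\<omega> (\<lambda>i. \<Sum>j\<in>UNIV. (A $ i $ j) *\<^sub>R v j) = det A * \<omega> v"
        by (simp add: scale_slots det_diagonal[OF 3])
    qed
  next
    case (4 m n)
    let ?p = "Transposition.transpose m n"
    have "det (\<chi> i j. (mat 1 :: real^'n^'n) $ i $ ?p j) = - 1"
      using det_permute_columns[of ?p "mat 1 :: real^'n^'n"] 4 by (simp add: permutes_swap_id sign_swap_id)
    moreover have "(\<Sum>j\<in>UNIV. ((\<chi> i j. (mat 1 :: real^'n^'n) $ i $ ?p j) $ i $ j) *\<^sub>R v j) = v (?p i)" for v :: "'n \<Rightarrow> real^'n" and i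
    proof -
      have "(\<Sum>j\<in>UNIV. ((\<chi> i j. (mat 1 :: real^'n^'n) $ i $ ?p j) $ i $ j) *\<^sub>R v j) = (\<Sum>j\<in>UNIV. if j = ?p i then v j else 0)"
        by (intro sum.cong refl) (auto simp: mat_def transpose_eq_iff)
      then show ?thesis by simp
    qed
    ultimately show ?case using swap_slots[OF 4] by simp
  next
    case (5 m n c)
    let ?E = "(\<chi> i j. if i = m \<and> j = n then c else of_bool (i = j)) :: real^'n^'n"
    have "?E = (\<chi> k. if k = m then row m (mat 1) + c *s row n (mat 1) else row k (mat 1))"
      using 5 by (auto simp: vec_eq_iff row_def mat_def)
    then have d: "det ?E = 1" using det_row_operation[OF 5, of "mat 1" c] by simp
    show ?case
    proof
      fix v :: "'n \<Rightarrow> real^'n"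
      have "(\<Sum>j\<in>UNIV. (?E $ i $ j) *\<^sub>R v j) = (v(m := v m + c *\<^sub>R v n)) i" for i
      proof (cases "i = m")
        case True
        have "(\<Sum>j\<in>UNIV. (?E $ i $ j) *\<^sub>R v j) = (\<Sum>j\<in>UNIV. (if j = n then c *\<^sub>R v n else 0) + (if j = m then v m else 0))"
          using True 5 by (intro sum.cong refl) auto
        then show ?thesis using True by (simp add: sum.distrib add.commute)
      next
        case False
        have "(\<Sum>j\<in>UNIV. (?E $ i $ j) *\<^sub>R v j) = (\<Sum>j\<in>UNIV. if j = i then v i else 0)"
          using False by (intro sum.cong refl) auto
        then show ?thesis using False by simp
      qed
      then have "\<omega> (\<lambda>i. \<Sum>j\<in>UNIV. (?E $ i $ j) *\<^sub>R v j) = \<omega> (v(m := v m + c *\<^sub>R v n))"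
        by (rule arg_cong[OF ext])
      also have "\<dots> = \<omega> (v(m := v m)) + c * \<omega> (v(m := v n))" by (simp only: add_slot scale_slot)
      also have "\<omega> (v(m := v n)) = 0" using 5 by (intro alt[of m n]) auto
      finally show "\<omega> (\<lambda>i. \<Sum>j\<in>UNIV. (?E $ i $ j) *\<^sub>R v j) = det ?E * \<omega> v" unfolding d by simp
    qed
  qed
  then show ?thesis by blast
qed

lemma det_axis: "\<omega> v = det (\<chi> i. v i) * \<omega> (\<lambda>j. axis j 1)"
proof -
  have "(\<Sum>j\<in>UNIV. (v i $ j) *\<^sub>R axis j 1) = v i" for i
    using basis_expansion[of "v i"] by (simp add: scalar_mult_eq_scaleR)
  then show ?thesis using det_form[of "\<chi> i. v i" "\<lambda>j. axis j 1"] by simp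
qed

end

text \<open>With the vectors as rows of \<open>V\<close>, orthonormality reads
  \<open>V ** G ** transpose V = mat 1\<close>; then determinants are taken.\<close>

lemma orthonormal_det:
  fixes G :: "real^'n^'n"
  assumes "\<And>i j. v i \<bullet> (G *v v j) = (if i = j then 1 else 0)"
  shows "(det (\<chi> i. v i))\<^sup>2 * det G = 1"
proof -
  let ?V = "(\<chi> i. v i) :: real^'n^'n"
  have "?V ** G ** transpose ?V = mat 1"
  proof -
    have "(?V ** G ** transpose ?V) $ i $ j = v i \<bullet> (G *v v j)" for i j
    proof -
      have "(?V ** (G ** transpose ?V)) $ i $ j = (\<Sum>k\<in>UNIV. v i $ k * (\<Sum>l\<in>UNIV. G $ k $ l * v j $ l))"
        by (simp add: matrix_matrix_mult_def transpose_def)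
      then show ?thesis by (simp add: matrix_mul_assoc inner_vec_def matrix_vector_mult_def)
    qed
    then show ?thesis using assms by (simp add: vec_eq_iff mat_def)
  qed
  then have "det (?V ** G ** transpose ?V) = 1" by simp
  then show ?thesis by (simp add: det_mul power2_eq_square ac_simps)
qed

lemma spd_det_pos:
  fixes G :: "real^'n^'n"
  assumes "spd G"
  shows "0 < det G"
proof -
  have "transpose (0 :: real^'n^'n) = 0" by (simp add: transpose_def vec_eq_iff)
  \<comment> \<open>The zero form serves as second member of the pencil, since just some
    \<open>G\<close>-orthonormal basis is wanted.\<close>
  then obtain v l where "eigen_frame G 0 v l" using eigen_frame_exists[OF assms] by blast
  then have "(det (\<chi> i. v i))\<^sup>2 * det G = 1" by (intro orthonormal_det) (auto simp: eigen_frame_def)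
  then show ?thesis by (metis zero_less_mult_pos zero_less_one zero_le_power2 less_eq_real_def mult_eq_0_iff zero_neq_one)
qed

text \<open>A metric induces \<open>\<omega>\<close> iff its determinant is the square of the value of \<open>\<omega>\<close> on the coordinate frame.\<close>

lemma (in alternating_form) unit_volume_of_det:
  assumes nz: "\<omega> v0 \<noteq> 0" and G: "spd G"
    and unit: "\<And>v. (\<forall>i j. v i \<bullet> (G *v v j) = (if i = j then 1 else 0)) \<and> \<omega> v > 0 \<Longrightarrow> \<omega> v = 1"
    and G': "det G' = det G" and v: "\<forall>i j. v i \<bullet> (G' *v v j) = (if i = j then 1 else 0)" "\<omega> v > 0"
  shows "\<omega> v = 1"
proof -
  let ?e = "\<omega> (\<lambda>j. axis j 1)"
  have e: "?e \<noteq> 0" using nz det_axis[of v0] by auto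
  \<comment> \<open>The squared volume of an orthonormal frame times the determinant of its metric
    is a constant of the form \<open>\<omega>\<close>; squaring removes the orientation.\<close>
  have sq: "(\<omega> v)\<^sup>2 * det H = ?e\<^sup>2" if "\<forall>i j. v i \<bullet> (H *v v j) = (if i = j then 1 else 0)" for v H
  proof -
    have "(det (\<chi> i. v i))\<^sup>2 * det H = 1" using that by (intro orthonormal_det) auto
    then show ?thesis by (subst det_axis) (simp add: power_mult_distrib ac_simps)
  qed
  have "transpose (0 :: real^'n^'n) = 0" by (simp add: transpose_def vec_eq_iff)
  then obtain u l where "eigen_frame G 0 u l" using eigen_frame_exists[OF G] by blast
  then have u: "\<forall>i j. u i \<bullet> (G *v u j) = (if i = j then 1 else 0)" by (auto simp: eigen_frame_def)
  have u0: "\<omega> u \<noteq> 0" using sq[OF u] e by auto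
  have "det G = ?e\<^sup>2"
  proof (cases "\<omega> u > 0")
    case True
    then have "\<omega> u = 1" using unit u by blast
    then show ?thesis using sq[OF u] by simp
  next
    \<comment> \<open>A negatively oriented basis is corrected by reversing one vector, because
      \<open>unit\<close> speaks about positive bases only.\<close>
    case False
    obtain k :: 'n where True by blast
    define w where "w = u(k := - u k)"
    have w: "\<omega> w = - \<omega> u" using scale_slot[of u k "-1" "u k"] by (simp add: w_def)
    have on: "\<forall>i j. w i \<bullet> (G *v w j) = (if i = j then 1 else 0)"
      using u by (auto simp: w_def linear_neg[OF matrix_vector_mul_linear])
    have "\<omega> w = 1" using False u0 w on by (intro unit) auto
    then show ?thesis using sq[OF on] by simp
  qed
  then have "(\<omega> v)\<^sup>2 = 1" using sq[OF v(1)] e by (simp add: G')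
  then show ?thesis using v(2) by (simp add: power2_eq_1_iff)
qed

lemma det_scaleR_matrix: "det (r *\<^sub>R A) = r ^ CARD('n) * det A" for A :: "real^'n^'n"
proof -
  have "det ((\<chi> i. r *s (A $ i)) :: real^'n^'n) = (\<Prod>i\<in>(UNIV::'n set). r) * det ((\<chi> i. A $ i) :: real^'n^'n)"
    by (rule det_rows_mul)
  moreover have "(\<chi> i. r *s (A $ i)) = r *\<^sub>R A" by (simp add: vec_eq_iff)
  ultimately show ?thesis by simp
qed

text \<open>In the Leibniz sum a permutation other than the identity moves at least two indices. Its
  product has two factors vanishing at 0 and contributes nothing to first order.\<close>

lemma det_derivative_identity:
  fixes X :: "real^'n^'n"
  shows "((\<lambda>t. det (mat 1 + t *\<^sub>R X)) has_real_derivative trace X) (at 0)"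
proof -
  let ?U = "UNIV :: 'n set"
  let ?f = "\<lambda>p i t. (mat 1 :: real^'n^'n) $ i $ p i + t * X $ i $ p i"
  let ?d = "\<lambda>p. \<Sum>i\<in>?U. X $ i $ p i * (\<Prod>j\<in>?U - {i}. ?f p j 0)"
  have "((\<lambda>t. \<Prod>i\<in>?U. ?f p i t) has_real_derivative ?d p) (at 0)" for p
    by (rule has_field_derivative_prod) (auto intro!: derivative_eq_intros)
  then have "((\<lambda>t. \<Sum>p\<in>{p. p permutes ?U}. of_int (sign p) * (\<Prod>i\<in>?U. ?f p i t)) has_real_derivative
      (\<Sum>p\<in>{p. p permutes ?U}. of_int (sign p) * ?d p)) (at 0)"
    by (intro DERIV_sum DERIV_cmult)
  moreover have "(\<Sum>p\<in>{p. p permutes ?U}. of_int (sign p) * ?d p) = (\<Sum>p\<in>{id}. of_int (sign p) * ?d p)"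
  proof (rule sum.mono_neutral_right)
    show "\<forall>p\<in>{p. p permutes ?U} - {id}. of_int (sign p) * ?d p = 0"
    proof
      fix p assume p: "p \<in> {p. p permutes ?U} - {id}"
      then have inj: "inj p" by (auto intro: permutes_inj)
      obtain a where a: "p a \<noteq> a" using p by (auto simp: fun_eq_iff)
      \<comment> \<open>A second moved index, so that a vanishing factor remains whichever single
        index is left out.\<close>
      then have b: "p (p a) \<noteq> p a" using inj by (metis injD)
      have "(\<Prod>j\<in>?U - {i}. ?f p j 0) = 0" for i
      proof (cases "i = a")
        case True
        then show ?thesis using a b by (intro prod_zero bexI[of _ "p a"]) (auto simp: mat_def)
      next
        case False
        then show ?thesis using a by (intro prod_zero bexI[of _ a]) (auto simp: mat_def)
      qed
      then show "of_int (sign p) * ?d p = 0" by (simp only: mult_zero_right sum.neutral_const)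
    qed
  qed (auto simp: permutes_id)
  moreover have "(\<Sum>p\<in>{id}. of_int (sign p) * ?d p) = trace X" by (simp add: trace_def mat_def)
  ultimately show ?thesis by (simp add: det_def)
qed

text \<open>Jacobi's formula, reduced to the identity matrix by factoring out
  \<open>G\<close>.\<close>

lemma det_derivative:
  fixes G H :: "real^'n^'n"
  assumes "invertible G"
  shows "((\<lambda>t. det (G + t *\<^sub>R H)) has_real_derivative det G * trace (matrix_inv G ** H)) (at 0)"
proof -
  have "G + t *\<^sub>R H = G ** (mat 1 + t *\<^sub>R (matrix_inv G ** H))" for t
    using matrix_inv_works[OF assms] by (simp add: matrix_add_ldistrib matrix_scalar_ac scalar_matrix_assoc[symmetric] matrix_mul_assoc)
  then show ?thesis
    using DERIV_cmult[OF det_derivative_identity[of "matrix_inv G ** H"], of "det G"] by (simp add: det_mul)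
qed

lemma Ck_on_det:
  fixes M :: "'a::euclidean_space \<Rightarrow> real^'n^'n"
  assumes S: "open S" and M: "Ck_on n S M"
  shows "Ck_on n S (\<lambda>x. det (M x))"
proof -
  have ent: "Ck_on n S (\<lambda>x. M x $ i $ j)" for i j
    by (rule Ck_on_linear_comp[OF S _ M, of "\<lambda>X. X $ i $ j"])
      (intro bounded_linear_compose[OF bounded_linear_vec_nth] bounded_linear_vec_nth)
  show ?thesis
    unfolding det_def
    by (intro Ck_on_sum S Ck_on_bilinear[OF S bounded_bilinear_mult] Ck_on_const Ck_on_prod ent)
qed

section \<open>Smooth curves of tensor fields and the curve of constant volume\<close>

context manifold
begin

lemma local_tensor_alt:
  assumes "c \<in> \<A>" "y \<in> chart_range c"
  shows "local_tensor \<A> c a y = transpose (frame c (chart_inv c y)) ** a (chart_inv c y) ** frame c (chart_inv c y)"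
  using local_tensor_chart[OF assms(1) chartD(7)[OF assms], of a] chartD(8)[OF assms] by simp

lemma bounded_linear_congruence: "bounded_linear (\<lambda>X. transpose P ** X ** P)" for P :: "real^'n^'n"
  by (intro bounded_bilinear.bounded_linear_left[OF bounded_bilinear_matrix_mult, THEN bounded_linear_compose]
      bounded_bilinear.bounded_linear_right[OF bounded_bilinear_matrix_mult])

text \<open>Smoothness of a curve in the Frechet space asks for all time derivatives as tensor
  fields, with uniform convergence of all partials. Joint smoothness in time and space reduces this
  to one finite-dimensional function per chart.\<close>

lemma smooth_curve_of_joint:
  fixes \<gamma> :: "real \<Rightarrow> ('m, 'n) tensor_field"
  assumes I: "open I" and sym: "\<And>t x. t \<in> I \<Longrightarrow> transpose (\<gamma> t x) = \<gamma> t x"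
    and F: "\<And>c. c \<in> \<A> \<Longrightarrow> smooth_on (I \<times> chart_range c) (F c)"
    and loc: "\<And>c t y. c \<in> \<A> \<Longrightarrow> t \<in> I \<Longrightarrow> y \<in> chart_range c \<Longrightarrow> local_tensor \<A> c (\<gamma> t) y = F c (t, y)"
  shows "smooth_tensor_curve \<A> I \<gamma>"
    and "\<And>t h. t \<in> I \<Longrightarrow> (\<And>x. ((\<lambda>\<tau>. \<gamma> \<tau> x) has_vector_derivative h x) (at t)) \<Longrightarrow> tensor_curve_derivative \<A> \<gamma> h t"
proof -
  \<comment> \<open>Time derivatives are taken pointwise in preferred coordinates, which makes them
    global fields at once; \<open>loc_n\<close> then matches their chart expressions with the time
    derivatives of \<open>F\<close>.\<close>
  define \<Gamma> :: "nat \<Rightarrow> real \<Rightarrow> ('m, 'n) tensor_field"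
    where "\<Gamma> = rec_nat \<gamma> (\<lambda>n \<delta> t x. vector_derivative (\<lambda>\<tau>. \<delta> \<tau> x) (at t))"
  have \<Gamma>0: "\<Gamma> 0 = \<gamma>" and \<Gamma>S: "\<Gamma> (Suc n) t x = vector_derivative (\<lambda>\<tau>. \<Gamma> n \<tau> x) (at t)" for n t x
    by (simp_all add: \<Gamma>_def)
  let ?one = "(1, 0) :: real \<times> (real^'n)"
  define Fn where "Fn n c = iterated_partial (replicate n ?one) (F c)" for n c
  have Fn_smooth: "smooth_on (I \<times> chart_range c) (Fn n c)" if "c \<in> \<A>" for n c
    unfolding Fn_def using F[OF that] by (intro smooth_on_iterated_partial) (auto simp: Basis_prod_def)
  have FnS: "Fn (Suc n) c z = frechet_derivative (Fn n c) (at z) ?one" for n c z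
    by (simp add: Fn_def)
  have Fn_deriv: "((\<lambda>\<tau>. Fn n c (\<tau>, y)) has_vector_derivative Fn (Suc n) c (t, y)) (at t)"
    if c: "c \<in> \<A>" and t: "t \<in> I" and y: "y \<in> chart_range c" for n c t y
  proof -
    have d: "(Fn n c has_derivative frechet_derivative (Fn n c) (at (t, y))) (at (t, y))"
      using t y by (intro smooth_on_has_derivative[OF Fn_smooth[OF c]] open_Times I chartD(2)[OF c]) auto
    have "(\<lambda>k. frechet_derivative (Fn n c) (at (t, y)) (k, 0)) = (\<lambda>k. k *\<^sub>R Fn (Suc n) c (t, y))"
    proof
      fix k :: real
      show "frechet_derivative (Fn n c) (at (t, y)) (k, 0) = k *\<^sub>R Fn (Suc n) c (t, y)"
        using linear_scale[OF has_derivative_linear[OF d], of k ?one] by (simp add: FnS)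
    qed
    then show ?thesis using slice_has_derivative(2)[OF d] unfolding has_vector_derivative_def by metis
  qed
  \<comment> \<open>The pointwise derivative is computed in some chart and carried back by the
    inverse frame \<open>R\<close>, which is constant in time.\<close>
  have step: "((\<lambda>\<tau>. \<Gamma> n \<tau> x) has_vector_derivative \<Gamma> (Suc n) t x) (at t)"
    if l: "\<And>c t y. c \<in> \<A> \<Longrightarrow> t \<in> I \<Longrightarrow> y \<in> chart_range c \<Longrightarrow> local_tensor \<A> c (\<Gamma> n t) y = Fn n c (t, y)" and t: "t \<in> I"
    for n t x
  proof -
    obtain c where c: "c \<in> \<A>" "x \<in> chart_dom c" by (rule chart_around)
    obtain R where R: "\<And>X. transpose R ** (transpose (frame c x) ** X ** frame c x) ** R = X"
      using pull_inverse[OF c] by blast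
    have y: "chart_map c x \<in> chart_range c" using c by (simp add: chartD)
    have "((\<lambda>\<tau>. transpose R ** Fn n c (\<tau>, chart_map c x) ** R) has_vector_derivative
        transpose R ** Fn (Suc n) c (t, chart_map c x) ** R) (at t)"
      by (rule bounded_linear.has_vector_derivative[OF bounded_linear_congruence Fn_deriv[OF c(1) t y]])
    then have "((\<lambda>\<tau>. \<Gamma> n \<tau> x) has_vector_derivative transpose R ** Fn (Suc n) c (t, chart_map c x) ** R) (at t)"
    proof (rule has_vector_derivative_transform_within_open[OF _ I t])
      fix \<tau> assume "\<tau> \<in> I"
      then have "Fn n c (\<tau>, chart_map c x) = transpose (frame c x) ** \<Gamma> n \<tau> x ** frame c x"
        using l[OF c(1) _ y] local_tensor_chart[OF c] by simp
      then show "transpose R ** Fn n c (\<tau>, chart_map c x) ** R = \<Gamma> n \<tau> x" by (simp add: R)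
    qed
    then show ?thesis unfolding \<Gamma>S by (simp add: vector_derivative_at)
  qed
  have loc_n: "local_tensor \<A> c (\<Gamma> n t) y = Fn n c (t, y)"
    if "c \<in> \<A>" "t \<in> I" "y \<in> chart_range c" for n c t y
    using that
  proof (induction n arbitrary: c t y)
    case 0
    then show ?case by (simp add: \<Gamma>0 Fn_def loc)
  next
    case (Suc n)
    let ?x = "chart_inv c y"
    have "((\<lambda>\<tau>. local_tensor \<A> c (\<Gamma> n \<tau>) y) has_vector_derivative local_tensor \<A> c (\<Gamma> (Suc n) t) y) (at t)"
      unfolding local_tensor_alt[OF Suc.prems(1,3)]
      by (rule bounded_linear.has_vector_derivative[OF bounded_linear_congruence step[OF Suc.IH Suc.prems(2)]])
    then have "((\<lambda>\<tau>. Fn n c (\<tau>, y)) has_vector_derivative local_tensor \<A> c (\<Gamma> (Suc n) t) y) (at t)"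
      by (rule has_vector_derivative_transform_within_open[OF _ I Suc.prems(2)])
        (rule Suc.IH[OF Suc.prems(1) _ Suc.prems(3)])
    then show ?case using Fn_deriv[OF Suc.prems] by (rule vector_derivative_unique_at)
  qed
  have sym_n: "transpose (\<Gamma> n t x) = \<Gamma> n t x" if "t \<in> I" for n t x
    using that
  proof (induction n arbitrary: t)
    case 0
    then show ?case by (simp add: \<Gamma>0 sym)
  next
    case (Suc n)
    have d: "((\<lambda>\<tau>. \<Gamma> n \<tau> x) has_vector_derivative \<Gamma> (Suc n) t x) (at t)" by (rule step[OF loc_n Suc.prems])
    have "((\<lambda>\<tau>. transpose (\<Gamma> n \<tau> x)) has_vector_derivative transpose (\<Gamma> (Suc n) t x)) (at t)"
      by (rule bounded_linear.has_vector_derivative[OF bounded_linear_transpose d])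
    then have "((\<lambda>\<tau>. \<Gamma> n \<tau> x) has_vector_derivative transpose (\<Gamma> (Suc n) t x)) (at t)"
      by (rule has_vector_derivative_transform_within_open[OF _ I Suc.prems]) (rule Suc.IH)
    then show ?case using d by (rule vector_derivative_unique_at)
  qed
  have tensors: "\<Gamma> n t \<in> sym_tensors \<A>" if t: "t \<in> I" for n t
  proof -
    have "smooth_on (chart_range c) (local_tensor \<A> c (\<Gamma> n t))" if c: "c \<in> \<A>" for c
      unfolding smooth_on_def
    proof
      fix k
      have "Ck_on k (chart_range c) (\<lambda>y. Fn n c (t, y))"
        using Fn_smooth[OF c] by (intro Ck_on_slice[OF I chartD(2)[OF c] _ t]) (auto simp: smooth_on_def)
      then show "Ck_on k (chart_range c) (local_tensor \<A> c (\<Gamma> n t))"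
        by - (rule Ck_on_cong[OF chartD(2)[OF c], where F = "\<lambda>y. Fn n c (t, y)"], simp_all add: loc_n[OF c t])
    qed
    then show ?thesis by (simp add: sym_tensors_def sym_n[OF t])
  qed
  have deriv: "tensor_curve_derivative \<A> (\<Gamma> n) (\<Gamma> (Suc n) t) t" if t: "t \<in> I" for n t
    unfolding tensor_curve_derivative_def tensor_tendsto_def
  proof (intro ballI allI impI)
    fix c K bs assume c: "c \<in> \<A>" and "compact K \<and> K \<subseteq> chart_range c \<and> set bs \<subseteq> (Basis :: (real^'n) set)"
    then have K: "compact K" "K \<subseteq> chart_range c" and bs: "set bs \<subseteq> (Basis :: (real^'n) set)" by auto
    note U = chartD(2)[OF c]
    have "\<forall>\<^sub>F s in at 0. s \<in> (\<lambda>s. t + s) -` I"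
      using t I by (intro eventually_at_in_open' open_vimage continuous_intros) auto
    then have "\<forall>\<^sub>F s in at 0. \<forall>y\<in>K. iterated_partial bs (local_tensor \<A> c (\<lambda>x. (\<Gamma> n (t + s) x - \<Gamma> n t x) /\<^sub>R s)) y
        = iterated_partial bs (\<lambda>y. (Fn n c (t + s, y) - Fn n c (t, y)) /\<^sub>R s) y"
    proof eventually_elim
      case (elim s)
      show ?case
      proof
        fix y assume "y \<in> K"
        then show "iterated_partial bs (local_tensor \<A> c (\<lambda>x. (\<Gamma> n (t + s) x - \<Gamma> n t x) /\<^sub>R s)) y
            = iterated_partial bs (\<lambda>y. (Fn n c (t + s, y) - Fn n c (t, y)) /\<^sub>R s) y"
          using K elim t by (intro iterated_partial_cong[OF U]) (auto simp: local_tensor_diff_quotient loc_n[OF c])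
      qed
    qed
    moreover have "iterated_partial bs (local_tensor \<A> c (\<Gamma> (Suc n) t)) y
        = iterated_partial bs (\<lambda>y. frechet_derivative (Fn n c) (at (t, y)) ?one) y" if "y \<in> K" for y
      using K that by (intro iterated_partial_cong[OF U]) (auto simp: loc_n[OF c t] FnS)
    ultimately show "uniform_limit K (\<lambda>s. iterated_partial bs (local_tensor \<A> c (\<lambda>x. (\<Gamma> n (t + s) x - \<Gamma> n t x) /\<^sub>R s)))
        (iterated_partial bs (local_tensor \<A> c (\<Gamma> (Suc n) t))) (at 0)"
      using uniform_partials_of_quotient[OF I U Fn_smooth[OF c] t K bs, of n]
      by (subst uniform_limit_cong) assumption+
  qed
  show "smooth_tensor_curve \<A> I \<gamma>"
    unfolding smooth_tensor_curve_def using \<Gamma>0 tensors deriv by blast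
  fix t h assume t: "t \<in> I" and h: "\<And>x. ((\<lambda>\<tau>. \<gamma> \<tau> x) has_vector_derivative h x) (at t)"
  have "\<Gamma> (Suc 0) t = h" using h by (auto simp: \<Gamma>S \<Gamma>0 vector_derivative_at)
  then show "tensor_curve_derivative \<A> \<gamma> h t" using deriv[OF t, of 0] by (simp add: \<Gamma>0)
qed

text \<open>Positivity is an open condition on matrices in a chart, made uniform by compactness. The
  filter \<open>nhds 0\<close> in place of \<open>at 0\<close> includes the value
  \<open>t = 0\<close>.\<close>

lemma spd_line:
  assumes comp: "compact (UNIV :: 'm set)" and g: "cont_tensor g" "\<And>x. spd (g x)" and h: "cont_tensor h"
  obtains \<epsilon> where "0 < \<epsilon>" "\<And>t x. \<bar>t\<bar> < \<epsilon> \<Longrightarrow> spd (g x + t *\<^sub>R h x)"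
proof -
  have "\<forall>\<^sub>F t in nhds 0. \<forall>x. spd (g x + t *\<^sub>R h x)"
  proof (rule eventually_all_of_local[OF comp])
    fix x0
    obtain c where c: "c \<in> \<A>" "x0 \<in> chart_dom c" by (rule chart_around)
    have s0: "spd (chart_rep c g x0)" using spd_chart_rep[OF c] g by simp
    obtain \<kappa> where \<kappa>: "\<kappa> > 0" "\<And>G. transpose G = G \<Longrightarrow> norm (G - chart_rep c g x0) < \<kappa> \<Longrightarrow> spd G"
      by (rule spd_nearby[OF s0]) (rule that)
    have "isCont (chart_rep c g) x0" "isCont (chart_rep c h) x0"
      using chart_rep_continuous[OF g(1) c(1)] chart_rep_continuous[OF h c(1)] c chartD(1)[OF c(1)]
      by (auto simp: continuous_on_eq_continuous_at)
    then have lim: "(chart_rep c g \<longlongrightarrow> chart_rep c g x0) (nhds x0)" "(chart_rep c h \<longlongrightarrow> chart_rep c h x0) (nhds x0)"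
      by (auto simp: isCont_def intro: tendsto_nhds_iff[THEN iffD2])
    define M where "M = norm (chart_rep c h x0) + 1"
    have M: "M > 0" by (simp add: M_def add_nonneg_pos)
    have "\<forall>\<^sub>F x in nhds x0. x \<in> chart_dom c" using c chartD(1) by (intro eventually_nhds_in_open) auto
    moreover have "\<forall>\<^sub>F x in nhds x0. dist (chart_rep c g x) (chart_rep c g x0) < \<kappa> / 2" "\<forall>\<^sub>F x in nhds x0. dist (chart_rep c h x) (chart_rep c h x0) < 1"
      by (rule tendstoD, rule lim, use \<kappa> in simp)+
    ultimately have "\<forall>\<^sub>F x in nhds x0. x \<in> chart_dom c \<and> norm (chart_rep c g x - chart_rep c g x0) < \<kappa> / 2 \<and> norm (chart_rep c h x) \<le> M"
    proof eventually_elim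
      case (elim x)
      then show ?case using norm_triangle_sub[of "chart_rep c h x" "chart_rep c h x0"] by (simp add: M_def dist_norm)
    qed
    then obtain U where U: "open U" "x0 \<in> U"
      "\<And>x. x \<in> U \<Longrightarrow> x \<in> chart_dom c \<and> norm (chart_rep c g x - chart_rep c g x0) < \<kappa> / 2 \<and> norm (chart_rep c h x) \<le> M"
      unfolding eventually_nhds by blast
    have "\<forall>\<^sub>F t in nhds (0::real). t \<in> ball 0 (\<kappa> / (2 * M))" using \<kappa> M by (intro eventually_nhds_in_open) auto
    then have "\<forall>\<^sub>F t in nhds 0. \<forall>x\<in>U. spd (g x + t *\<^sub>R h x)"
    proof eventually_elim
      case (elim t)
      have tM: "\<bar>t\<bar> * M < \<kappa> / 2" using elim M by (simp add: field_simps)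
      show ?case
      proof
        fix x assume x: "x \<in> U"
        have xc: "x \<in> chart_dom c" using U(3)[OF x] by blast
        have "cont_tensor (\<lambda>x. g x + t *\<^sub>R h x)" by (rule cont_tensor_add_scaleR[OF g(1) h])
        then have s: "transpose (chart_rep c (\<lambda>x. g x + t *\<^sub>R h x) x) = chart_rep c (\<lambda>x. g x + t *\<^sub>R h x) x"
          by (intro transpose_chart_rep[OF c(1) xc]) (simp add: cont_tensor_def)
        have "chart_rep c (\<lambda>x. g x + t *\<^sub>R h x) x = chart_rep c g x + t *\<^sub>R chart_rep c h x"
          unfolding chart_rep_congruence[OF c(1) xc]
          by (simp add: matrix_add_ldistrib matrix_add_rdistrib scalar_matrix_assoc[symmetric] matrix_scalar_ac)
        then have "chart_rep c (\<lambda>x. g x + t *\<^sub>R h x) x - chart_rep c g x0 = (chart_rep c g x - chart_rep c g x0) + t *\<^sub>R chart_rep c h x" by simp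
        then have "norm (chart_rep c (\<lambda>x. g x + t *\<^sub>R h x) x - chart_rep c g x0) \<le> norm (chart_rep c g x - chart_rep c g x0) + \<bar>t\<bar> * norm (chart_rep c h x)"
          using norm_triangle_ineq[of "chart_rep c g x - chart_rep c g x0" "t *\<^sub>R chart_rep c h x"] by (simp only: norm_scaleR)
        also have "\<dots> \<le> norm (chart_rep c g x - chart_rep c g x0) + \<bar>t\<bar> * M" using U(3)[OF x] by (intro add_left_mono mult_left_mono) auto
        also have "\<dots> < \<kappa>" using U(3)[OF x] tM by linarith
        finally show "spd (g x + t *\<^sub>R h x)" using \<kappa>(2)[OF s] spd_chart_rep[OF c(1) xc, of "\<lambda>x. g x + t *\<^sub>R h x"] by simp
      qed
    qed
    then show "\<exists>U. open U \<and> x0 \<in> U \<and> (\<forall>\<^sub>F t in nhds 0. \<forall>x\<in>U. spd (g x + t *\<^sub>R h x))" using U by blast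
  qed
  then obtain \<epsilon> where "\<epsilon> > 0" "\<And>t. dist t 0 < \<epsilon> \<Longrightarrow> \<forall>x. spd (g x + t *\<^sub>R h x)"
    unfolding eventually_nhds_metric by blast
  then show thesis by (intro that[of \<epsilon>]) (auto simp: dist_real_def)
qed

text \<open>The determinants are taken in preferred charts and may each be irregular in
  \<open>x\<close>; only their ratio is intrinsic. The exponents come from the fact that scaling by
  \<open>r\<close> multiplies a determinant by \<open>r ^ CARD('n)\<close>.\<close>

definition volume_curve :: "('m, 'n) tensor_field \<Rightarrow> ('m, 'n) tensor_field \<Rightarrow> real \<Rightarrow> ('m, 'n) tensor_field" where
  "volume_curve g h t x =
     (det (g x + t *\<^sub>R h x) powr (- (1 / CARD('n))) * det (g x) powr (1 / CARD('n))) *\<^sub>R (g x + t *\<^sub>R h x)"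

text \<open>Both determinants acquire the factor \<open>(det P)\<^sup>2\<close>, which cancels, so
  the scaling factor may be computed in any chart.\<close>

lemma volume_curve_factor:
  fixes G H P :: "real^'n^'n"
  assumes "0 < det G" "0 < det H" "invertible P"
  shows "det (transpose P ** H ** P) powr (- a) * det (transpose P ** G ** P) powr a = det H powr (- a) * det G powr a"
proof -
  have "det P \<noteq> 0" using assms(3) by (simp add: invertible_det_nz)
  then have p: "0 < (det P)\<^sup>2" by simp
  have d: "det (transpose P ** X ** P) = (det P)\<^sup>2 * det X" for X :: "real^'n^'n"
    by (simp add: det_mul power2_eq_square)
  show ?thesis
    unfolding d using assms p by (simp add: powr_mult powr_minus field_simps)
qed

lemma volume_curve_det:
  assumes "spd (g x)" "spd (g x + t *\<^sub>R h x)"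
  shows "det (volume_curve g h t x) = det (g x)"
proof -
  let ?n = "CARD('n)"
  have p: "0 < det (g x)" "0 < det (g x + t *\<^sub>R h x)" using assms by (auto intro: spd_det_pos)
  have n: "0 < ?n" by simp
  have "(det (g x + t *\<^sub>R h x) powr (- (1 / ?n)) * det (g x) powr (1 / ?n)) ^ ?n
      = det (g x + t *\<^sub>R h x) powr (- 1) * det (g x) powr 1"
    using p n by (simp add: power_mult_distrib powr_power)
  then show ?thesis
    using p by (simp add: volume_curve_def det_scaleR_matrix powr_minus)
qed

lemma volume_curve_0:
  assumes "spd (g x)"
  shows "volume_curve g h 0 x = g x"
  using spd_det_pos[OF assms] by (simp add: volume_curve_def powr_minus)

text \<open>By Jacobi's formula zero trace makes the determinant stationary at 0. The scaling factor
  then has value 1 and derivative 0 there, and the velocity is that of the affine line.\<close>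

lemma volume_curve_derivative:
  assumes g: "spd (g x)" and tr: "trace (matrix_inv (g x) ** h x) = 0"
  shows "((\<lambda>t. volume_curve g h t x) has_vector_derivative h x) (at 0)"
proof -
  let ?a = "1 / CARD('n)"
  let ?r = "\<lambda>t. det (g x + t *\<^sub>R h x) powr (- ?a) * det (g x) powr ?a"
  have p: "0 < det (g x)" using g by (rule spd_det_pos)
  have d: "((\<lambda>t. det (g x + t *\<^sub>R h x)) has_real_derivative 0) (at 0)"
    using det_derivative[OF spd_invertible[OF g], of "h x"] tr by simp
  have "((\<lambda>t. det (g x + t *\<^sub>R h x) powr (- ?a)) has_real_derivative
      (- ?a * det (g x + 0 *\<^sub>R h x) powr (- ?a - 1)) * 0) (at 0)"
    using p by (intro DERIV_chain2[OF has_real_derivative_powr d]) simp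
  then have r: "(?r has_real_derivative 0) (at 0)" using DERIV_cmult_right by fastforce
  have l: "((\<lambda>t. g x + t *\<^sub>R h x) has_vector_derivative h x) (at 0)"
    by (auto intro!: derivative_eq_intros)
  have "?r 0 = 1" using p by (simp add: powr_minus)
  then show ?thesis
    unfolding volume_curve_def using has_vector_derivative_scaleR[OF r l] by simp
qed

text \<open>In a chart the curve is built from tensors affine in \<open>t\<close>, their
  determinants and real powers of positive functions, hence is jointly smooth in time and
  space.\<close>

lemma volume_curve_smooth:
  assumes g: "g \<in> sym_tensors \<A>" and h: "h \<in> sym_tensors \<A>" and \<epsilon>: "0 < \<epsilon>"
    and spd: "\<And>t x. \<bar>t\<bar> < \<epsilon> \<Longrightarrow> spd (g x + t *\<^sub>R h x)"
    and tr: "\<And>x. trace (matrix_inv (g x) ** h x) = 0"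
  shows "smooth_tensor_curve \<A> {-\<epsilon><..<\<epsilon>} (volume_curve g h)" "tensor_curve_derivative \<A> (volume_curve g h) h 0"
proof -
  let ?a = "1 / CARD('n)" and ?I = "{-\<epsilon><..<\<epsilon>}"
  have spd0: "spd (g x)" for x using spd[of 0 x] \<epsilon> by simp
  define L where "L c z = local_tensor \<A> c g (snd z) + fst z *\<^sub>R local_tensor \<A> c h (snd z)" for c and z :: "real \<times> (real^'n)"
  define F where "F c z = (det (L c z) powr (- ?a) * det (local_tensor \<A> c g (snd z)) powr ?a) *\<^sub>R L c z" for c z
  have L: "L c (t, y) = transpose (frame c (chart_inv c y)) ** (g (chart_inv c y) + t *\<^sub>R h (chart_inv c y)) ** frame c (chart_inv c y)"
    if "c \<in> \<A>" "y \<in> chart_range c" for c t y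
    unfolding L_def using local_tensor_alt[OF that]
    by (simp add: matrix_add_ldistrib matrix_add_rdistrib scalar_matrix_assoc[symmetric] matrix_scalar_ac)
  have inv: "invertible (frame c (chart_inv c y))" if "c \<in> \<A>" "y \<in> chart_range c" for c y
    using that by (intro frame_invertible chartD)
  have loc: "local_tensor \<A> c (volume_curve g h t) y = F c (t, y)"
    if c: "c \<in> \<A>" and t: "t \<in> ?I" and y: "y \<in> chart_range c" for c t y
  proof -
    let ?x = "chart_inv c y"
    have "0 < det (g ?x)" "0 < det (g ?x + t *\<^sub>R h ?x)" using spd t spd0 by (auto intro!: spd_det_pos)
    from volume_curve_factor[OF this inv[OF c y], of ?a] show ?thesis
      unfolding F_def L[OF c y] local_tensor_alt[OF c y] snd_conv volume_curve_def
      by (simp add: matrix_scalar_ac scalar_matrix_assoc[symmetric])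
  qed
  have smooth: "smooth_on (?I \<times> chart_range c) (F c)" if c: "c \<in> \<A>" for c
    unfolding smooth_on_def
  proof
    fix k
    let ?S = "?I \<times> chart_range c"
    have I: "open ?I" and U: "open (chart_range c)" using chartD(2)[OF c] by auto
    have S: "open ?S" using I U by (rule open_Times)
    have lg: "Ck_on k ?S (\<lambda>z. local_tensor \<A> c g (snd z))" "Ck_on k ?S (\<lambda>z. local_tensor \<A> c h (snd z))"
      using g h c by (auto intro!: Ck_on_snd I U simp: sym_tensors_def smooth_on_def)
    have Lk: "Ck_on k ?S (L c)"
      unfolding L_def by (intro Ck_on_add Ck_on_bilinear[OF S bounded_bilinear_scaleR] S lg Ck_on_bounded_linear bounded_linear_fst)
    have p1: "0 < det (L c z)" if "z \<in> ?S" for z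
    proof -
      obtain t y where z: "z = (t, y)" "t \<in> ?I" "y \<in> chart_range c" using \<open>z \<in> ?S\<close> by auto
      have "spd (L c z)" unfolding z(1) L[OF c z(3)] using spd_congruence[OF inv[OF c z(3)]] spd z(2) by auto
      then show ?thesis by (rule spd_det_pos)
    qed
    have p2: "0 < det (local_tensor \<A> c g (snd z))" if "z \<in> ?S" for z
    proof -
      have y: "snd z \<in> chart_range c" using that by auto
      have "spd (local_tensor \<A> c g (snd z))" unfolding local_tensor_alt[OF c y]
        using spd_congruence[OF inv[OF c y]] spd0 by auto
      then show ?thesis by (rule spd_det_pos)
    qed
    show "Ck_on k ?S (F c)"
      unfolding F_def
      by (rule Ck_on_bilinear[OF S bounded_bilinear_scaleR _ Lk], rule Ck_on_bilinear[OF S bounded_bilinear_mult];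
          rule Ck_on_powr[OF S Ck_on_det[OF S]]) (use Lk lg p1 p2 in auto)
  qed
  have sym: "transpose (volume_curve g h t x) = volume_curve g h t x" if "t \<in> ?I" for t x
  proof -
    have "transpose (g x + t *\<^sub>R h x) = g x + t *\<^sub>R h x" using spd[of t x] that by (auto simp: spd_def)
    then show ?thesis
      unfolding volume_curve_def by (simp only: linear_scale[OF bounded_linear.linear[OF bounded_linear_transpose]])
  qed
  note joint = smooth_curve_of_joint[where \<gamma> = "volume_curve g h" and I = ?I and F = F, OF _ sym smooth loc]
  show "smooth_tensor_curve \<A> ?I (volume_curve g h)" by (rule joint(1)) auto
  show "tensor_curve_derivative \<A> (volume_curve g h) h 0"
    using \<epsilon> by (intro joint(2) volume_curve_derivative spd0 tr) auto
qed

text \<open>This supplies the nonvacuity clause of \<open>has_directional_derivative\<close>. Volume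
  is preserved because the determinant at each point stays that of \<open>g\<close>.\<close>

lemma volume_curve_through:
  assumes comp: "compact (UNIV :: 'm set)" and vol: "volume_form \<A> \<omega>"
    and g: "g \<in> metrics_inducing \<A> \<omega>" and h: "h \<in> tangent_metrics_inducing \<A> g"
  shows "smooth_curve_through \<A> (metrics_inducing \<A> \<omega>) g h (volume_curve g h)"
proof -
  have vol1: "\<forall>x v i. linear (\<lambda>u. \<omega> x (v(i := u)))"
    and vol2: "\<forall>x v i j. i \<noteq> j \<and> v i = v j \<longrightarrow> \<omega> x v = 0"
    using vol unfolding volume_form_def by - (elim conjE, assumption)+
  have gm: "g \<in> metrics \<A>" and gs: "g \<in> sym_tensors \<A>" using g by (auto simp: metrics_inducing_def metrics_def)
  have hs: "h \<in> sym_tensors \<A>" and tr: "\<And>x. trace (matrix_inv (g x) ** h x) = 0"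
    using h by (auto simp: tangent_metrics_inducing_def)
  have spd: "spd (g x)" for x using gm by (rule metrics_spd)
  obtain \<epsilon> where \<epsilon>: "0 < \<epsilon>" "\<And>t x. \<bar>t\<bar> < \<epsilon> \<Longrightarrow> spd (g x + t *\<^sub>R h x)"
    using spd_line[OF comp sym_tensors_cont[OF gs] spd sym_tensors_cont[OF hs]] by blast
  note sm = volume_curve_smooth[OF gs hs \<epsilon> tr]
  have "volume_curve g h t \<in> metrics_inducing \<A> \<omega>" if t: "t \<in> {-\<epsilon><..<\<epsilon>}" for t
  proof -
    have st: "spd (g x + t *\<^sub>R h x)" for x using \<epsilon>(2) t by auto
    have "volume_curve g h t \<in> sym_tensors \<A>" using sm(1) t unfolding smooth_tensor_curve_def by metis
    moreover have "0 < ginner (volume_curve g h t x) v v" if "v \<noteq> 0" for x v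
    proof -
      have "0 < det (g x + t *\<^sub>R h x) powr (- (1 / CARD('n))) * det (g x) powr (1 / CARD('n))"
        using spd_det_pos[OF st] spd_det_pos[OF spd] by (intro mult_pos_pos) (simp_all add: less_imp_neq[symmetric])
      moreover have "0 < v \<bullet> ((g x + t *\<^sub>R h x) *v v)" using st that unfolding spd_def by blast
      ultimately show ?thesis
        unfolding volume_curve_def ginner_eq scaleR_matrix_vector_assoc[symmetric] inner_scaleR_right by (rule mult_pos_pos)
    qed
    ultimately have m: "volume_curve g h t \<in> metrics \<A>" by (simp add: metrics_def)
    have "\<omega> x v = 1" if v: "(\<forall>i j. ginner (volume_curve g h t x) (v i) (v j) = (if i = j then 1 else 0)) \<and> \<omega> x v > 0" for x v
    proof -
      interpret A: alternating_form "\<omega> x"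
        by (rule alternating_form.intro) (rule vol1[rule_format], use vol2 in blast)
      obtain v0 where v0: "\<omega> x v0 \<noteq> 0" using vol unfolding volume_form_def by blast
      have unit: "\<omega> x v = 1" if "(\<forall>i j. v i \<bullet> (g x *v v j) = (if i = j then 1 else 0)) \<and> \<omega> x v > 0" for v
        using g that unfolding metrics_inducing_def ginner_eq by blast
      show ?thesis
        using v unfolding ginner_eq
        by (intro A.unit_volume_of_det[OF v0 spd unit volume_curve_det[OF spd st]]) auto
    qed
    then show ?thesis using m by (simp add: metrics_inducing_def)
  qed
  moreover have "volume_curve g h 0 = g" using volume_curve_0[OF spd] by auto
  ultimately show ?thesis
    unfolding smooth_curve_through_def using \<epsilon>(1) sm by blast
qed

end

section \<open>The directional derivative\<close>

theorem theorem6p1: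
  fixes \<A> :: "('m::{t2_space,second_countable_topology}, 'n::finite) chart set"
    and f :: "'m \<Rightarrow> 'm"
    and \<mu> :: "'m measure"
    and \<omega> :: "'m \<Rightarrow> ('n \<Rightarrow> real ^ 'n) \<Rightarrow> real"
    and g :: "('m, 'n) tensor_field"
    and k :: nat
  assumes "compact (UNIV :: 'm set)"
    and "smooth_atlas \<A>"
    and "orientable \<A>"
    and "C1_diffeomorphism \<A> f"
    and "prob_space \<mu>" and "sets \<mu> = sets borel" and "distr \<mu> \<mu> f = \<mu>"
    and "volume_form \<A> \<omega>"
    and "g \<in> metrics_inducing \<A> \<omega>"
    and "k \<in> {1..CARD('n) - 1}"
    and "\<And>x. sv \<A> f g k x > sv \<A> f g (k + 1) x"
  shows "(\<forall>h \<in> tangent_metrics_inducing \<A> g. \<exists>D.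
            has_directional_derivative \<A> (metrics_inducing \<A> \<omega>) (s_functional \<A> k f \<mu>) g h D) \<and>
         (\<forall>h \<in> tangent_metrics_inducing \<A> g.
            integrable \<mu>
              (\<lambda>x. tensor_inner (g x)
                     (tensor_of_map (g x) (\<lambda>v. Q_left \<A> f g k x v - Q_right \<A> f g k x v)) (h x)) \<and>
            has_directional_derivative \<A> (metrics_inducing \<A> \<omega>) (s_functional \<A> k f \<mu>) g h
              (1 / 2 * (\<integral>x. tensor_inner (g x)
                     (tensor_of_map (g x) (\<lambda>v. Q_left \<A> f g k x v - Q_right \<A> f g k x v)) (h x) \<partial>\<mu>)))"
proof -
  interpret C1_dynamics \<A> f
    using assms(2,4) by unfold_locales (auto simp: C1_diffeomorphism_def)
  have gs: "g \<in> sym_tensors \<A>" and gm: "g \<in> metrics \<A>"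
    using assms(9) by (auto simp: metrics_inducing_def metrics_def)
  have spd: "spd (g x)" for x using gm by (rule metrics_spd)
  have f: "bij f" "continuous_on UNIV (inv f)"
    using assms(4) by (auto simp: C1_diffeomorphism_def C1_map_def)
  have gap: "singular_value (k + 1) (g x) (g (f x)) (tangent_map \<A> f x)
      < singular_value k (g x) (g (f x)) (tangent_map \<A> f x)" for x
    using assms(11)[of x] by (simp add: sv_def)
  have k: "1 \<le> k" "k < CARD('n)" using assms(10) by auto
  let ?N = "metrics_inducing \<A> \<omega>"
  have "integrable \<mu> (\<lambda>x. left_term g k h x - right_term g k h x) \<and>
      has_directional_derivative \<A> ?N (s_functional \<A> k f \<mu>) g h
        (1 / 2 * (\<integral>x. left_term g k h x - right_term g k h x \<partial>\<mu>))"
    if h: "h \<in> tangent_metrics_inducing \<A> g" for h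
  proof
    have hs: "h \<in> sym_tensors \<A>" using h by (simp add: tangent_metrics_inducing_def)
    have through: "smooth_curve_through \<A> ?N g h (volume_curve g h)"
      by (rule volume_curve_through[OF assms(1,8,9) h])
    have start: "\<gamma> 0 = g" and C0: "C0_curve \<gamma> h" if "smooth_curve_through \<A> ?N g h \<gamma>" for \<gamma>
      using that smooth_curve_C0[OF that hs] by (auto simp: smooth_curve_through_def)
    \<comment> \<open>The value depends on the curve only through its velocity \<open>h\<close>, so
      all admissible curves give the same number.\<close>
    have d: "integrable \<mu> (\<lambda>x. left_term g k h x - right_term g k h x)"
      "((\<lambda>t. s_functional \<A> k f \<mu> (\<gamma> t)) has_real_derivative
        (1 / 2 * (\<integral>x. left_term g k h x - right_term g k h x \<partial>\<mu>))) (at 0)"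
      if "smooth_curve_through \<A> ?N g h \<gamma>" for \<gamma>
      by (rule derivative_along_curve[OF assms(1) sym_tensors_cont[OF gs] spd f gap k sym_tensors_cont[OF hs]
            start[OF that] C0[OF that] assms(5-7)])+
    show "integrable \<mu> (\<lambda>x. left_term g k h x - right_term g k h x)" by (rule d(1)[OF through])
    show "has_directional_derivative \<A> ?N (s_functional \<A> k f \<mu>) g h
        (1 / 2 * (\<integral>x. left_term g k h x - right_term g k h x \<partial>\<mu>))"
      unfolding has_directional_derivative_def using through d(2) by blast
  qed
  then show ?thesis
    unfolding integrand_eq[OF spd f(1) gap k] by blast
qed

end
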